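(* Let $A$ be an $SU(2)^2\times U(1)$-invariant $G_2$-instanton with gauge group $SU(2)$, defined in a neighbourhood of $\{0\}\times S^3$ in the BGGG $G_2$-manifold $\mathbb{R}^4\times S^3$ and extending smoothly over $\{0\}\times S^3$ on $P_1$; so $$A=A_1f^+T_1\otimes\eta_1^++A_2g^+(T_2\otimes\eta_2^++T_3\otimes\eta_3^+),\qquad f^+=f_1^+t+O(t^3),\quad g^+=g_1^+t+O(t^3)$$ with $(f_1^+,g_1^+)\in\mathbb{R}^2$. If $f_1^+\ge\frac12+g_1^+>\frac12$, then $A$ extends globally to $\mathbb{R}^4\times S^3$ with bounded curvature.
   Context: Conventions: $SU(2)$ is identified with the unit quaternions; $\{T_i\}_{i=1}^3$ is a basis of $\mathfrak{su}(2)$ with $[T_i,T_j]=2\epsilon_{ijk}T_k$; $T_i^{\pm}=(T_i,\pm T_i)$; $\{\eta_i^{\pm}\}$ are the left-invariant 1-forms on $SU(2)^2$ dual to $\{T_i^{\pm}\}$. Manifold: $\mathbb{R}^4\times S^3\subset\mathbb{H}\times\mathbb{H}$ with $SU(2)^2$ acting by $(a_1,a_2)\cdot(p,q)=(a_1p,a_1q\bar a_2)$; the complement of $\{0\}\times S^3\cong SU(2)^2/\Delta SU(2)$ is identified with $\mathbb{R}^+_t\times SU(2)^2$ via $(t,a_1,a_2)\mapsto(ta_1,a_1\bar a_2)$. The extra $U(1)$ acts on $SU(2)^2$ by right multiplication by the diagonal one-parameter subgroup generated by $T_1^+$. BGGG structure: define $r\in[9/4,\infty)$ by $t(r)=\int_{9/4}^r\frac{\sqrt{(s-3/4)(s+3/4)}}{\sqrt{(s-9/4)(s+9/4)}}ds$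 and $$A_1=\frac{\sqrt{(r-9/4)(r+9/4)}}{\sqrt{(r-3/4)(r+3/4)}},\quad A_2=A_3=\sqrt{\tfrac{(r-9/4)(r+3/4)}{3}},\quad B_1=\tfrac{2r}{3},\quad B_2=B_3=\sqrt{\tfrac{(r-3/4)(r+9/4)}{3}}.$$ With $\omega=4\sum_iA_iB_i\eta_i^-\wedge\eta_i^+$, $\Omega_1=8B_1B_2B_3\eta_{123}^--4\sum\epsilon_{ijk}A_iA_jB_k\eta_i^+\wedge\eta_j^+\wedge\eta_k^-$, $\Omega_2=-8A_1A_2A_3\eta_{123}^++4\sum\epsilon_{ijk}B_iB_jA_k\eta_i^-\wedge\eta_j^-\wedge\eta_k^+$, the $G_2$-structure is $\varphi=dt\wedge\omega+\Omega_1$, $\psi=*\varphi=\frac12\omega^2-dt\wedge\Omega_2$, with metric $g=dt^2+\sum_i(2A_i)^2(\eta_i^+)^2+(2B_i)^2(\eta_i^-)^2$. A $G_2$-instanton is a connection with $F_A\wedge\psi=0$. $P_1=SU(2)^2\times_{(\Delta SU(2),1)}SU(2)$ (trivial isotropy homomorphism), pulled back from $S^3$ to $\mathbb{R}^4\times S^3$. Every $SU(2)^2\times U(1)$-invariant $G_2$-instanton with gauge group $SU(2)$ near $\{0\}\times S^3$ extending smoothly on $P_1$ is, up to invariant gauge transformation, of the displayed form, where $f^+,g^+$ solve $$\dot f^++\tfrac12\Big(\tfrac{A_1}{B_2^2}-\tfrac{A_1}{A_2^2}\Big)f^+=-(g^+)^2,\qquad \dot g^++\tfrac12\Big(\tfrac{A_2^2+B_1^2+B_2^2}{A_2B_1B_2}-\tfrac{A_1^2+2A_2^2}{A_1A_2^2}\Big)g^+=-f^+g^+,$$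 and is uniquely determined by $(f_1^+,g_1^+)\in\mathbb{R}^2$. Bounded curvature means $|F_A|_g$ is a bounded function. *)

theory Defs
  imports "HOL-Analysis.Analysis" "HOL-Library.Landau_Symbols"
begin

text \<open>A quaternion is a pair (real part, imaginary part); the Euclidean structure of the product
  type is the standard one. SU(2) is the set of quaternions of norm 1 and su(2) is the space
  of imaginary quaternions, i.e. \<^typ>\<open>real^3\<close> with the commutator bracket.\<close>

type_synonym quat = "real \<times> (real^3)"

fun qmul :: "quat \<Rightarrow> quat \<Rightarrow> quat" where
  "qmul (a, u) (b, v) = (a * b - u \<bullet> v, a *\<^sub>R v + b *\<^sub>R u + cross3 u v)"

fun qcnj :: "quat \<Rightarrow> quat" where
  "qcnj (a, u) = (a, - u)"

definition T :: "3 \<Rightarrow> real^3" where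
  "T i = axis i 1"

definition bracket :: "real^3 \<Rightarrow> real^3 \<Rightarrow> real^3" where
  "bracket u v = snd (qmul (0, u) (0, v) - qmul (0, v) (0, u))"

definition Ad :: "quat \<Rightarrow> real^3 \<Rightarrow> real^3" where
  "Ad a u = snd (qmul (qmul a (0, u)) (qcnj a))"

definition expT1 :: "real \<Rightarrow> quat" where
  "expT1 \<theta> = (cos \<theta>, sin \<theta> *\<^sub>R T 1)"

definition levi_civita :: "3 \<Rightarrow> 3 \<Rightarrow> 3 \<Rightarrow> real" where
  "levi_civita i j k = cross3 (axis i 1) (axis j 1) $ k"

lemma bracket_T: "bracket (T i) (T j) = 2 *\<^sub>R (\<Sum>k\<in>UNIV. levi_civita i j k *\<^sub>R T k)"
proof -
  have "cross3 (T i) (T j) = (\<Sum>k\<in>UNIV. levi_civita i j k *\<^sub>R T k)"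
    using basis_expansion[of "cross3 (T i) (T j)"]
    by (simp add: levi_civita_def T_def scalar_mult_eq_scaleR)
  moreover have "bracket (T i) (T j) = 2 *\<^sub>R cross3 (T i) (T j)"
    by (simp add: bracket_def cross_skew[of "T j" "T i"] scaleR_2)
  ultimately show ?thesis by simp
qed

text \<open>Points and tangent vectors of \<open>\<real>\<^sup>4 \<times> S\<^sup>3\<close> both live in the ambient space
  \<open>\<bbbH> \<times> \<bbbH>\<close>. Every function of a tangent vector below is only meaningful on
  \<open>tangent x\<close>, and only there is it constrained.\<close>

type_synonym amb = "quat \<times> quat"

definition M :: "amb set" where
  "M = {(p, q). norm q = 1}"

definition tangent :: "amb \<Rightarrow> amb set" where
  "tangent x = {(v, w). snd x \<bullet> w = 0}"

text \<open>The open tube of radius \<open>\<epsilon>\<close> about the singular orbit \<open>{0} \<times> S\<^sup>3\<close>. Every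
  neighbourhood of the (compact) singular orbit contains one.\<close>

definition tube :: "real \<Rightarrow> amb set" where
  "tube \<epsilon> = {x \<in> M. norm (fst x) < \<epsilon>}"

primrec Ck_on :: "nat \<Rightarrow> 'a::euclidean_space set \<Rightarrow> ('a \<Rightarrow> 'b::real_normed_vector) \<Rightarrow> bool" where
  "Ck_on 0 S f \<longleftrightarrow> continuous_on S f"
| "Ck_on (Suc n) S f \<longleftrightarrow>
     (\<forall>x\<in>S. f differentiable (at x)) \<and> (\<forall>v. Ck_on n S (\<lambda>x. frechet_derivative f (at x) v))"

text \<open>To be used for open sets \<open>S\<close>.\<close>

definition smooth_on :: "'a::euclidean_space set \<Rightarrow> ('a \<Rightarrow> 'b::real_normed_vector) \<Rightarrow> bool" where
  "smooth_on S f \<longleftrightarrow> (\<forall>n. Ck_on n S f)"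

text \<open>The smooth retraction of \<open>\<bbbH> \<times> (\<bbbH> - {0})\<close> onto \<open>M\<close>.\<close>

definition retr :: "amb \<Rightarrow> amb" where
  "retr x = (fst x, snd x /\<^sub>R norm (snd x))"

text \<open>The bundle \<open>P\<^sub>1 = SU(2)\<^sup>2 \<times>\<^bsub>(\<Delta>SU(2),1)\<^esub> SU(2)\<close> has trivial isotropy
  homomorphism, so \<open>[(a\<^sub>1, a\<^sub>2), h] \<mapsto> (a\<^sub>1 a\<^sub>2\<^sup>-\<^sup>1, h)\<close> identifies it canonically with
  \<open>S\<^sup>3 \<times> SU(2)\<close>, the group \<open>SU(2)\<^sup>2\<close> acting trivially on the fibre. In this global
  trivialisation a connection on the pull-back of \<open>P\<^sub>1\<close> over an open subset of \<open>M\<close> is an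
  su(2)-valued 1-form there. A 1-form on \<open>M\<close> is smooth iff its pull-back under the retraction
  is a smooth form on an open subset of the ambient space, and as pull-backs commute with the
  exterior derivative, the latter can be computed from this pull-back, with constant vector
  fields.\<close>

type_synonym conn = "amb \<Rightarrow> amb \<Rightarrow> real^3"

definition retr_pull :: "conn \<Rightarrow> conn" where
  "retr_pull A y v = A (retr y) (frechet_derivative retr (at y) v)"

definition connection_on :: "amb set \<Rightarrow> conn \<Rightarrow> bool" where
  "connection_on U A \<longleftrightarrow>
     (\<forall>x\<in>U. linear (retr_pull A x)) \<and>
     (\<forall>v. smooth_on {y. snd y \<noteq> 0 \<and> retr y \<in> U} (\<lambda>y. retr_pull A y v))"

definition ext_d :: "conn \<Rightarrow> amb \<Rightarrow> amb \<Rightarrow> amb \<Rightarrow> real^3" where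
  "ext_d A x v w = frechet_derivative (\<lambda>y. retr_pull A y w) (at x) v
                 - frechet_derivative (\<lambda>y. retr_pull A y v) (at x) w"

text \<open>The value of a k-form at a point is a function of a sequence of tangent vectors that
  uses only the first k of them. The convention for the wedge product is
  \<open>(\<alpha> \<and> \<beta>)(v, w) = \<alpha>(v) \<beta>(w) - \<alpha>(w) \<beta>(v)\<close> for 1-forms.\<close>

type_synonym ('v, 'b) form = "(nat \<Rightarrow> 'v) \<Rightarrow> 'b"

definition wedge :: "nat \<Rightarrow> nat \<Rightarrow> ('v, 'b::real_vector) form \<Rightarrow> ('v, real) form \<Rightarrow> ('v, 'b) form" where
  "wedge k l \<alpha> \<beta> v =
     (1 / (fact k * fact l)) *\<^sub>R
     (\<Sum>\<sigma> | \<sigma> permutes {..<k+l}.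
        (of_int (sign \<sigma>) * \<beta> (\<lambda>i. v (\<sigma> (k + i)))) *\<^sub>R \<alpha> (\<lambda>i. v (\<sigma> i)))"

text \<open>\<open>F\<^sub>A = dA + (1/2) [A \<and> A]\<close>.\<close>

definition curvature :: "conn \<Rightarrow> amb \<Rightarrow> (amb, real^3) form" where
  "curvature A x v = ext_d A x (v 0) (v 1) + bracket (A x (v 0)) (A x (v 1))"

text \<open>Left-invariant 1-forms on \<open>SU(2)\<^sup>2\<close>, trivially extended to \<open>\<real> \<times> SU(2)\<^sup>2\<close>:
  \<open>eta 1 i\<close> is \<open>\<eta>\<^sub>i\<^sup>+\<close> and \<open>eta (-1) i\<close> is \<open>\<eta>\<^sub>i\<^sup>-\<close>. Lemma \<open>eta_dual\<close> is the
  duality with the left-invariant fields \<open>T\<^sub>i\<^sup>\<plusminus>\<close>.\<close>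

type_synonym cyl = "real \<times> quat \<times> quat"

fun eta :: "real \<Rightarrow> 3 \<Rightarrow> cyl \<Rightarrow> cyl \<Rightarrow> real" where
  "eta s i (t, a1, a2) (\<tau>, \<xi>1, \<xi>2) =
     (snd (qmul (qcnj a1) \<xi>1) $ i + s * snd (qmul (qcnj a2) \<xi>2) $ i) / 2"

fun orbit_chart :: "cyl \<Rightarrow> amb" where
  "orbit_chart (t, a1, a2) = (t *\<^sub>R a1, qmul a1 (qcnj a2))"

definition orbit_chart_inv :: "amb \<Rightarrow> cyl" where
  "orbit_chart_inv x =
     (norm (fst x), fst x /\<^sub>R norm (fst x), qmul (qcnj (snd x)) (fst x /\<^sub>R norm (fst x)))"

lemma norm_quat_1: "norm ((a, u) :: quat) = 1 \<longleftrightarrow> a\<^sup>2 + u \<bullet> u = 1"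
  by (simp add: norm_Pair power2_norm_eq_inner)

lemma qmul_qcnj_left:
  assumes "norm a = 1"
  shows "qmul (qcnj a) (qmul a b) = b"
proof (cases a; cases b)
  fix r u s v
  assume a: "a = (r, u)" and b: "b = (s, v)"
  from assms have "r\<^sup>2 + u \<bullet> u = 1" by (simp add: a norm_quat_1)
  then have n: "r * r + (u$1 * u$1 + u$2 * u$2 + u$3 * u$3) = 1"
    by (simp add: inner_vec_def sum_3 power2_eq_square)
  show ?thesis
    unfolding a b
    apply (simp add: inner_vec_def sum_3 cross3_def vec_eq_iff forall_3)
    using n by algebra
qed

lemma orbit_chart_inv_chart:
  assumes "t > 0" "norm a1 = 1" "norm a2 = 1"
  shows "orbit_chart_inv (orbit_chart (t, a1, a2)) = (t, a1, a2)"
proof -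
  have cnj: "qcnj (qmul a b) = qmul (qcnj b) (qcnj a)" for a b
    by (cases a; cases b) (simp add: inner_commute cross3_def vec_eq_iff forall_3 algebra_simps)
  have assoc: "qmul (qmul a b) c = qmul a (qmul b c)" for a b c
    by (cases a; cases b; cases c)
       (simp add: inner_vec_def sum_3 cross3_def vec_eq_iff forall_3 algebra_simps)
  have cc: "qcnj (qcnj a) = a" for a
    by (cases a) simp
  have one: "qmul a (1, 0) = a" for a
    by (cases a) (simp add: cross3_def vec_eq_iff forall_3)
  have "qmul (qcnj a1) a1 = (1, 0)"
    using qmul_qcnj_left[OF assms(2), of "(1, 0)"] by (simp only: one)
  then show ?thesis
    using assms by (simp add: orbit_chart_inv_def cnj cc assoc one)
qed

lemma eta_dual:
  assumes "norm a1 = 1" "norm a2 = 1" "s \<in> {1, -1}" "s' \<in> {1, -1}"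
  shows "eta s i (t, a1, a2) (0, qmul a1 (0, T j), s' *\<^sub>R qmul a2 (0, T j)) =
         (if i = j \<and> s = s' then 1 else 0)"
proof -
  have sc: "qmul a (c *\<^sub>R b) = c *\<^sub>R qmul a b" for a b c
    by (cases a; cases b) (simp add: cross_mult_right algebra_simps)
  show ?thesis
    using assms(3,4) qmul_qcnj_left[OF assms(1)] qmul_qcnj_left[OF assms(2)]
    by (auto simp: sc T_def axis_def)
qed

text \<open>The forms \<open>dt\<close> and \<open>\<eta>\<^sub>i\<^sup>\<plusminus>\<close>, as 1-forms on the complement \<open>fst x \<noteq> 0\<close> of the
  singular orbit in \<open>M\<close>.\<close>

definition dt :: "amb \<Rightarrow> amb \<Rightarrow> real" where
  "dt x v = fst (frechet_derivative orbit_chart_inv (at x) v)"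

definition etap :: "3 \<Rightarrow> amb \<Rightarrow> amb \<Rightarrow> real" where
  "etap i x v = eta 1 i (orbit_chart_inv x) (frechet_derivative orbit_chart_inv (at x) v)"

definition etam :: "3 \<Rightarrow> amb \<Rightarrow> amb \<Rightarrow> real" where
  "etam i x v = eta (-1) i (orbit_chart_inv x) (frechet_derivative orbit_chart_inv (at x) v)"

text \<open>The radial variables of the BGGG metric and its coefficient functions \<open>A\<^sub>i\<close>, \<open>B\<^sub>i\<close>, as
  functions of \<open>t\<close>. The integrand of \<open>t_of_r\<close> has an integrable singularity at \<open>9/4\<close>.\<close>

definition t_of_r :: "real \<Rightarrow> real" where
  "t_of_r r = integral {9/4..r}
     (\<lambda>s. sqrt ((s - 3/4) * (s + 3/4)) / sqrt ((s - 9/4) * (s + 9/4)))"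

definition r_of_t :: "real \<Rightarrow> real" where
  "r_of_t = inv_into {9/4..} t_of_r"

definition Acf :: "3 \<Rightarrow> real \<Rightarrow> real" where
  "Acf i t = (let r = r_of_t t in
     if i = 1 then sqrt ((r - 9/4) * (r + 9/4)) / sqrt ((r - 3/4) * (r + 3/4))
     else sqrt ((r - 9/4) * (r + 3/4) / 3))"

definition Bcf :: "3 \<Rightarrow> real \<Rightarrow> real" where
  "Bcf i t = (let r = r_of_t t in
     if i = 1 then 2 * r / 3
     else sqrt ((r - 3/4) * (r + 9/4) / 3))"

definition wedge2 :: "('v \<Rightarrow> real) \<Rightarrow> ('v \<Rightarrow> real) \<Rightarrow> ('v, real) form" where
  "wedge2 \<alpha> \<beta> = wedge 1 1 (\<lambda>v. \<alpha> (v 0)) (\<lambda>v. \<beta> (v 0))"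

definition wedge3 :: "('v \<Rightarrow> real) \<Rightarrow> ('v \<Rightarrow> real) \<Rightarrow> ('v \<Rightarrow> real) \<Rightarrow> ('v, real) form" where
  "wedge3 \<alpha> \<beta> \<gamma> = wedge 2 1 (wedge2 \<alpha> \<beta>) (\<lambda>v. \<gamma> (v 0))"

definition omega :: "amb \<Rightarrow> (amb, real) form" where
  "omega x v = (let t = norm (fst x) in
     4 * (\<Sum>i\<in>UNIV. Acf i t * Bcf i t * wedge2 (etam i x) (etap i x) v))"

definition Omega2 :: "amb \<Rightarrow> (amb, real) form" where
  "Omega2 x v = (let t = norm (fst x) in
     - 8 * Acf 1 t * Acf 2 t * Acf 3 t * wedge3 (etap 1 x) (etap 2 x) (etap 3 x) v
     + 4 * (\<Sum>i\<in>UNIV. \<Sum>j\<in>UNIV. \<Sum>k\<in>UNIV. levi_civita i j k * Bcf i t * Bcf j t * Acf k t *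
              wedge3 (etam i x) (etam j x) (etap k x) v))"

definition psi :: "amb \<Rightarrow> (amb, real) form" where
  "psi x v = 1/2 * wedge 2 2 (omega x) (omega x) v - wedge 1 3 (\<lambda>w. dt x (w 0)) (Omega2 x) v"

definition gmetric :: "amb \<Rightarrow> amb \<Rightarrow> amb \<Rightarrow> real" where
  "gmetric x v w = (let t = norm (fst x) in
     dt x v * dt x w
     + (\<Sum>i\<in>UNIV. (2 * Acf i t)\<^sup>2 * (etap i x v * etap i x w)
              + (2 * Bcf i t)\<^sup>2 * (etam i x v * etam i x w)))"

text \<open>The formulas for \<open>\<psi>\<close> and \<open>g\<close> are only valid off the singular orbit; both
  tensors extend smoothly over it. As its complement is dense and \<open>A\<close> is smooth across it, the
  equation \<open>F\<^sub>A \<and> \<psi> = 0\<close> and a bound on \<open>|F\<^sub>A|\<close> hold everywhere iff they hold on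
  the complement.\<close>

definition G2_instanton_on :: "amb set \<Rightarrow> conn \<Rightarrow> bool" where
  "G2_instanton_on U A \<longleftrightarrow>
     connection_on U A \<and>
     (\<forall>x\<in>U. fst x \<noteq> 0 \<longrightarrow>
        (\<forall>v. (\<forall>i<6. v i \<in> tangent x) \<longrightarrow> wedge 2 4 (curvature A x) (psi x) v = 0))"

definition orthonormal_frame :: "amb \<Rightarrow> (nat \<Rightarrow> amb) \<Rightarrow> bool" where
  "orthonormal_frame x e \<longleftrightarrow>
     (\<forall>i<7. e i \<in> tangent x) \<and>
     (\<forall>i<7. \<forall>j<7. gmetric x (e i) (e j) = (if i = j then 1 else 0))"

text \<open>The norm of a 2-form with values in su(2), computed in a given orthonormal frame.
  It does not depend on the frame.\<close>

definition norm_form2 :: "(nat \<Rightarrow> amb) \<Rightarrow> (amb, real^3) form \<Rightarrow> real" where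
  "norm_form2 e F = sqrt (\<Sum>j<7. \<Sum>i<j. (norm (F (\<lambda>n. if n = 0 then e i else e j)))\<^sup>2)"

definition bounded_curvature_on :: "amb set \<Rightarrow> conn \<Rightarrow> bool" where
  "bounded_curvature_on U A \<longleftrightarrow>
     (\<exists>C. \<forall>x\<in>U. fst x \<noteq> 0 \<longrightarrow>
        (\<forall>e. orthonormal_frame x e \<longrightarrow> norm_form2 e (curvature A x) \<le> C))"

text \<open>The group actions on \<open>M\<close> are restrictions of linear maps of the ambient space, so
  they also give the action on tangent vectors. The extra U(1) acts on
  \<open>\<real>\<^sup>+ \<times> SU(2)\<^sup>2\<close> by \<open>(t, a\<^sub>1, a\<^sub>2) \<mapsto> (t, a\<^sub>1 u, a\<^sub>2 u)\<close>, which is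
  \<open>(p, q) \<mapsto> (p u, q)\<close> on \<open>M\<close>; its lift to \<open>P\<^sub>1\<close> is the one for which the forms
  \<open>T\<^sub>1 \<otimes> \<eta>\<^sub>1\<^sup>+\<close> and \<open>T\<^sub>2 \<otimes> \<eta>\<^sub>2\<^sup>+ + T\<^sub>3 \<otimes> \<eta>\<^sub>3\<^sup>+\<close> are invariant.\<close>

fun su2_action :: "quat \<Rightarrow> quat \<Rightarrow> amb \<Rightarrow> amb" where
  "su2_action b1 b2 (p, q) = (qmul b1 p, qmul (qmul b1 q) (qcnj b2))"

fun u1_action :: "quat \<Rightarrow> amb \<Rightarrow> amb" where
  "u1_action u (p, q) = (qmul p u, q)"

definition invariant_on :: "amb set \<Rightarrow> conn \<Rightarrow> bool" where
  "invariant_on U A \<longleftrightarrow>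
     (\<forall>x\<in>U. \<forall>v\<in>tangent x.
        (\<forall>b1 b2. norm b1 = 1 \<longrightarrow> norm b2 = 1 \<longrightarrow>
           A (su2_action b1 b2 x) (su2_action b1 b2 v) = A x v) \<and>
        (\<forall>\<theta>. A (u1_action (expT1 \<theta>) x) (u1_action (expT1 \<theta>) v) =
              Ad (qcnj (expT1 \<theta>)) (A x v)))"

definition ansatz :: "(real \<Rightarrow> real) \<Rightarrow> (real \<Rightarrow> real) \<Rightarrow> conn" where
  "ansatz f g x v = (let t = norm (fst x) in
     (Acf 1 t * f t * etap 1 x v) *\<^sub>R T 1
     + (Acf 2 t * g t) *\<^sub>R (etap 2 x v *\<^sub>R T 2 + etap 3 x v *\<^sub>R T 3))"

end

theory Submission
  imports Defs
begin

text \<open>Put \<open>a = A\<^sub>1 f\<^sup>+\<close> and \<open>b = A\<^sub>2 g\<^sup>+\<close>. By the Maurer-Cartan equations the instanton equation is an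
  ordinary differential equation for \<open>(a, b)\<close>. In the independent variable \<open>r\<close> its coefficients are
  rational and its linear part can be integrated: with \<open>a = (1 + Y) A\<^sub>1\<^sup>2\<close> and
  \<open>b = D (r - 9/4) / ((r + 9/4)\<^sup>2 \<surd>r)\<close> it becomes \<open>dY/dr = - k D\<^sup>2\<close>, \<open>dD/dr = - Y D\<close> with
  \<open>k = 3 (r - 3/4) / (r (r + 9/4)\<^sup>5)\<close>, and the initial values at \<open>r = 9/4\<close> are \<open>Y = 2 f\<^sub>1 - 1\<close>,
  \<open>D = 243/4 g\<^sub>1\<close>. As \<open>\<surd>k = 8/243\<close> there, the hypothesis says that initially \<open>Y \<ge> \<surd>k D > 0\<close>.
  Since \<open>k\<close> decreases, this region is forward-invariant; in it \<open>Y\<close> and \<open>D\<close> are positive and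
  decreasing, so that the solution exists for all times and all curvature components stay bounded.\<close>

subsection \<open>Continuously differentiable functions\<close>

text \<open>The threshold comes from freezing \<open>k\<close>: then
  \<open>Y\<^sup>2 - k D\<^sup>2\<close> is conserved and the line \<open>Y = \<surd>k D\<close> is
  invariant. The sign of \<open>Y\<close> matters because, once \<open>Y\<close> is negative, a
  positive \<open>D\<close> grows and drives \<open>Y\<close> further down. The equation for
  \<open>(a, b)\<close> is singular at the singular orbit, where \<open>A\<^sub>1\<close> and
  \<open>A\<^sub>2\<close> vanish. The two integrating factors absorb the poles, so that
  \<open>(f\<^sub>1, g\<^sub>1)\<close> turn into ordinary initial values of a regular system. That
  system is quadratic; it is continued by solving a bounded Lipschitz truncation for all times and
  showing by monotonicity that the truncation never acts. Over the singular orbit the given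
  connection is kept, which settles smoothness there. Differentiability of \<open>f\<close> and
  \<open>g\<close> is extracted from the smoothness of the connection. Transitivity of
  \<open>SU(2)\<^sup>2\<close> on the levels of \<open>|p|\<close> reduces the curvature to the
  points \<open>((t, 0), (1, 0))\<close>. Its bound is delicate near \<open>t = 0\<close>, where the
  forms \<open>\<eta>\<^sub>i\<^sup>+\<close> have length \<open>1 / (2 A\<^sub>i)\<close>; the
  integrating factors make \<open>a\<close> and \<open>b\<close> vanish fast enough to
  compensate.\<close>

text \<open>On an open set the derivatives at \<open>x\<close> depend only on values near
  \<open>x\<close>. Both functions thus have the same derivatives, and the choice operator behind
  \<open>frechet_derivative\<close> picks the same one for both.\<close>

lemma Ck_on_cong:
  assumes "open S" "\<And>x. x \<in> S \<Longrightarrow> f x = g x"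
  shows "Ck_on n S f \<longleftrightarrow> Ck_on n S g"
  using assms(2)
proof (induction n arbitrary: f g)
  case 0
  then show ?case by (simp cong: continuous_on_cong)
next
  case (Suc n)
  have hd: "(f has_derivative D) (at x) \<longleftrightarrow> (g has_derivative D) (at x)" if "x \<in> S" for x D
    using has_derivative_transform_within_open[OF _ assms(1) that, of f D UNIV g]
      has_derivative_transform_within_open[OF _ assms(1) that, of g D UNIV f] Suc.prems by auto
  have 1: "f differentiable (at x) \<longleftrightarrow> g differentiable (at x)"
       and 2: "frechet_derivative f (at x) = frechet_derivative g (at x)" if "x \<in> S" for x
    using hd[OF that] by (simp_all add: differentiable_def frechet_derivative_def)
  have "Ck_on n S (\<lambda>x. frechet_derivative f (at x) v)
      \<longleftrightarrow> Ck_on n S (\<lambda>x. frechet_derivative g (at x) v)" for v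
    by (rule Suc.IH) (simp add: 2)
  with 1 show ?case by simp
qed

text \<open>Any explicit derivative may serve for the induction step, which keeps
  \<open>frechet_derivative\<close> out of the closure properties below.\<close>

lemma Ck_on_SucI:
  assumes "open S" "\<And>x. x \<in> S \<Longrightarrow> (f has_derivative f' x) (at x)"
    and "\<And>v. Ck_on n S (\<lambda>x. f' x v)"
  shows "Ck_on (Suc n) S f"
proof -
  have "frechet_derivative f (at x) = f' x" if "x \<in> S" for x
    using assms(2)[OF that] by (rule frechet_derivative_at[symmetric])
  then have "Ck_on n S (\<lambda>x. frechet_derivative f (at x) v)" for v
    by (intro Ck_on_cong[OF assms(1), THEN iffD2, OF _ assms(3)]) simp
  with assms(2) show ?thesis by (auto simp: differentiable_def)
qed

lemma Ck_on_SucD: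
  assumes "Ck_on (Suc n) S f"
  shows "x \<in> S \<Longrightarrow> (f has_derivative frechet_derivative f (at x)) (at x)"
    and "Ck_on n S (\<lambda>x. frechet_derivative f (at x) v)"
  using assms by (simp_all only: Ck_on.simps(2) frechet_derivative_works[symmetric])

lemma Ck_on_Suc_imp: "Ck_on (Suc n) S f \<Longrightarrow> Ck_on n S f"
proof (induction n arbitrary: f)
  case 0
  then show ?case
    by (simp add: continuous_at_imp_continuous_on differentiable_imp_continuous_within)
next
  case (Suc n)
  have f: "\<forall>x\<in>S. f differentiable (at x)" "\<And>v. Ck_on (Suc n) S (\<lambda>x. frechet_derivative f (at x) v)"
    using Suc.prems unfolding Ck_on.simps(2)[of "Suc n"] by blast+
  show ?case
    unfolding Ck_on.simps(2)[of n] by (intro conjI allI f Suc.IH)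
qed

text \<open>Regularity is local. This glues the tube around the singular orbit, where the given
  connection is smooth, to the complement of that orbit, where an explicit formula holds.\<close>

lemma Ck_on_Un:
  assumes "open S" "open W" "Ck_on n S f" "Ck_on n W f"
  shows "Ck_on n (S \<union> W) f"
  using assms(3,4)
  by (induction n arbitrary: f) (auto intro: continuous_on_open_Un[OF assms(1,2)])

lemma Ck_on_const: "open S \<Longrightarrow> Ck_on n S (\<lambda>x. c)"
proof (induction n arbitrary: c)
  case (Suc n)
  then show ?case by (intro Ck_on_SucI[where f' = "\<lambda>_ _. 0"]) auto
qed simp

lemma Ck_on_linear:
  assumes "open S" "bounded_linear L"
  shows "Ck_on n S L"
proof (cases n)
  case (Suc k)
  have "Ck_on (Suc k) S L"
    by (rule Ck_on_SucI[where f' = "\<lambda>_. L"])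
       (use assms in \<open>auto intro: Ck_on_const bounded_linear_imp_has_derivative\<close>)
  then show ?thesis unfolding Suc .
qed (use assms in \<open>auto intro: linear_continuous_on\<close>)

lemma Ck_on_compose_linear:
  assumes "open S" "bounded_linear L" "Ck_on n S f"
  shows "Ck_on n S (\<lambda>x. L (f x))"
  using assms(3)
proof (induction n arbitrary: f)
  case 0
  then show ?case by (auto intro: bounded_linear.continuous_on[OF assms(2)])
next
  case (Suc n)
  show ?case
  proof (rule Ck_on_SucI[OF assms(1)])
    show "((\<lambda>x. L (f x)) has_derivative (\<lambda>v. L (frechet_derivative f (at x) v))) (at x)"
      if "x \<in> S" for x
      by (rule bounded_linear.has_derivative[OF assms(2) Ck_on_SucD(1)[OF Suc.prems that]])
    show "Ck_on n S (\<lambda>x. L (frechet_derivative f (at x) v))" for v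
      by (rule Suc.IH[OF Ck_on_SucD(2)[OF Suc.prems]])
  qed
qed

lemma Ck_on_add:
  assumes "open S" "Ck_on n S f" "Ck_on n S g"
  shows "Ck_on n S (\<lambda>x. f x + g x)"
  using assms(2,3)
proof (induction n arbitrary: f g)
  case 0
  then show ?case by (simp add: continuous_on_add)
next
  case (Suc n)
  note f = Ck_on_SucD[OF Suc.prems(1)] and g = Ck_on_SucD[OF Suc.prems(2)]
  show ?case
  proof (rule Ck_on_SucI[OF assms(1)])
    show "((\<lambda>x. f x + g x) has_derivative
      (\<lambda>v. frechet_derivative f (at x) v + frechet_derivative g (at x) v)) (at x)" if "x \<in> S" for x
      by (rule has_derivative_add[OF f(1)[OF that] g(1)[OF that]])
    show "Ck_on n S (\<lambda>x. frechet_derivative f (at x) v + frechet_derivative g (at x) v)" for v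
      by (rule Suc.IH[OF f(2) g(2)])
  qed
qed

text \<open>The derivative is a sum of two terms of the same shape, so the induction closes if
  \<open>f\<close> and \<open>g\<close> vary. Covers products, scaling, inner products and
  quaternion multiplication at once.\<close>

lemma Ck_on_bilinear:
  assumes "open S" "bounded_bilinear P" "Ck_on n S f" "Ck_on n S g"
  shows "Ck_on n S (\<lambda>x. P (f x) (g x))"
  using assms(3,4)
proof (induction n arbitrary: f g)
  case 0
  then show ?case by (auto intro: bounded_bilinear.continuous_on[OF assms(2)])
next
  case (Suc n)
  note f = Ck_on_SucD[OF Suc.prems(1)] and g = Ck_on_SucD[OF Suc.prems(2)]
  show ?case
  proof (rule Ck_on_SucI[OF assms(1)])
    show "((\<lambda>x. P (f x) (g x)) has_derivative
      (\<lambda>v. P (f x) (frechet_derivative g (at x) v) + P (frechet_derivative f (at x) v) (g x))) (at x)"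
      if "x \<in> S" for x
      by (rule bounded_bilinear.FDERIV[OF assms(2) f(1)[OF that] g(1)[OF that]])
    show "Ck_on n S (\<lambda>x. P (f x) (frechet_derivative g (at x) v) + P (frechet_derivative f (at x) v) (g x))"
      for v
      by (rule Ck_on_add[OF assms(1) Suc.IH[OF Ck_on_Suc_imp[OF Suc.prems(1)] g(2)]
            Suc.IH[OF f(2) Ck_on_Suc_imp[OF Suc.prems(2)]]])
  qed
qed

lemmas Ck_on_mult = Ck_on_bilinear[where P = "(*)", OF _ bounded_bilinear_mult]
lemmas Ck_on_scaleR = Ck_on_bilinear[where P = scaleR, OF _ bounded_bilinear_scaleR]
lemmas Ck_on_inner = Ck_on_bilinear[where P = inner, OF _ bounded_bilinear_inner]

lemma Ck_on_minus:
  assumes "open S" "Ck_on n S f"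
  shows "Ck_on n S (\<lambda>x. - f x)"
  by (rule Ck_on_compose_linear[OF assms(1) bounded_linear_minus[OF bounded_linear_ident] assms(2)])

lemma Ck_on_diff:
  assumes "open S" "Ck_on n S f" "Ck_on n S g"
  shows "Ck_on n S (\<lambda>x. f x - g x)"
  using Ck_on_add[OF assms(1,2) Ck_on_minus[OF assms(1,3)]] by simp

lemma Ck_on_power:
  fixes f :: "'a::euclidean_space \<Rightarrow> real"
  assumes "open S" "Ck_on n S f"
  shows "Ck_on n S (\<lambda>x. f x ^ k)"
proof (induction k)
  case (Suc k)
  then show ?case
    using Ck_on_mult[OF assms(1,2) Suc] by simp
qed (simp add: Ck_on_const[OF assms(1)])

text \<open>The derivative contains \<open>inverse (f x)\<close> again, one order lower, so
  \<open>f\<close> stays fixed in the induction.\<close>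

lemma Ck_on_inverse:
  fixes f :: "'a::euclidean_space \<Rightarrow> real"
  assumes "open S" "Ck_on n S f" "\<And>x. x \<in> S \<Longrightarrow> f x \<noteq> 0"
  shows "Ck_on n S (\<lambda>x. inverse (f x))"
  using assms(2)
proof (induction n)
  case 0
  then show ?case using assms(3) by (simp add: continuous_on_inverse)
next
  case (Suc n)
  note IH = Suc.IH[OF Ck_on_Suc_imp[OF Suc.prems]]
  show ?case
  proof (rule Ck_on_SucI[OF assms(1)])
    show "((\<lambda>x. inverse (f x)) has_derivative
      (\<lambda>v. - (inverse (f x) * frechet_derivative f (at x) v * inverse (f x)))) (at x)" if "x \<in> S" for x
      by (rule Deriv.has_derivative_inverse[OF assms(3)[OF that] Ck_on_SucD(1)[OF Suc.prems that]])
    show "Ck_on n S (\<lambda>x. - (inverse (f x) * frechet_derivative f (at x) v * inverse (f x)))" for v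
      by (rule Ck_on_minus[OF assms(1) Ck_on_mult[OF assms(1) Ck_on_mult[OF assms(1) IH
            Ck_on_SucD(2)[OF Suc.prems]] IH]])
  qed
qed

lemma Ck_on_divide:
  fixes f :: "'a::euclidean_space \<Rightarrow> real"
  assumes "open S" "Ck_on n S f" "Ck_on n S g" "\<And>x. x \<in> S \<Longrightarrow> g x \<noteq> 0"
  shows "Ck_on n S (\<lambda>x. f x / g x)"
  unfolding divide_inverse by (rule Ck_on_mult[OF assms(1,2) Ck_on_inverse[OF assms(1,3,4)]])

lemma Ck_on_sqrt:
  fixes f :: "'a::euclidean_space \<Rightarrow> real"
  assumes "open S" "Ck_on n S f" "\<And>x. x \<in> S \<Longrightarrow> f x > 0"
  shows "Ck_on n S (\<lambda>x. sqrt (f x))"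
  using assms(2)
proof (induction n)
  case 0
  then show ?case by (simp add: continuous_on_real_sqrt)
next
  case (Suc n)
  let ?D = "\<lambda>x v. frechet_derivative f (at x) v * (inverse (sqrt (f x)) * (1 / 2))"
  have 1: "((\<lambda>x. sqrt (f x)) has_derivative ?D x) (at x)" if "x \<in> S" for x
  proof -
    have "DERIV sqrt (f x) :> inverse (sqrt (f x)) * (1 / 2)"
      using DERIV_real_sqrt[OF assms(3)[OF that]] by simp
    from DERIV_compose_FDERIV[OF this Ck_on_SucD(1)[OF Suc.prems that]] show ?thesis .
  qed
  have "sqrt (f x) \<noteq> 0" if "x \<in> S" for x
    using assms(3)[OF that] by simp
  then have "Ck_on n S (\<lambda>x. inverse (sqrt (f x)) * (1 / 2))"
    by (intro Ck_on_mult[OF assms(1)] Ck_on_inverse[OF assms(1)] Ck_on_const[OF assms(1)]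
        Suc.IH[OF Ck_on_Suc_imp[OF Suc.prems]])
  then have 2: "Ck_on n S (\<lambda>x. ?D x v)" for v
    by (rule Ck_on_mult[OF assms(1) Ck_on_SucD(2)[OF Suc.prems]])
  show ?case
    by (rule Ck_on_SucI[where f' = ?D, OF assms(1) 1 2])
qed

subsection \<open>Alternating forms\<close>

text \<open>The wedge product of a list of 1-forms, i.e. the determinant of the matrix
  \<open>(\<theta>s ! i) (v j)\<close>. In this encoding the product of two forms is concatenation
  of lists, and sums over the permutations of six vectors are never expanded.\<close>

definition alt :: "('v \<Rightarrow> real) list \<Rightarrow> ('v, real) form" where
  "alt \<theta>s v = (\<Sum>\<sigma> | \<sigma> permutes {..<length \<theta>s}.
     of_int (sign \<sigma>) * (\<Prod>s<length \<theta>s. (\<theta>s ! s) (v (\<sigma> s))))"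

lemma sign_comp_permutes:
  assumes "p permutes S" "q permutes S" "finite S"
  shows "sign (p \<circ> q) = sign p * sign q"
  using assms by (intro sign_compose) (auto simp: permutation_permutes)

lemma prod_lessThan_add:
  fixes f :: "nat \<Rightarrow> 'a::comm_monoid_mult"
  shows "(\<Prod>s<k + l. f s) = (\<Prod>s<k. f s) * (\<Prod>s<l. f (k + s))"
  by (induction l) (auto simp: mult.assoc)

text \<open>Expanding both factors gives a sum over \<open>\<sigma>\<close>, \<open>\<tau>\<close>
  and \<open>\<rho>\<close>, where \<open>\<tau>\<close> acts on the first \<open>k\<close>
  positions and the shifted \<open>\<rho>\<close> on the last \<open>l\<close>. For fixed
  \<open>\<tau>\<close> and \<open>\<rho>\<close> the composed permutation runs once through all
  permutations of \<open>k + l\<close> positions, so every pair contributes the same value. The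
  number of pairs, \<open>fact k * fact l\<close>, cancels the normalisation.\<close>

lemma wedge_alt:
  assumes k: "length \<alpha>s = k" and l: "length \<beta>s = l"
  shows "wedge k l (alt \<alpha>s) (alt \<beta>s) = alt (\<alpha>s @ \<beta>s)"
proof
  fix v :: "nat \<Rightarrow> 'a"
  define P where "P m = {\<sigma>. \<sigma> permutes {..<m::nat}}" for m
  define G where "G \<sigma> = of_int (sign \<sigma>) * (\<Prod>s<k + l. ((\<alpha>s @ \<beta>s) ! s) (v (\<sigma> s)))" for \<sigma>
  define sh where "sh \<rho> = map_permutation {..<l} ((+) k) \<rho>" for \<rho>
  have sh_perm: "sh \<rho> permutes {..<k + l}" and sh_sign: "sign (sh \<rho>) = sign \<rho>"
    and sh_ge: "\<And>s. s < l \<Longrightarrow> sh \<rho> (k + s) = k + \<rho> s" and sh_lt: "\<And>s. s < k \<Longrightarrow> sh \<rho> s = s"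
    if "\<rho> \<in> P l" for \<rho>
  proof -
    have r: "\<rho> permutes {..<l}" using that by (simp add: P_def)
    have p: "sh \<rho> permutes (+) k ` {..<l}"
      unfolding sh_def by (rule map_permutation_permutes[OF _ r]) (simp add: bij_betw_def)
    then show "sh \<rho> permutes {..<k + l}"
      by (rule permutes_subset) auto
    show "sign (sh \<rho>) = sign \<rho>"
      unfolding sh_def by (rule sign_map_permutation) (use r in auto)
    show "sh \<rho> (k + s) = k + \<rho> s" if "s < l" for s
      unfolding sh_def by (rule map_permutation_apply) (use that in auto)
    show "sh \<rho> s = s" if "s < k" for s
      by (rule permutes_not_in[OF p]) (use that in auto)
  qed
  have term_eq: "of_int (sign \<sigma>) * (of_int (sign \<rho>) * (\<Prod>s<l. (\<beta>s ! s) (v (\<sigma> (k + \<rho> s)))))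
      * (of_int (sign \<tau>) * (\<Prod>s<k. (\<alpha>s ! s) (v (\<sigma> (\<tau> s))))) = G (\<sigma> \<circ> (\<tau> \<circ> sh \<rho>))"
    if s: "\<sigma> \<in> P (k + l)" and t: "\<tau> \<in> P k" and r: "\<rho> \<in> P l" for \<sigma> \<tau> \<rho>
  proof -
    have t': "\<tau> permutes {..<k + l}" "\<tau> permutes {..<k}"
      using t by (auto simp: P_def intro: permutes_subset)
    have "sign (\<sigma> \<circ> (\<tau> \<circ> sh \<rho>)) = sign \<sigma> * (sign \<tau> * sign \<rho>)"
      using s t' sh_perm[OF r] sh_sign[OF r]
      by (simp add: P_def sign_comp_permutes[where S = "{..<k + l}"] permutes_compose)
    moreover have "\<tau> (k + \<rho> s) = k + \<rho> s" for s
      by (rule permutes_not_in[OF t'(2)]) simp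
    ultimately show ?thesis
      by (simp add: G_def prod_lessThan_add nth_append k sh_ge[OF r] sh_lt[OF r])
  qed
  have const: "(\<Sum>\<sigma>\<in>P (k + l). G (\<sigma> \<circ> (\<tau> \<circ> sh \<rho>))) = alt (\<alpha>s @ \<beta>s) v"
    if t: "\<tau> \<in> P k" and r: "\<rho> \<in> P l" for \<tau> \<rho>
  proof -
    have "\<tau> permutes {..<k + l}"
      using t by (auto simp: P_def intro: permutes_subset)
    then have "\<tau> \<circ> sh \<rho> permutes {..<k + l}"
      using sh_perm[OF r] by (rule permutes_compose[rotated])
    from sum_permutations_compose_right[OF this, of G] show ?thesis
      by (simp add: alt_def P_def G_def k l)
  qed
  have "wedge k l (alt \<alpha>s) (alt \<beta>s) v = 1 / (fact k * fact l) *
     (\<Sum>\<sigma>\<in>P (k + l). \<Sum>\<tau>\<in>P k. \<Sum>\<rho>\<in>P l. G (\<sigma> \<circ> (\<tau> \<circ> sh \<rho>)))"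
    unfolding wedge_def alt_def[of \<alpha>s] alt_def[of \<beta>s] k l P_def[symmetric] real_scaleR_def
    by (simp add: sum_distrib_left sum_distrib_right term_eq[symmetric] mult.assoc
        cong: sum.cong)
  also have "(\<Sum>\<sigma>\<in>P (k + l). \<Sum>\<tau>\<in>P k. \<Sum>\<rho>\<in>P l. G (\<sigma> \<circ> (\<tau> \<circ> sh \<rho>)))
      = (\<Sum>\<tau>\<in>P k. \<Sum>\<rho>\<in>P l. \<Sum>\<sigma>\<in>P (k + l). G (\<sigma> \<circ> (\<tau> \<circ> sh \<rho>)))"
    by (subst sum.swap, rule sum.cong[OF refl], rule sum.swap)
  also have "\<dots> = fact k * (fact l * alt (\<alpha>s @ \<beta>s) v)"
    by (simp add: const) (simp add: P_def card_permutations)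
  finally show "wedge k l (alt \<alpha>s) (alt \<beta>s) v = alt (\<alpha>s @ \<beta>s) v"
    by simp
qed

lemma alt_swap:
  "alt (xs @ a # b # ys) v = - alt (xs @ b # a # ys) v"
proof -
  let ?n = "length (xs @ a # b # ys)" and ?i = "length xs"
  define \<tau> where "\<tau> = Transposition.transpose ?i (Suc ?i)"
  have t: "\<tau> permutes {..<?n}"
    unfolding \<tau>_def by (rule permutes_swap_id) auto
  have sw: "(xs @ b # a # ys) ! (\<tau> s) = (xs @ a # b # ys) ! s" for s
    by (auto simp: \<tau>_def Transposition.transpose_def nth_append nth_Cons')
  have "(\<Prod>s<?n. ((xs @ a # b # ys) ! s) (v ((\<sigma> \<circ> \<tau>) s))) =
      (\<Prod>s<?n. ((xs @ b # a # ys) ! s) (v (\<sigma> s)))" for \<sigma>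
    using prod.permute[OF t, of "\<lambda>s. ((xs @ b # a # ys) ! s) (v (\<sigma> s))"] by (simp add: sw)
  moreover have "sign (\<sigma> \<circ> \<tau>) = - sign \<sigma>" if "\<sigma> permutes {..<?n}" for \<sigma>
    using sign_comp_permutes[OF that t] by (simp add: \<tau>_def sign_swap_id)
  ultimately have "(\<Sum>\<sigma> | \<sigma> permutes {..<?n}.
       of_int (sign (\<sigma> \<circ> \<tau>)) * (\<Prod>s<?n. ((xs @ a # b # ys) ! s) (v ((\<sigma> \<circ> \<tau>) s))))
     = (\<Sum>\<sigma> | \<sigma> permutes {..<?n}. - (of_int (sign \<sigma>) * (\<Prod>s<?n. ((xs @ b # a # ys) ! s) (v (\<sigma> s)))))"
    by (intro sum.cong) auto
  then show ?thesis
    by (subst alt_def, subst sum_permutations_compose_right[OF t]) (simp add: sum_negf alt_def)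
qed

text \<open>Adjacent swaps bring two equal entries together; one more swap then shows that the value
  is its own negative.\<close>

lemma alt_not_distinct:
  assumes "\<not> distinct \<theta>s"
  shows "alt \<theta>s v = 0"
proof -
  obtain xs ys zs a where \<theta>s: "\<theta>s = xs @ [a] @ ys @ [a] @ zs"
    using not_distinct_decomp[OF assms] by blast
  have "alt (xs @ [a] @ ys @ [a] @ zs) v = 0" for xs
  proof (induction ys arbitrary: xs)
    case Nil
    then show ?case using alt_swap[of xs a a zs v] unfolding equal_neg_zero by simp
  next
    case (Cons b ys)
    show ?case using alt_swap[of xs a b "ys @ a # zs" v] Cons.IH[of "xs @ [b]"] by simp
  qed
  then show ?thesis by (simp add: \<theta>s)
qed

text \<open>Every permutation other than the identity moves some position, where the corresponding
  factor vanishes. Evaluation on dual vectors will isolate scalar coefficients of forms.\<close>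

lemma alt_dual:
  assumes "\<And>s j. s < length \<theta>s \<Longrightarrow> j < length \<theta>s \<Longrightarrow> (\<theta>s ! s) (v j) = (if s = j then 1 else 0)"
  shows "alt \<theta>s v = 1"
proof -
  let ?n = "length \<theta>s"
  have "(\<Prod>s<?n. (\<theta>s ! s) (v (\<sigma> s))) = 0" if "\<sigma> permutes {..<?n}" "\<sigma> \<noteq> id" for \<sigma>
  proof -
    obtain s where "\<sigma> s \<noteq> s" using \<open>\<sigma> \<noteq> id\<close> by (auto simp: fun_eq_iff)
    moreover from this have "s < ?n" using permutes_not_in[OF that(1)] by auto
    ultimately show ?thesis
      using assms[of s "\<sigma> s"] permutes_in_image[OF that(1), of s]
      by (intro prod_zero) (auto intro!: bexI[of _ s])
  qed
  then have "alt \<theta>s v = (\<Sum>\<sigma>\<in>{id}. of_int (sign \<sigma>) * (\<Prod>s<?n. (\<theta>s ! s) (v (\<sigma> s))))"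
    unfolding alt_def by (intro sum.mono_neutral_right) (auto simp: finite_permutations permutes_id)
  then show ?thesis using assms by simp
qed

lemma alt_1: "alt [\<alpha>] = (\<lambda>v. \<alpha> (v 0))"
  by (auto simp: alt_def lessThan_Suc)

lemma alt_2: "alt [\<alpha>, \<beta>] v = \<alpha> (v 0) * \<beta> (v 1) - \<alpha> (v 1) * \<beta> (v 0)"
proof -
  have "{..<Suc (Suc 0)} = insert 0 {1::nat}" by auto
  then show ?thesis
    by (simp add: alt_def sum_over_permutations_insert permutes_sing sign_swap_id)
qed

lemma wedge2_alt: "wedge2 \<alpha> \<beta> = alt [\<alpha>, \<beta>]"
  using wedge_alt[of "[\<alpha>]" 1 "[\<beta>]" 1] by (simp add: wedge2_def alt_1)

lemma wedge3_alt: "wedge3 \<alpha> \<beta> \<gamma> = alt [\<alpha>, \<beta>, \<gamma>]"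
  using wedge_alt[of "[\<alpha>, \<beta>]" 2 "[\<gamma>]" 1] by (simp add: wedge3_def wedge2_alt alt_1)

lemma wedge_add_left: "wedge k l (\<lambda>v. \<alpha> v + \<alpha>' v) \<beta> v = wedge k l \<alpha> \<beta> v + wedge k l \<alpha>' \<beta> v"
  by (simp add: wedge_def scaleR_add_right sum.distrib)

lemma wedge_add_right: "wedge k l \<alpha> (\<lambda>v. \<beta> v + \<beta>' v) v = wedge k l \<alpha> \<beta> v + wedge k l \<alpha> \<beta>' v"
  by (simp add: wedge_def scaleR_add_right scaleR_add_left distrib_left sum.distrib)

lemma wedge_scale_left:
  fixes \<alpha> :: "('v, real) form"
  shows "wedge k l (\<lambda>v. c * \<alpha> v) \<beta> v = c * wedge k l \<alpha> \<beta> v"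
  by (simp add: wedge_def sum_distrib_left mult_ac divide_inverse)

lemma wedge_scale_right:
  fixes \<alpha> :: "('v, real) form"
  shows "wedge k l \<alpha> (\<lambda>v. c * \<beta> v) v = c * wedge k l \<alpha> \<beta> v"
  by (simp add: wedge_def sum_distrib_left mult_ac)

lemma wedge_nth: "wedge k l F \<beta> v $ i = wedge k l (\<lambda>v. F v $ i) \<beta> v"
  by (simp add: wedge_def)

text \<open>Agreement is asked only on the rearrangements of the given tuples, because the formula
  for the curvature holds only on tangent vectors.\<close>

lemma wedge_cong:
  assumes "\<And>\<sigma>. \<sigma> permutes {..<k + l} \<Longrightarrow> \<alpha> (\<lambda>i. v (\<sigma> i)) = \<alpha>' (\<lambda>i. w (\<sigma> i))"
    and "\<And>\<sigma>. \<sigma> permutes {..<k + l} \<Longrightarrow> \<beta> (\<lambda>i. v (\<sigma> (k + i))) = \<beta>' (\<lambda>i. w (\<sigma> (k + i)))"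
  shows "wedge k l \<alpha> \<beta> v = wedge k l \<alpha>' \<beta>' w"
  unfolding wedge_def using assms by (auto intro!: arg_cong2[where f = scaleR] sum.cong)

text \<open>Naming the 1-forms by numerals lets the simplifier decide \<open>b < a\<close>, hence
  sort the factors and detect repetitions.\<close>

definition alti :: "(nat \<Rightarrow> 'v \<Rightarrow> real) \<Rightarrow> nat list \<Rightarrow> ('v, real) form" where
  "alti \<theta> is = alt (map \<theta> is)"

lemma wedge_alti:
  "length is = k \<Longrightarrow> length js = l \<Longrightarrow> wedge k l (alti \<theta> is) (alti \<theta> js) v = alti \<theta> (is @ js) v"
  by (simp add: alti_def wedge_alt)

lemma alti_not_distinct: "\<not> distinct is \<Longrightarrow> alti \<theta> is v = 0"
  unfolding alti_def by (rule alt_not_distinct) (auto simp: distinct_map)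

text \<open>Used as rewrite rules, these sort lists of up to six numerals.\<close>

lemma alti_sort:
  "b < a \<Longrightarrow> alti \<theta> (a # b # ks) v = - alti \<theta> (b # a # ks) v"
  "b < a \<Longrightarrow> alti \<theta> (i # a # b # ks) v = - alti \<theta> (i # b # a # ks) v"
  "b < a \<Longrightarrow> alti \<theta> (i # j # a # b # ks) v = - alti \<theta> (i # j # b # a # ks) v"
  "b < a \<Longrightarrow> alti \<theta> (i # j # k # a # b # ks) v = - alti \<theta> (i # j # k # b # a # ks) v"
  "b < a \<Longrightarrow> alti \<theta> (i # j # k # l # a # b # ks) v = - alti \<theta> (i # j # k # l # b # a # ks) v"
  using alt_swap[of "[]" "\<theta> a" "\<theta> b" "map \<theta> ks" v]
    alt_swap[of "[\<theta> i]" "\<theta> a" "\<theta> b" "map \<theta> ks" v]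
    alt_swap[of "[\<theta> i, \<theta> j]" "\<theta> a" "\<theta> b" "map \<theta> ks" v]
    alt_swap[of "[\<theta> i, \<theta> j, \<theta> k]" "\<theta> a" "\<theta> b" "map \<theta> ks" v]
    alt_swap[of "[\<theta> i, \<theta> j, \<theta> k, \<theta> l]" "\<theta> a" "\<theta> b" "map \<theta> ks" v]
  by (simp_all add: alti_def)

subsection \<open>Ordinary differential equations\<close>

text \<open>Gronwall's inequality from below: \<open>z\<close> times \<open>exp (- P)\<close> is
  nondecreasing for the primitive \<open>P\<close> of \<open>\<rho>\<close>. A linear differential
  inequality thus preserves the sign of \<open>z\<close>; both the positivity of \<open>D\<close>
  and the barrier rest on this.\<close>

lemma exp_integral_le_of_deriv_ge:
  fixes z \<rho> :: "real \<Rightarrow> real"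
  assumes ab: "a \<le> b" and z: "continuous_on {a..b} z" and \<rho>: "continuous_on {a..b} \<rho>"
    and z': "\<And>t. a < t \<Longrightarrow> t < b \<Longrightarrow> (z has_real_derivative z' t) (at t)"
    and ge: "\<And>t. a < t \<Longrightarrow> t < b \<Longrightarrow> z' t \<ge> \<rho> t * z t"
  shows "z a * exp (integral {a..b} \<rho>) \<le> z b"
proof -
  define P where "P t = integral {a..t} \<rho>" for t
  have P: "(P has_real_derivative \<rho> t) (at t within {a..b})" if "t \<in> {a..b}" for t
    unfolding P_def using integral_has_vector_derivative[OF \<rho> that]
    by (simp add: has_real_derivative_iff_has_vector_derivative)
  have "z a * exp (- P a) \<le> z b * exp (- P b)"
  proof (rule DERIV_nonneg_imp_increasing_open[OF ab, where f = "\<lambda>t. z t * exp (- P t)"])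
    show "continuous_on {a..b} (\<lambda>t. z t * exp (- P t))"
      by (intro continuous_intros z DERIV_continuous_on[of _ P \<rho>] P)
    fix t assume t: "a < t" "t < b"
    then have "(P has_real_derivative \<rho> t) (at t)"
      using P[of t] at_within_Icc_at[of a t b] by auto
    then have "((\<lambda>t. z t * exp (- P t)) has_real_derivative (z' t - \<rho> t * z t) * exp (- P t)) (at t)"
      using z'[OF t] by (auto intro!: derivative_eq_intros simp: algebra_simps)
    moreover have "(z' t - \<rho> t * z t) * exp (- P t) \<ge> 0"
      using ge[OF t] by simp
    ultimately show "\<exists>y. ((\<lambda>t. z t * exp (- P t)) has_real_derivative y) (at t) \<and> y \<ge> 0"
      by blast
  qed
  then have "z a * exp (P b) \<le> z b * exp (- P b) * exp (P b)"
    by (intro mult_right_mono) (auto simp: P_def)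
  also have "\<dots> = z b" by (simp add: exp_minus)
  finally show ?thesis by (simp add: P_def)
qed

text \<open>The squared distance, weighted by \<open>exp (- 2 * L * t)\<close>, is nonincreasing.
  The Lipschitz estimate is needed only along the two solutions.\<close>

lemma ode_unique:
  fixes F :: "real \<Rightarrow> 'a::real_inner \<Rightarrow> 'a"
  assumes ab: "a \<le> b" and cont: "continuous_on {a..b} x" "continuous_on {a..b} y"
    and x': "\<And>t. a < t \<Longrightarrow> t < b \<Longrightarrow> (x has_vector_derivative F t (x t)) (at t)"
    and y': "\<And>t. a < t \<Longrightarrow> t < b \<Longrightarrow> (y has_vector_derivative F t (y t)) (at t)"
    and lip: "\<And>t. a < t \<Longrightarrow> t < b \<Longrightarrow> norm (F t (x t) - F t (y t)) \<le> L * norm (x t - y t)"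
    and "x a = y a"
  shows "x b = y b"
proof -
  define d where "d t = x t - y t" for t
  have "exp (- 2 * L * b) * (d b \<bullet> d b) \<le> exp (- 2 * L * a) * (d a \<bullet> d a)"
  proof (rule DERIV_nonpos_imp_decreasing_open[OF ab, where f = "\<lambda>t. exp (- 2 * L * t) * (d t \<bullet> d t)"])
    show "continuous_on {a..b} (\<lambda>t. exp (- 2 * L * t) * (d t \<bullet> d t))"
      unfolding d_def by (intro continuous_intros cont)
    fix t assume t: "a < t" "t < b"
    let ?e = "F t (x t) - F t (y t)"
    have d': "(d has_vector_derivative ?e) (at t)"
      unfolding d_def by (intro has_vector_derivative_diff x'[OF t] y'[OF t])
    have dd: "((\<lambda>t. d t \<bullet> d t) has_real_derivative 2 * (d t \<bullet> ?e)) (at t)"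
      using bounded_bilinear.has_vector_derivative[OF bounded_bilinear_inner d' d']
      by (simp add: has_real_derivative_iff_has_vector_derivative inner_commute)
    have "((\<lambda>t. exp (- 2 * L * t) * (d t \<bullet> d t)) has_real_derivative
        exp (- 2 * L * t) * (2 * (d t \<bullet> ?e) - 2 * L * (d t \<bullet> d t))) (at t)"
      by (rule derivative_eq_intros dd refl)+ (simp add: algebra_simps)
    moreover have "d t \<bullet> ?e \<le> L * (d t \<bullet> d t)"
    proof -
      have "d t \<bullet> ?e \<le> norm (d t) * norm ?e" by (rule norm_cauchy_schwarz)
      also have "\<dots> \<le> norm (d t) * (L * norm (d t))"
        using lip[OF t] by (intro mult_left_mono) (auto simp: d_def)
      also have "\<dots> = L * (d t \<bullet> d t)"
        by (simp add: dot_square_norm power2_eq_square)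
      finally show ?thesis .
    qed
    ultimately show "\<exists>y. ((\<lambda>t. exp (- 2 * L * t) * (d t \<bullet> d t)) has_real_derivative y) (at t) \<and> y \<le> 0"
      by (intro exI[of _ "exp (- 2 * L * t) * (2 * (d t \<bullet> ?e) - 2 * L * (d t \<bullet> d t))"])
        (simp add: mult_nonneg_nonpos)
  qed
  then have "d b \<bullet> d b \<le> 0"
    using \<open>x a = y a\<close> by (simp add: d_def mult_le_0_iff)
  then show ?thesis
    by (metis d_def eq_iff_diff_eq_0 inner_eq_zero_iff inner_ge_zero order_antisym)
qed

text \<open>Weighting by \<open>exp (- \<kappa> (t - a))\<close> makes the Picard map a contraction on the whole half-line.\<close>

lemma ode_exists_global:
  fixes F :: "real \<Rightarrow> 'a::euclidean_space \<Rightarrow> 'a"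
  assumes cont: "continuous_on ({a..} \<times> UNIV) (\<lambda>(t, x). F t x)"
    and bound: "\<And>t x. a \<le> t \<Longrightarrow> norm (F t x) \<le> B"
    and lip: "\<And>t x y. a \<le> t \<Longrightarrow> norm (F t x - F t y) \<le> L * norm (x - y)"
  obtains x where "x a = x0" "continuous_on {a..} x"
    "\<And>t. a < t \<Longrightarrow> (x has_vector_derivative F t (x t)) (at t)"
proof -
  define \<kappa> where "\<kappa> = 2 * (\<bar>L\<bar> + 1)"
  have \<kappa>: "\<kappa> > 0" "\<bar>L\<bar> / \<kappa> \<le> 1 / 2" by (auto simp: \<kappa>_def field_simps)
  have B: "B \<ge> 0" using bound[of a] norm_ge_zero order_trans by blast
  \<comment> \<open>The unknown \<open>z\<close> is the weighted solution; the exponential restores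
    the solution itself before it enters \<open>F\<close>.\<close>
  define G where "G z s = F s (exp (\<kappa> * (s - a)) *\<^sub>R apply_bcontfun z s)" for z :: "real \<Rightarrow>\<^sub>C 'a" and s
  define I where "I z t = x0 + integral {a..t} (G z)" for z t
  \<comment> \<open>\<open>max a t\<close> continues the function constantly to the left of
    \<open>a\<close>, since bounded continuous functions live on the whole line.\<close>
  define Q where "Q z t = exp (- \<kappa> * (max a t - a)) *\<^sub>R I z (max a t)" for z t
  have G_cont: "continuous_on {a..t} (G z)" for z t
  proof -
    have "continuous_on {a..t} (\<lambda>s. (s, exp (\<kappa> * (s - a)) *\<^sub>R apply_bcontfun z s))"
      by (intro continuous_intros continuous_on_apply_bcontfun)
    moreover have "(\<lambda>s. (s, exp (\<kappa> * (s - a)) *\<^sub>R apply_bcontfun z s)) ` {a..t} \<subseteq> {a..} \<times> UNIV"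
      by auto
    ultimately show ?thesis
      unfolding G_def using continuous_on_compose2[OF cont] by fastforce
  qed
  have G_int: "G z integrable_on {a..t}" for z t
    by (rule integrable_continuous_real[OF G_cont])
  have I_cont: "continuous_on {a..} (I z)" for z
  proof -
    have "continuous_on {a..<t + 1} (I z)" for t
      unfolding I_def using indefinite_integral_continuous_1[OF G_int[of z "t + 1"]]
      by (intro continuous_intros) (auto elim: continuous_on_subset)
    then show ?thesis
      unfolding continuous_on_eq_continuous_within
    proof (intro ballI)
      fix t assume c: "\<And>t. \<forall>x\<in>{a..<t + 1}. continuous (at x within {a..<t + 1}) (I z)" and t: "t \<in> {a..}"
      have "at t within {a..} = at t within {a..<t + 1}"
        by (rule at_within_nhd[of _ "{..<t + 1}"]) (use t in auto)
      then show "continuous (at t within {a..}) (I z)" using c[of t] t by auto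
    qed
  qed
  have I_bound: "norm (I z t) \<le> norm x0 + B * (t - a)" if "a \<le> t" for z t
  proof -
    have "norm (integral {a..t} (G z)) \<le> integral {a..t} (\<lambda>_. B)"
      by (rule integral_norm_bound_integral[OF G_int]) (auto simp: G_def bound)
    then show ?thesis
      using norm_triangle_ineq[of x0 "integral {a..t} (G z)"] that
      by (simp add: I_def mult.commute)
  qed
  have Q_bcont: "Q z \<in> bcontfun" for z
  proof -
    have "continuous_on UNIV (Q z)"
      unfolding Q_def
      by (intro continuous_intros continuous_on_compose2[OF I_cont]) auto
    moreover have "norm (Q z t) \<le> norm x0 + B / \<kappa>" for t
    proof -
      define s where "s = max a t - a"
      have s: "s \<ge> 0" "max a t = a + s" by (auto simp: s_def)
      \<comment> \<open>The integral grows at most linearly, and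
        \<open>s * exp (- \<kappa> * s)\<close> is bounded by \<open>1 / \<kappa>\<close>; hence the
        Picard map stays within the bounded functions.\<close>
      have "\<kappa> * s \<le> exp (\<kappa> * s)" using exp_ge_add_one_self[of "\<kappa> * s"] by linarith
      then have "exp (- \<kappa> * s) * s \<le> 1 / \<kappa>"
        using \<kappa> by (simp add: exp_minus field_simps)
      then have 1: "B * (exp (- \<kappa> * s) * s) \<le> B * (1 / \<kappa>)" by (rule mult_left_mono) (rule B)
      have 2: "exp (- \<kappa> * s) * norm x0 \<le> 1 * norm x0"
        using \<kappa> s by (intro mult_right_mono) auto
      have "norm (Q z t) = exp (- \<kappa> * s) * norm (I z (a + s))"
        by (simp add: Q_def s_def)
      also have "\<dots> \<le> exp (- \<kappa> * s) * (norm x0 + B * s)"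
        using I_bound[of "a + s" z] s by (intro mult_left_mono) auto
      also have "\<dots> = exp (- \<kappa> * s) * norm x0 + B * (exp (- \<kappa> * s) * s)" by (simp add: algebra_simps)
      finally show ?thesis using 1 2 by simp
    qed
    ultimately show ?thesis
      by (auto simp: bcontfun_def bounded_iff)
  qed
  define \<Phi> where "\<Phi> z = Bcontfun (Q z)" for z
  have \<Phi>: "apply_bcontfun (\<Phi> z) = Q z" for z
    by (simp add: \<Phi>_def Bcontfun_inverse Q_bcont)
  have "dist (\<Phi> z) (\<Phi> w) \<le> 1 / 2 * dist z w" for z w
  proof (rule dist_bound)
    fix t
    define s where "s = max a t"
    have s: "s \<ge> a" by (simp add: s_def)
    let ?D = "\<bar>L\<bar> * dist z w"
    \<comment> \<open>Integrating the weight gains the factor \<open>1 / \<kappa>\<close>, which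
      turns the Lipschitz constant into the contraction factor
      \<open>\<bar>L\<bar> / \<kappa> \<le> 1 / 2\<close>.\<close>
    have hi: "((\<lambda>r. exp (\<kappa> * (r - a)) * ?D) has_integral
        (exp (\<kappa> * (s - a)) * (?D / \<kappa>) - exp (\<kappa> * (a - a)) * (?D / \<kappa>))) {a..s}"
      by (rule fundamental_theorem_of_calculus[OF s])
         (use \<kappa> in \<open>auto intro!: derivative_eq_intros simp: has_real_derivative_iff_has_vector_derivative[symmetric]\<close>)
    have "norm (G z r - G w r) \<le> exp (\<kappa> * (r - a)) * ?D" if "r \<in> {a..s}" for r
    proof -
      have "norm (G z r - G w r) \<le>
          L * norm (exp (\<kappa> * (r - a)) *\<^sub>R apply_bcontfun z r - exp (\<kappa> * (r - a)) *\<^sub>R apply_bcontfun w r)"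
        unfolding G_def using lip that by auto
      also have "\<dots> = L * (exp (\<kappa> * (r - a)) * dist (apply_bcontfun z r) (apply_bcontfun w r))"
        by (simp add: scaleR_diff_right[symmetric] dist_norm)
      also have "\<dots> \<le> \<bar>L\<bar> * (exp (\<kappa> * (r - a)) * dist z w)"
        by (intro mult_mono dist_bounded) auto
      finally show ?thesis by (simp add: mult_ac)
    qed
    then have "norm (integral {a..s} (\<lambda>r. G z r - G w r)) \<le> integral {a..s} (\<lambda>r. exp (\<kappa> * (r - a)) * ?D)"
      using hi by (intro integral_norm_bound_integral integrable_diff G_int) (auto simp: has_integral_integrable)
    also have "\<dots> \<le> exp (\<kappa> * (s - a)) * (?D / \<kappa>)"
      using integral_unique[OF hi] \<kappa> by simp
    finally have *: "norm (I z s - I w s) \<le> exp (\<kappa> * (s - a)) * (?D / \<kappa>)"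
      by (simp add: I_def integral_diff[OF G_int G_int])
    have "dist (Q z t) (Q w t) = exp (- \<kappa> * (s - a)) * norm (I z s - I w s)"
      by (simp add: Q_def s_def dist_norm scaleR_diff_right[symmetric])
    also have "\<dots> \<le> exp (- \<kappa> * (s - a)) * (exp (\<kappa> * (s - a)) * (?D / \<kappa>))"
      by (intro mult_left_mono *) simp
    also have "\<dots> = \<bar>L\<bar> / \<kappa> * dist z w"
      by (simp add: exp_minus)
    also have "\<dots> \<le> 1 / 2 * dist z w"
      by (intro mult_right_mono \<kappa>) simp
    finally show "dist (apply_bcontfun (\<Phi> z) t) (apply_bcontfun (\<Phi> w) t) \<le> 1 / 2 * dist z w"
      by (simp add: \<Phi>)
  qed
  then obtain z where z: "\<Phi> z = z"
    using banach_fix_type[of "1 / 2" \<Phi>] by auto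
  have I_eq: "exp (\<kappa> * (t - a)) *\<^sub>R apply_bcontfun z t = I z t" if "a \<le> t" for t
  proof -
    have "apply_bcontfun z t = exp (- \<kappa> * (t - a)) *\<^sub>R I z t"
      using \<Phi>[of z] that by (simp add: z Q_def max_def)
    then show ?thesis by (simp add: exp_minus)
  qed
  show thesis
  proof
    show "I z a = x0" by (simp add: I_def)
    show "continuous_on {a..} (I z)" by (rule I_cont)
    fix t assume t: "a < t"
    have "((\<lambda>u. integral {a..u} (G z)) has_vector_derivative G z t) (at t within {a..t + 1})"
      by (rule integral_has_vector_derivative[OF G_cont]) (use t in auto)
    then have "((\<lambda>u. integral {a..u} (G z)) has_vector_derivative G z t) (at t)"
      using t at_within_Icc_at[of a t "t + 1"] by simp
    then have "(I z has_vector_derivative G z t) (at t)"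
      unfolding I_def by (auto intro: derivative_eq_intros)
    then show "(I z has_vector_derivative F t (I z t)) (at t)"
      using I_eq[of t] t by (simp add: G_def)
  qed
qed

subsection \<open>The radial coordinate\<close>

text \<open>The substitution \<open>r = 9/4 + u\<^sup>2\<close> removes the singularity of the integrand of \<open>t_of_r\<close>.\<close>

definition t_of_u :: "real \<Rightarrow> real" where
  "t_of_u u = integral {0..u} (\<lambda>v. 2 * sqrt ((v\<^sup>2 + 3/2) * (v\<^sup>2 + 3) / (v\<^sup>2 + 9/2)))"

lemma t_of_u_integrand_cont:
  "continuous_on S (\<lambda>v. 2 * sqrt ((v\<^sup>2 + 3/2) * (v\<^sup>2 + 3) / (v\<^sup>2 + 9/2)) :: real)"
  by (intro continuous_intros) (simp add: add_nonneg_eq_0_iff)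

lemma t_of_u_deriv_within:
  assumes "u \<in> {0..b}"
  shows "(t_of_u has_real_derivative 2 * sqrt ((u\<^sup>2 + 3/2) * (u\<^sup>2 + 3) / (u\<^sup>2 + 9/2))) (at u within {0..b})"
  unfolding t_of_u_def has_real_derivative_iff_has_vector_derivative
  by (rule integral_has_vector_derivative[OF t_of_u_integrand_cont assms])

lemma t_of_u_deriv:
  assumes "u > 0"
  shows "(t_of_u has_real_derivative 2 * sqrt ((u\<^sup>2 + 3/2) * (u\<^sup>2 + 3) / (u\<^sup>2 + 9/2))) (at u)"
  using t_of_u_deriv_within[of u "u + 1"] assms at_within_Icc_at[of 0 u "u + 1"] by simp

lemma t_of_u_cont: "continuous_on {0..b} t_of_u"
  by (rule DERIV_continuous_on[OF t_of_u_deriv_within])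

lemma t_of_u_0 [simp]: "t_of_u 0 = 0"
  by (simp add: t_of_u_def)

lemma t_of_u_sqrt_deriv:
  assumes r: "9/4 < r"
  shows "((\<lambda>s. t_of_u (sqrt (s - 9/4))) has_real_derivative
    sqrt ((r - 3/4) * (r + 3/4)) / sqrt ((r - 9/4) * (r + 9/4))) (at r)"
proof -
  define u where "u = sqrt (r - 9/4)"
  have u: "u > 0" "r = u\<^sup>2 + 9/4" using r by (auto simp: u_def)
  have "((\<lambda>s. sqrt (s - 9/4)) has_real_derivative inverse u / 2) (at r)"
    using r by (auto intro!: derivative_eq_intros simp: u_def)
  moreover have "(t_of_u has_real_derivative 2 * sqrt ((u\<^sup>2 + 3/2) * (u\<^sup>2 + 3) / (u\<^sup>2 + 9/2)))
      (at (sqrt (r - 9/4)))"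
    using t_of_u_deriv[OF u(1)] by (simp add: u_def)
  ultimately have "((\<lambda>s. t_of_u (sqrt (s - 9/4))) has_real_derivative
      2 * sqrt ((u\<^sup>2 + 3/2) * (u\<^sup>2 + 3) / (u\<^sup>2 + 9/2)) * (inverse u / 2)) (at r)"
    by (intro DERIV_chain2[where f = t_of_u and g = "\<lambda>s. sqrt (s - 9/4)"])
  also have "2 * sqrt ((u\<^sup>2 + 3/2) * (u\<^sup>2 + 3) / (u\<^sup>2 + 9/2)) * (inverse u / 2) =
      sqrt ((r - 3/4) * (r + 3/4)) / sqrt ((r - 9/4) * (r + 9/4))"
  proof -
    have "(r - 3/4) * (r + 3/4) = (u\<^sup>2 + 3/2) * (u\<^sup>2 + 3)" "(r - 9/4) * (r + 9/4) = u\<^sup>2 * (u\<^sup>2 + 9/2)"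
      by (simp_all add: u(2) algebra_simps)
    then show ?thesis
      using u(1) by (simp add: real_sqrt_divide real_sqrt_mult divide_simps)
  qed
  finally show ?thesis .
qed

lemma t_of_r_eq:
  assumes r: "9/4 \<le> r"
  shows "t_of_r r = t_of_u (sqrt (r - 9/4))"
proof -
  let ?h = "\<lambda>s::real. sqrt ((s - 3/4) * (s + 3/4)) / sqrt ((s - 9/4) * (s + 9/4))"
  have "(?h has_integral t_of_u (sqrt (r - 9/4)) - t_of_u (sqrt (9/4 - 9/4))) {9/4..r}"
  proof (rule fundamental_theorem_of_calculus_interior[OF r])
    show "continuous_on {9/4..r} (\<lambda>s. t_of_u (sqrt (s - 9/4)))"
      by (rule continuous_on_compose2[OF t_of_u_cont[of "sqrt (r - 9/4)"]])
         (auto intro!: continuous_intros)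
    fix s assume "s \<in> {9/4<..<r}"
    then show "((\<lambda>s. t_of_u (sqrt (s - 9/4))) has_vector_derivative ?h s) (at s)"
      using t_of_u_sqrt_deriv[of s] by (simp add: has_real_derivative_iff_has_vector_derivative)
  qed
  then show ?thesis
    by (simp add: t_of_r_def integral_unique)
qed

lemma t_of_r_deriv:
  assumes r: "9/4 < r"
  shows "(t_of_r has_real_derivative
    sqrt ((r - 3/4) * (r + 3/4)) / sqrt ((r - 9/4) * (r + 9/4))) (at r)"
  by (rule has_field_derivative_transform_within_open[OF t_of_u_sqrt_deriv[OF r], of "{9/4<..}"])
     (use r in \<open>auto simp: t_of_r_eq\<close>)

lemma t_of_u_strict_mono:
  assumes "0 \<le> u" "u < v"
  shows "t_of_u u < t_of_u v"
proof (rule DERIV_pos_imp_increasing_open[OF assms(2)])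
  show "continuous_on {u..v} t_of_u"
    using t_of_u_cont[of v] assms by (auto elim: continuous_on_subset)
  fix x assume "u < x" "x < v"
  then show "\<exists>y. (t_of_u has_real_derivative y) (at x) \<and> y > 0"
    using t_of_u_deriv[of x] assms
    by (intro exI[of _ "2 * sqrt ((x\<^sup>2 + 3/2) * (x\<^sup>2 + 3) / (x\<^sup>2 + 9/2))"])
       (auto intro!: divide_pos_pos mult_pos_pos add_nonneg_pos)
qed

text \<open>The integrand is at least 2, because
  \<open>x\<^sup>2 + 9/2 \<le> (x\<^sup>2 + 3/2) * (x\<^sup>2 + 3)\<close>. This gives both that
  \<open>t\<close> reaches every nonnegative value and that
  \<open>r - 9/4 \<le> (t / 2)\<^sup>2\<close>, the continuity of \<open>r_of_t\<close> at
  0.\<close>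

lemma t_of_u_ge:
  assumes "0 \<le> u"
  shows "2 * u \<le> t_of_u u"
proof -
  have "t_of_u 0 - 2 * 0 \<le> t_of_u u - 2 * u"
  proof (rule DERIV_nonneg_imp_increasing_open[OF assms, where f = "\<lambda>u. t_of_u u - 2 * u"])
    show "continuous_on {0..u} (\<lambda>u. t_of_u u - 2 * u)"
      by (intro continuous_intros t_of_u_cont)
    fix x assume x: "0 < x" "x < u"
    have "x\<^sup>2 + 9/2 \<le> (x\<^sup>2 + 3/2) * (x\<^sup>2 + 3)"
      using zero_le_power2[of x] mult_nonneg_nonneg[OF zero_le_power2[of x] zero_le_power2[of x]]
      by (simp only: distrib_left distrib_right)
    then have "1 \<le> (x\<^sup>2 + 3/2) * (x\<^sup>2 + 3) / (x\<^sup>2 + 9/2)"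
      by (subst le_divide_eq_1_pos) (auto intro: add_nonneg_pos)
    then have "1 \<le> sqrt ((x\<^sup>2 + 3/2) * (x\<^sup>2 + 3) / (x\<^sup>2 + 9/2))" by simp
    moreover have "((\<lambda>u. t_of_u u - 2 * u) has_real_derivative
        2 * sqrt ((x\<^sup>2 + 3/2) * (x\<^sup>2 + 3) / (x\<^sup>2 + 9/2)) - 2) (at x)"
      using x by (auto intro!: derivative_eq_intros t_of_u_deriv)
    ultimately show "\<exists>y. ((\<lambda>u. t_of_u u - 2 * u) has_real_derivative y) (at x) \<and> y \<ge> 0"
      by (intro exI[of _ "2 * sqrt ((x\<^sup>2 + 3/2) * (x\<^sup>2 + 3) / (x\<^sup>2 + 9/2)) - 2"]) simp
  qed
  then show ?thesis by simp
qed

lemma t_of_r_bij: "bij_betw t_of_r {9/4..} {0..}"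
proof -
  have "inj_on t_of_r {9/4..}"
  proof (rule inj_onI)
    fix x y :: real assume xy: "x \<in> {9/4..}" "y \<in> {9/4..}" "t_of_r x = t_of_r y"
    then have "\<not> sqrt (x - 9/4) < sqrt (y - 9/4)" "\<not> sqrt (y - 9/4) < sqrt (x - 9/4)"
      using t_of_u_strict_mono[of "sqrt (x - 9/4)" "sqrt (y - 9/4)"]
        t_of_u_strict_mono[of "sqrt (y - 9/4)" "sqrt (x - 9/4)"]
      by (auto simp: t_of_r_eq)
    then show "x = y" by simp
  qed
  moreover have "t_of_r ` {9/4..} = {0..}"
  proof (intro equalityI subsetI)
    fix t assume "t \<in> t_of_r ` {9/4..}"
    then obtain r where r: "9/4 \<le> r" "t = t_of_r r" by auto
    then have "0 \<le> 2 * sqrt (r - 9/4)" by simp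
    also have "\<dots> \<le> t" using t_of_u_ge[of "sqrt (r - 9/4)"] r by (simp add: t_of_r_eq)
    finally show "t \<in> {0..}" by simp
  next
    fix t :: real assume t: "t \<in> {0..}"
    then have "\<exists>u\<ge>0. u \<le> t \<and> t_of_u u = t"
      using t_of_u_ge[of t] by (intro IVT') (auto intro: t_of_u_cont)
    then obtain u where u: "u \<ge> 0" "t_of_u u = t" by auto
    then have "t_of_r (u\<^sup>2 + 9/4) = t" by (simp add: t_of_r_eq)
    then show "t \<in> t_of_r ` {9/4..}" by (auto intro!: rev_image_eqI[of "u\<^sup>2 + 9/4"])
  qed
  ultimately show ?thesis by (simp add: bij_betw_def)
qed

lemma r_of_t_ge: "t \<ge> 0 \<Longrightarrow> r_of_t t \<ge> 9/4"
  and t_of_r_of_t: "t \<ge> 0 \<Longrightarrow> t_of_r (r_of_t t) = t"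
  and r_of_t_of_r: "r \<ge> 9/4 \<Longrightarrow> r_of_t (t_of_r r) = r"
  using t_of_r_bij inv_into_into[of t t_of_r "{9/4..}"] f_inv_into_f[of t t_of_r "{9/4..}"]
    inv_into_f_f[of t_of_r "{9/4..}" r]
  unfolding r_of_t_def bij_betw_def by simp_all

lemma r_of_t_0: "r_of_t 0 = 9/4"
  using r_of_t_of_r[of "9/4"] by (simp add: t_of_r_eq)

lemma t_of_u_r_of_t: "t \<ge> 0 \<Longrightarrow> t_of_u (sqrt (r_of_t t - 9/4)) = t"
  using t_of_r_eq[OF r_of_t_ge] t_of_r_of_t by simp

lemma r_of_t_gt:
  assumes "t > 0"
  shows "r_of_t t > 9/4"
  using r_of_t_ge[of t] t_of_u_r_of_t[of t] assms by (cases "r_of_t t = 9/4") auto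

lemma sqrt_r_of_t_le: "t \<ge> 0 \<Longrightarrow> sqrt (r_of_t t - 9/4) \<le> t / 2"
  using t_of_u_ge[of "sqrt (r_of_t t - 9/4)"] t_of_u_r_of_t[of t] r_of_t_ge[of t] by simp

text \<open>The integrand that defines \<open>t\<close> is \<open>1 / A\<^sub>1\<close> as a
  function of \<open>r\<close>. Hence \<open>d/dt\<close> is \<open>A\<^sub>1 d/dr\<close>, the
  origin of the factor \<open>Acf 1 t\<close> in all equations below.\<close>

lemma r_of_t_deriv:
  assumes t: "t > 0"
  shows "(r_of_t has_real_derivative Acf 1 t) (at t)"
proof -
  define r where "r = r_of_t t"
  have r: "r > 9/4" using r_of_t_gt[OF t] by (simp add: r_def)
  have "isCont r_of_t (t_of_r r)"
  proof (rule isCont_inverse_function[where d = "(r - 9/4) / 2" and x = r and f = t_of_r])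
    show "0 < (r - 9/4) / 2" using r by simp
    fix z assume "\<bar>z - r\<bar> \<le> (r - 9/4) / 2"
    then have z: "z > 9/4" using r abs_ge_minus_self[of "z - r"] by argo
    then show "r_of_t (t_of_r z) = z" "isCont t_of_r z"
      using t_of_r_deriv[OF z] by (auto intro: r_of_t_of_r DERIV_isCont)
  qed
  then have "isCont r_of_t t" using t by (simp add: r_def t_of_r_of_t)
  then have "(r_of_t has_real_derivative
      inverse (sqrt ((r - 3/4) * (r + 3/4)) / sqrt ((r - 9/4) * (r + 9/4)))) (at t)"
    using t_of_r_deriv[OF r] r t
    by (intro DERIV_inverse_function[where a = 0 and b = "t + 1"])
       (auto simp: r_def t_of_r_of_t)
  then show ?thesis by (simp add: Acf_def r_def Let_def)
qed

lemma r_of_t_cont: "continuous_on {0..} r_of_t"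
proof -
  have "continuous (at t within {0..}) r_of_t" if "t \<ge> 0" for t
  proof (cases "t = 0")
    case False
    then show ?thesis
      using r_of_t_deriv[of t] that by (auto intro: continuous_at_imp_continuous_within DERIV_isCont)
  next
    case True
    have b: "\<bar>r_of_t s - 9/4\<bar> \<le> (s / 2)\<^sup>2" if "s \<ge> 0" for s
      using power_mono[OF sqrt_r_of_t_le[OF that], of 2] r_of_t_ge[OF that] by simp
    have "((\<lambda>s. r_of_t s - 9/4) \<longlongrightarrow> 0) (at 0 within {0..})"
    proof (rule Lim_null_comparison)
      show "\<forall>\<^sub>F s in at 0 within {0..}. norm (r_of_t s - 9/4) \<le> (s / 2)\<^sup>2"
        using b by (auto simp: eventually_at_filter)
      show "((\<lambda>s::real. (s / 2)\<^sup>2) \<longlongrightarrow> 0) (at 0 within {0..})"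
        by (auto intro!: tendsto_eq_intros)
    qed
    then show ?thesis
      using True by (simp add: continuous_within r_of_t_0 LIM_zero_iff)
  qed
  then show ?thesis by (simp add: continuous_on_eq_continuous_within)
qed

text \<open>The derivative of \<open>t_of_u\<close> at 0 is 2. This translates the slopes of
  \<open>f\<close> and \<open>g\<close> in \<open>t\<close> into initial values at
  \<open>r = 9/4\<close>.\<close>

lemma sqrt_r_of_t_asymp: "((\<lambda>t. t / sqrt (r_of_t t - 9/4)) \<longlongrightarrow> 2) (at_right 0)"
proof -
  have "sqrt ((0\<^sup>2 + 3/2) * (0\<^sup>2 + 3) / (0\<^sup>2 + 9/2)) = (1::real)"
    by (subst real_sqrt_eq_1_iff) simp
  then have "(t_of_u has_real_derivative 2) (at 0 within {0..1})"
    using t_of_u_deriv_within[of 0 1] by (simp only: atLeastAtMost_iff) simp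
  then have "((\<lambda>u. t_of_u u / u) \<longlongrightarrow> 2) (at 0 within {0..1})"
    by (simp add: has_field_derivative_iff)
  then have 1: "((\<lambda>u. t_of_u u / u) \<longlongrightarrow> 2) (at_right 0)"
    using at_within_Icc_at_right[of 0 "1::real"] by simp
  have ev: "\<forall>\<^sub>F t::real in at_right 0. t > 0"
    by (rule eventually_at_right_less)
  have "((\<lambda>t. sqrt (r_of_t t - 9/4)) \<longlongrightarrow> 0) (at_right 0)"
  proof (rule Lim_null_comparison)
    show "\<forall>\<^sub>F t in at_right 0. norm (sqrt (r_of_t t - 9/4)) \<le> t / 2"
      using ev by eventually_elim (use sqrt_r_of_t_le r_of_t_ge in auto)
    show "((\<lambda>t::real. t / 2) \<longlongrightarrow> 0) (at_right 0)"
      by (auto intro!: tendsto_eq_intros)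
  qed
  then have "filterlim (\<lambda>t. sqrt (r_of_t t - 9/4)) (at_right 0) (at_right 0)"
    by (rule tendsto_imp_filterlim_at_right) (use ev in eventually_elim, use r_of_t_gt in auto)
  from filterlim_compose[OF 1 this] show ?thesis
    by (rule Lim_transform_eventually) (use ev in eventually_elim, auto simp: t_of_u_r_of_t)
qed

section \<open>The coefficient functions of the metric and their relations\<close>

lemma Acf_3: "Acf 3 = Acf 2" and Bcf_3: "Bcf 3 = Bcf 2"
  by (auto simp: Acf_def Bcf_def fun_eq_iff)

lemma Acf_pos: "t > 0 \<Longrightarrow> Acf i t > 0"
  using r_of_t_gt[of t] by (auto simp: Acf_def Let_def)

lemma Bcf_pos: "t > 0 \<Longrightarrow> Bcf i t > 0"
  using r_of_t_gt[of t] by (auto simp: Bcf_def Let_def)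

lemma Acf_1_sq:
  assumes "t \<ge> 0"
  shows "(Acf 1 t)\<^sup>2 =
    ((r_of_t t - 9/4) * (r_of_t t + 9/4)) / ((r_of_t t - 3/4) * (r_of_t t + 3/4))"
proof -
  have "(r_of_t t - 9/4) * (r_of_t t + 9/4) \<ge> 0" "(r_of_t t - 3/4) * (r_of_t t + 3/4) \<ge> 0"
    using r_of_t_ge[OF assms] by simp_all
  then show ?thesis by (simp add: Acf_def Let_def power_divide)
qed

lemma Acf_2_sq: "t \<ge> 0 \<Longrightarrow> (Acf 2 t)\<^sup>2 = (r_of_t t - 9/4) * (r_of_t t + 3/4) / 3"
  using r_of_t_ge[of t] by (auto simp: Acf_def Let_def)

lemma Bcf_1: "Bcf 1 t = 2 * r_of_t t / 3"
  by (simp add: Bcf_def)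

lemma Bcf_2_sq: "t \<ge> 0 \<Longrightarrow> (Bcf 2 t)\<^sup>2 = (r_of_t t - 3/4) * (r_of_t t + 9/4) / 3"
  using r_of_t_ge[of t] by (auto simp: Bcf_def Let_def)

text \<open>Both sides are nonnegative and their squares are the same rational function of
  \<open>r\<close>. So \<open>A\<^sub>2 / (A\<^sub>1 B\<^sub>2)\<close> is rational in
  \<open>r\<close>, and this removes the square roots from the equation for
  \<open>b\<close>.\<close>

lemma Acf_2_eq:
  assumes "t \<ge> 0"
  shows "Acf 2 t * (r_of_t t + 9/4) = (r_of_t t + 3/4) * Acf 1 t * Bcf 2 t"
proof (rule power2_eq_imp_eq)
  define r where "r = r_of_t t"
  have n: "r - 3/4 \<noteq> 0" "r + 3/4 \<noteq> 0" using r_of_t_ge[OF assms] by (simp_all add: r_def)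
  have "(r - 9/4) * (r + 3/4) / 3 * (r + 9/4)\<^sup>2 = (r + 3/4)\<^sup>2 *
      ((r - 9/4) * (r + 9/4) / ((r - 3/4) * (r + 3/4))) * ((r - 3/4) * (r + 9/4) / 3)"
    using n by (simp add: power2_eq_square)
  then show "(Acf 2 t * (r_of_t t + 9/4))\<^sup>2 = ((r_of_t t + 3/4) * Acf 1 t * Bcf 2 t)\<^sup>2"
    unfolding power_mult_distrib Acf_1_sq[OF assms] Acf_2_sq[OF assms] Bcf_2_sq[OF assms] r_def .
qed (use assms r_of_t_ge[of t] in \<open>auto simp: Acf_def Bcf_def Let_def\<close>)

lemma Acf_1_le:
  assumes "t \<ge> 0"
  shows "Acf 1 t \<le> 1"
proof -
  have "(r_of_t t - 9/4) * (r_of_t t + 9/4) \<le> (r_of_t t - 3/4) * (r_of_t t + 3/4)"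
    by (simp add: algebra_simps)
  moreover have "(r_of_t t - 3/4) * (r_of_t t + 3/4) > 0"
    using r_of_t_ge[OF assms] by simp
  ultimately show ?thesis
    by (simp add: Acf_def Let_def)
qed

lemma Acf_1_cont: "continuous_on {0..} (Acf 1)"
proof -
  have "(r_of_t t - 3/4) * (r_of_t t + 3/4) \<noteq> 0" if "t \<ge> 0" for t
    using r_of_t_ge[OF that] by simp
  then have "continuous_on {0..} (\<lambda>t. sqrt ((r_of_t t - 9/4) * (r_of_t t + 9/4))
      / sqrt ((r_of_t t - 3/4) * (r_of_t t + 3/4)))"
    by (intro continuous_intros r_of_t_cont) auto
  then show ?thesis by (simp add: Acf_def Let_def)
qed

subsection \<open>The reduced system\<close>

text \<open>The coefficient \<open>k\<close> of the overview.\<close>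

definition decay :: "real \<Rightarrow> real" where
  "decay r = 3 * (r - 3/4) / (r * (r + 9/4) ^ 5)"

abbreviation Y_ode :: "(real \<Rightarrow> real) \<Rightarrow> (real \<Rightarrow> real) \<Rightarrow> real \<Rightarrow> bool" where
  "Y_ode Y D t \<equiv> (Y has_real_derivative - (Acf 1 t * decay (r_of_t t)) * (D t)\<^sup>2) (at t)"

abbreviation D_ode :: "(real \<Rightarrow> real) \<Rightarrow> (real \<Rightarrow> real) \<Rightarrow> real \<Rightarrow> bool" where
  "D_ode Y D t \<equiv> (D has_real_derivative - Acf 1 t * Y t * D t) (at t)"

lemma decay_pos: "r \<ge> 9/4 \<Longrightarrow> decay r > 0"
  by (simp add: decay_def)

lemma decay_le_1:
  assumes "r \<ge> 9/4"
  shows "decay r \<le> 1"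
proof -
  have "3 * (r - 3/4) \<le> r * 3" by simp
  also have "\<dots> \<le> r * (r + 9/4) ^ 5"
    using assms power_increasing[of 1 5 "r + 9/4"] by (intro mult_left_mono) auto
  finally show ?thesis using assms by (simp add: decay_def divide_le_eq_1)
qed

text \<open>Expanded in powers of \<open>r - 9/4\<close>, the quadratic factor in the numerator of
  the derivative has only positive coefficients, so that the sign is visible on the whole
  range.\<close>

lemma decay_deriv_nonpos:
  assumes "r \<ge> 9/4"
  shows "\<exists>k'\<le>0. (decay has_real_derivative k') (at r)"
proof -
  have "(decay has_real_derivative
     (3 * (r * (r + 9/4) ^ 5) - 3 * (r - 3/4) * ((r + 9/4) ^ 5 + r * (5 * (r + 9/4) ^ 4))) /
       ((r * (r + 9/4) ^ 5) * (r * (r + 9/4) ^ 5))) (at r)"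
    unfolding decay_def[abs_def] using assms by (auto intro!: derivative_eq_intros)
  moreover have "3 * (r * (r + 9/4) ^ 5) - 3 * (r - 3/4) * ((r + 9/4) ^ 5 + r * (5 * (r + 9/4) ^ 4))
      = - 3 * ((r + 9/4) ^ 4 * (5 * (r - 9/4)\<^sup>2 + 18 * (r - 9/4) + 27/2))"
  proof -
    have "3 * (r * p ^ 5) - 3 * (r - 3/4) * (p ^ 5 + r * (5 * p ^ 4))
        = 3 * (p ^ 4 * (p * r - (r - 3/4) * (p + 5 * r)))" for p
      by algebra
    moreover have "(r + 9/4) * r - (r - 3/4) * ((r + 9/4) + 5 * r)
        = - (5 * (r - 9/4)\<^sup>2 + 18 * (r - 9/4) + 27/2)"
      by (simp add: power2_eq_square field_simps)
    ultimately show ?thesis by (simp only: mult_minus_right mult_minus_left)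
  qed
  moreover have "(r + 9/4) ^ 4 * (5 * (r - 9/4)\<^sup>2 + 18 * (r - 9/4) + 27/2) \<ge> 0"
    using assms by (intro mult_nonneg_nonneg add_nonneg_nonneg) auto
  ultimately have "(decay has_real_derivative
      - 3 * ((r + 9/4) ^ 4 * (5 * (r - 9/4)\<^sup>2 + 18 * (r - 9/4) + 27/2)) /
       ((r * (r + 9/4) ^ 5) * (r * (r + 9/4) ^ 5))) (at r)"
    and "- 3 * ((r + 9/4) ^ 4 * (5 * (r - 9/4)\<^sup>2 + 18 * (r - 9/4) + 27/2)) \<le> 0"
    by (simp_all only: mult_minus_left neg_le_0_iff_le)
  then show ?thesis
    using assms by (blast intro: divide_nonpos_nonneg mult_nonneg_nonneg zero_le_square)
qed

lemma decay_r_of_t_cont: "continuous_on {0..} (\<lambda>t. decay (r_of_t t))"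
  unfolding decay_def using r_of_t_ge by (intro continuous_intros r_of_t_cont) fastforce

lemma sqrt_decay_deriv:
  assumes "t > 0"
  shows "\<exists>m'\<le>0. ((\<lambda>t. sqrt (decay (r_of_t t))) has_real_derivative m') (at t)"
proof -
  have r: "r_of_t t \<ge> 9/4" using r_of_t_gt[OF assms] by simp
  obtain k' where k': "k' \<le> 0" "(decay has_real_derivative k') (at (r_of_t t))"
    using decay_deriv_nonpos[OF r] by blast
  have "((\<lambda>t. sqrt (decay (r_of_t t))) has_real_derivative
      inverse (sqrt (decay (r_of_t t))) / 2 * (k' * Acf 1 t)) (at t)"
    by (rule DERIV_chain2[OF DERIV_real_sqrt[OF decay_pos[OF r]] DERIV_chain2[OF k'(2) r_of_t_deriv[OF assms]]])
  moreover have "inverse (sqrt (decay (r_of_t t))) / 2 * (k' * Acf 1 t) \<le> 0"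
    using decay_pos[OF r] k' Acf_pos[OF assms, of 1] by (simp add: mult_nonneg_nonpos mult_nonpos_nonneg)
  ultimately show ?thesis by blast
qed

text \<open>The barrier: along the flow the region \<open>Y \<ge> sqrt decay * D\<close> is forward-invariant,
  because \<open>decay\<close> is decreasing. The function \<open>w\<close> covers both the system itself and its
  truncation at \<open>Y = 0\<close>.\<close>

lemma barrier:
  assumes ab: "0 \<le> a" "a \<le> b"
    and cont: "continuous_on {a..b} Y" "continuous_on {a..b} D" "continuous_on {a..b} w"
    and Y': "\<And>t. a < t \<Longrightarrow> t < b \<Longrightarrow> Y_ode Y D t"
    and D': "\<And>t. a < t \<Longrightarrow> t < b \<Longrightarrow> D_ode w D t"
    and w: "\<And>t. t \<in> {a..b} \<Longrightarrow> Y t \<le> w t"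
    and init: "D a > 0" "Y a \<ge> sqrt (decay (r_of_t a)) * D a"
  shows "D b > 0 \<and> Y b \<ge> sqrt (decay (r_of_t b)) * D b"
proof -
  define m where "m t = sqrt (decay (r_of_t t))" for t
  have sub: "{a..c} \<subseteq> {0..}" for c using ab by auto
  \<comment> \<open>\<open>D\<close> solves a linear equation with continuous coefficient
    \<open>- Acf 1 t * w t\<close>, so it stays positive whatever the sign of
    \<open>w\<close>.\<close>
  have D_pos: "D c > 0" if "c \<in> {a..b}" for c
  proof -
    have "D a * exp (integral {a..c} (\<lambda>t. - Acf 1 t * w t)) \<le> D c"
      using that
      by (intro exp_integral_le_of_deriv_ge[where z' = "\<lambda>t. - Acf 1 t * w t * D t"] continuous_intros
          continuous_on_subset[OF cont(2)] continuous_on_subset[OF cont(3)] continuous_on_subset[OF Acf_1_cont] D')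
         (use ab in auto)
    moreover have "D a * exp (integral {a..c} (\<lambda>t. - Acf 1 t * w t)) > 0"
      using init by simp
    ultimately show ?thesis by linarith
  qed
  have m_cont: "continuous_on {a..b} m"
    unfolding m_def by (intro continuous_on_real_sqrt continuous_on_subset[OF decay_r_of_t_cont] sub)
  have m_sq: "m t * m t = decay (r_of_t t)" and m_nonneg: "m t \<ge> 0" if "t \<ge> 0" for t
    using decay_pos[OF r_of_t_ge[OF that]] by (auto simp: m_def)
  have "\<exists>m'. m' \<le> 0 \<and> (m has_real_derivative m') (at t)" if "t > 0" for t
    using sqrt_decay_deriv[OF that] by (auto simp: m_def[abs_def])
  then obtain m' where m': "\<And>t. t > 0 \<Longrightarrow> m' t \<le> 0" "\<And>t. t > 0 \<Longrightarrow> (m has_real_derivative m' t) (at t)"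
    by metis
  define z where "z t = Y t - m t * D t" for t
  define z' where "z' t = - (Acf 1 t * decay (r_of_t t)) * (D t)\<^sup>2 - (m' t * D t - m t * (Acf 1 t * w t * D t))" for t
  have "z a * exp (integral {a..b} (\<lambda>t. Acf 1 t * m t * D t)) \<le> z b"
  proof (rule exp_integral_le_of_deriv_ge[OF ab(2), where z' = z'])
    show "continuous_on {a..b} z"
      unfolding z_def by (intro continuous_intros cont m_cont)
    show "continuous_on {a..b} (\<lambda>t. Acf 1 t * m t * D t)"
      by (intro continuous_intros cont m_cont continuous_on_subset[OF Acf_1_cont] sub)
    fix t assume t: "a < t" "t < b"
    then have t0: "t > 0" using ab by simp
    show "(z has_real_derivative z' t) (at t)"
      unfolding z_def[abs_def] z'_def
      by (rule derivative_eq_intros Y'[OF t] D'[OF t] m'(2)[OF t0] refl)+ (simp add: algebra_simps)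
    have "Acf 1 t * m t * D t * (w t - Y t) \<ge> 0"
      using w[of t] D_pos[of t] m_nonneg[of t] Acf_pos[OF t0, of 1] t t0 by simp
    moreover have "m' t * D t \<le> 0"
      using m'(1)[OF t0] D_pos[of t] t by (simp add: mult_nonpos_nonneg)
    \<comment> \<open>For \<open>w = Y\<close> and constant \<open>m\<close> this difference would
      vanish: the boundary of the region would be invariant. The two remaining terms come from the
      truncation and from the decrease of \<open>m\<close>, and both point into the region.\<close>
    moreover have "z' t - Acf 1 t * m t * D t * z t = Acf 1 t * m t * D t * (w t - Y t) - m' t * D t"
      using m_sq[of t] t0 by (simp add: z'_def z_def power2_eq_square algebra_simps)
    ultimately show "z' t \<ge> Acf 1 t * m t * D t * z t" by linarith
  qed
  moreover have "z a \<ge> 0" using init by (simp add: z_def m_def)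
  ultimately have "z b \<ge> 0"
    by (meson exp_ge_zero mult_nonneg_nonneg order_trans)
  then show ?thesis
    using D_pos[of b] ab by (simp add: z_def m_def)
qed

section \<open>The truncated system and the continuation of solutions\<close>

lemma exp_diff_le:
  fixes x y c :: real
  assumes "c \<le> x" "c \<le> y"
  shows "\<bar>exp (- 2 * x) - exp (- 2 * y)\<bar> \<le> 2 * exp (- 2 * c) * \<bar>x - y\<bar>"
proof -
  have *: "\<bar>exp (- 2 * x) - exp (- 2 * y)\<bar> \<le> 2 * exp (- 2 * c) * \<bar>x - y\<bar>"
    if "c \<le> x" "x \<le> y" for x y :: real
  proof -
    have "exp (- 2 * y) = exp (- 2 * x) * exp (- 2 * (y - x))"
      by (simp add: exp_add[symmetric] algebra_simps)
    then have "\<bar>exp (- 2 * x) - exp (- 2 * y)\<bar> = exp (- 2 * x) * (1 - exp (- 2 * (y - x)))"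
      using that by (simp add: right_diff_distrib)
    also have "\<dots> \<le> exp (- 2 * c) * (2 * (y - x))"
    proof (rule mult_mono)
      show "1 - exp (- 2 * (y - x)) \<le> 2 * (y - x)"
        using exp_ge_add_one_self[of "- 2 * (y - x)"] by linarith
    qed (use that in auto)
    finally show ?thesis using that by (simp add: algebra_simps)
  qed
  show ?thesis
    using *[of x y] *[of y x] assms by (cases "x \<le> y") (auto simp: abs_minus_commute)
qed

text \<open>The unknowns are \<open>(Y, - ln D)\<close>, which makes the positivity of \<open>D\<close> automatic. The bounds
  \<open>y1\<close>, \<open>\<phi>1\<close> are the values at the initial time.\<close>

definition trunc_field :: "real \<Rightarrow> real \<Rightarrow> real \<Rightarrow> real \<times> real \<Rightarrow> real \<times> real" where
  "trunc_field y1 \<phi>1 t x = (- (Acf 1 t * decay (r_of_t t)) * exp (- 2 * max (snd x) \<phi>1),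
     Acf 1 t * max 0 (min (fst x) y1))"

lemma Acf_decay_bounds:
  assumes "t \<ge> 0"
  shows "0 \<le> Acf 1 t * decay (r_of_t t)" "Acf 1 t * decay (r_of_t t) \<le> 1" "0 \<le> Acf 1 t"
proof -
  show A: "0 \<le> Acf 1 t" using r_of_t_ge[OF assms] by (simp add: Acf_def Let_def)
  show "0 \<le> Acf 1 t * decay (r_of_t t)"
    using A decay_pos[OF r_of_t_ge[OF assms]] by simp
  show "Acf 1 t * decay (r_of_t t) \<le> 1"
    using A Acf_1_le[OF assms] decay_pos[OF r_of_t_ge[OF assms]] decay_le_1[OF r_of_t_ge[OF assms]]
    by (intro mult_le_one) auto
qed

lemma trunc_field_cont: "0 \<le> a \<Longrightarrow> continuous_on ({a..} \<times> UNIV) (\<lambda>(t, x). trunc_field y1 \<phi>1 t x)"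
  unfolding trunc_field_def split_beta
  by (intro continuous_intros continuous_on_compose2[OF Acf_1_cont]
      continuous_on_compose2[OF decay_r_of_t_cont]) auto

lemma trunc_field_bound:
  assumes "0 \<le> t"
  shows "norm (trunc_field y1 \<phi>1 t x) \<le> exp (- 2 * \<phi>1) + \<bar>y1\<bar>"
proof -
  have "Acf 1 t * decay (r_of_t t) * exp (- 2 * max (snd x) \<phi>1) \<le> 1 * exp (- 2 * \<phi>1)"
    using Acf_decay_bounds[OF assms] by (intro mult_mono) auto
  moreover have "Acf 1 t * max 0 (min (fst x) y1) \<le> 1 * \<bar>y1\<bar>"
    using Acf_decay_bounds[OF assms] Acf_1_le[OF assms] by (intro mult_mono) auto
  moreover have "norm (trunc_field y1 \<phi>1 t x) \<le>
      Acf 1 t * decay (r_of_t t) * exp (- 2 * max (snd x) \<phi>1) + Acf 1 t * max 0 (min (fst x) y1)"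
  proof -
    have "norm (- (Acf 1 t * decay (r_of_t t)) * exp (- 2 * max (snd x) \<phi>1)) =
        Acf 1 t * decay (r_of_t t) * exp (- 2 * max (snd x) \<phi>1)"
      using mult_nonneg_nonneg[OF Acf_decay_bounds(1)[OF assms] exp_ge_zero[of "- 2 * max (snd x) \<phi>1"]]
      by (simp only: mult_minus_left abs_minus_cancel real_norm_def abs_of_nonneg)
    moreover have "norm (Acf 1 t * max 0 (min (fst x) y1)) = Acf 1 t * max 0 (min (fst x) y1)"
      using Acf_decay_bounds(3)[OF assms] by simp
    ultimately show ?thesis
      unfolding trunc_field_def by (metis norm_Pair_le)
  qed
  ultimately show ?thesis by linarith
qed

lemma trunc_field_lipschitz:
  assumes "0 \<le> t"
  shows "norm (trunc_field y1 \<phi>1 t x - trunc_field y1 \<phi>1 t x') \<le> (2 * exp (- 2 * \<phi>1) + 1) * norm (x - x')"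
proof -
  define q where "q = Acf 1 t * decay (r_of_t t)"
  let ?u = "max (snd x) \<phi>1" and ?u' = "max (snd x') \<phi>1"
  let ?v = "max 0 (min (fst x) y1)" and ?v' = "max 0 (min (fst x') y1)"
  have n: "\<bar>fst x - fst x'\<bar> \<le> norm (x - x')" "\<bar>snd x - snd x'\<bar> \<le> norm (x - x')"
    using norm_fst_le[of "fst (x - x')" "snd (x - x')"]
      norm_snd_le[of "snd (x - x')" "fst (x - x')"] unfolding prod.collapse by auto
  have u: "\<bar>?u - ?u'\<bar> \<le> norm (x - x')" and v: "\<bar>?v - ?v'\<bar> \<le> norm (x - x')"
    using n by (auto simp: max_def min_def)
  have "\<bar>q * (exp (- 2 * ?u') - exp (- 2 * ?u))\<bar> \<le> 1 * (2 * exp (- 2 * \<phi>1) * \<bar>?u' - ?u\<bar>)"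
    unfolding abs_mult using Acf_decay_bounds[OF assms]
    by (intro mult_mono exp_diff_le) (auto simp: q_def)
  also have "\<dots> \<le> 2 * exp (- 2 * \<phi>1) * norm (x - x')"
    using u by (simp add: abs_minus_commute)
  finally have 1: "\<bar>q * (exp (- 2 * ?u') - exp (- 2 * ?u))\<bar> \<le> 2 * exp (- 2 * \<phi>1) * norm (x - x')" .
  have "\<bar>Acf 1 t * (?v - ?v')\<bar> \<le> 1 * norm (x - x')"
    unfolding abs_mult using Acf_decay_bounds[OF assms] Acf_1_le[OF assms] v by (intro mult_mono) auto
  then have 2: "\<bar>Acf 1 t * (?v - ?v')\<bar> \<le> norm (x - x')" by simp
  have "trunc_field y1 \<phi>1 t x - trunc_field y1 \<phi>1 t x' =
      (q * (exp (- 2 * ?u') - exp (- 2 * ?u)), Acf 1 t * (?v - ?v'))"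
    by (simp add: trunc_field_def q_def right_diff_distrib)
  then have "norm (trunc_field y1 \<phi>1 t x - trunc_field y1 \<phi>1 t x') \<le>
      \<bar>q * (exp (- 2 * ?u') - exp (- 2 * ?u))\<bar> + \<bar>Acf 1 t * (?v - ?v')\<bar>"
    using norm_Pair_le by (metis real_norm_def)
  also have "\<dots> \<le> 2 * exp (- 2 * \<phi>1) * norm (x - x') + norm (x - x')"
    by (rule add_mono[OF 1 2])
  finally show ?thesis by (simp only: distrib_right mult_1)
qed

text \<open>The barrier, started at \<open>t = 0\<close> from the limits, puts the given solution
  into the region \<open>Y \<ge> sqrt decay * D > 0\<close> for all times below
  \<open>\<epsilon>\<close>. From an interior time on, the truncated system has a global solution;
  the barrier and monotonicity show that it solves the original system, and uniqueness identifies it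
  with the given one on the overlap.\<close>

lemma solution_extends:
  fixes Y D :: "real \<Rightarrow> real"
  assumes eps: "\<epsilon> > 0"
    and Y': "\<And>t. 0 < t \<Longrightarrow> t < \<epsilon> \<Longrightarrow> Y_ode Y D t"
    and D': "\<And>t. 0 < t \<Longrightarrow> t < \<epsilon> \<Longrightarrow> D_ode Y D t"
    and lim: "(Y \<longlongrightarrow> y0) (at_right 0)" "(D \<longlongrightarrow> d0) (at_right 0)"
    and init: "d0 > 0" "y0 \<ge> 8/243 * d0"
  obtains Y2 D2 C where
    "\<And>t. 0 < t \<Longrightarrow> Y_ode Y2 D2 t"
    "\<And>t. 0 < t \<Longrightarrow> D_ode Y2 D2 t"
    "\<And>t. 0 < t \<Longrightarrow> t < \<epsilon> \<Longrightarrow> Y2 t = Y t \<and> D2 t = D t"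
    "\<And>t. 0 < t \<Longrightarrow> 0 \<le> Y2 t \<and> Y2 t \<le> C \<and> 0 \<le> D2 t \<and> D2 t \<le> C"
proof -
  \<comment> \<open>With the limits as values at 0 both functions are continuous up to the singular
    orbit, so the barrier can start there.\<close>
  define Y0 where "Y0 t = (if t \<le> 0 then y0 else Y t)" for t
  define D0 where "D0 t = (if t \<le> 0 then d0 else D t)" for t
  have Y0': "Y_ode Y0 D0 t"
    and D0': "D_ode Y0 D0 t" if "0 < t" "t < \<epsilon>" for t
  proof -
    have "Y_ode Y0 D t"
      by (rule has_field_derivative_transform_within_open[OF Y'[OF that], of "{0<..}"])
         (use that in \<open>auto simp: Y0_def\<close>)
    then show "Y_ode Y0 D0 t"
      using that by (simp add: D0_def)
    have "(D0 has_real_derivative - Acf 1 t * Y t * D t) (at t)"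
      by (rule has_field_derivative_transform_within_open[OF D'[OF that], of "{0<..}"])
         (use that in \<open>auto simp: D0_def\<close>)
    then show "D_ode Y0 D0 t"
      using that by (simp add: D0_def Y0_def)
  qed
  have cont0: "continuous_on {0..b} Y0" "continuous_on {0..b} D0" if "b < \<epsilon>" for b
  proof -
    have aux: "continuous_on {0..b} h0"
      if h: "(h \<longlongrightarrow> l) (at_right 0)" "\<And>t. h0 t = (if t \<le> 0 then l else h t)"
        and d: "\<And>t. 0 < t \<Longrightarrow> t < \<epsilon> \<Longrightarrow> isCont h0 t" for h h0 :: "real \<Rightarrow> real" and l
      unfolding continuous_on_eq_continuous_within
    proof
      fix t assume t: "t \<in> {0..b}"
      show "continuous (at t within {0..b}) h0"
      proof (cases "t = 0")
        case False
        then show ?thesis using t \<open>b < \<epsilon>\<close> d[of t] by (auto intro: continuous_at_imp_continuous_within)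
      next
        case True
        have "(h0 \<longlongrightarrow> l) (at_right 0)"
          using h(1) by (rule Lim_transform_eventually)
            (simp add: h(2) eventually_at_filter)
        then have "(h0 \<longlongrightarrow> l) (at 0 within {0<..b})"
          by (rule tendsto_within_subset) auto
        moreover have "at 0 within {0..b} = at 0 within {0<..b}"
          unfolding at_within_def by (rule arg_cong[where f = "\<lambda>S. inf (nhds 0) (principal S)"]) auto
        ultimately show ?thesis
          using True by (simp add: continuous_within h(2))
      qed
    qed
    show "continuous_on {0..b} Y0"
      by (rule aux[OF lim(1) Y0_def]) (auto intro!: DERIV_isCont[OF Y0'])
    show "continuous_on {0..b} D0"
      by (rule aux[OF lim(2) D0_def]) (auto intro!: DERIV_isCont[OF D0'])
  qed
  have m0: "sqrt (decay (r_of_t 0)) = 8/243"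
    by (rule real_sqrt_unique) (simp_all add: decay_def r_of_t_0 power2_eq_square power_eq_if)
  have reg0: "D0 b > 0 \<and> Y0 b \<ge> sqrt (decay (r_of_t b)) * D0 b" if "0 \<le> b" "b < \<epsilon>" for b
  proof (rule barrier[where a = 0 and w = Y0])
    show "0 < D0 0" "Y0 0 \<ge> sqrt (decay (r_of_t 0)) * D0 0"
      using init unfolding m0 by (simp_all add: Y0_def D0_def)
  qed (use that cont0[of b] Y0' D0' in auto)
  have m_nonneg: "sqrt (decay (r_of_t t)) \<ge> 0" if "t \<ge> 0" for t
    using decay_pos[OF r_of_t_ge[OF that]] by simp
  have pos0: "D0 b > 0" "Y0 b \<ge> 0" if "0 \<le> b" "b < \<epsilon>" for b
    using reg0[OF that] mult_nonneg_nonneg[OF m_nonneg[of b], of "D0 b"] that by auto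
  \<comment> \<open>Any time strictly between 0 and \<open>\<epsilon>\<close> would serve; it leaves
    an overlap on which old and new solution can be compared.\<close>
  define a where "a = \<epsilon> / 2"
  have a: "0 < a" "a < \<epsilon>" using eps by (auto simp: a_def)
  define y1 where "y1 = Y0 a"
  define \<phi>1 where "\<phi>1 = - ln (D0 a)"
  have exp_\<phi>1: "exp (- \<phi>1) = D0 a" using pos0(1)[of a] a by (simp add: \<phi>1_def)
  define F where "F = trunc_field y1 \<phi>1"
  have F_bound: "norm (F t x) \<le> exp (- 2 * \<phi>1) + \<bar>y1\<bar>"
    and F_lip: "norm (F t x - F t x') \<le> (2 * exp (- 2 * \<phi>1) + 1) * norm (x - x')" if "a \<le> t" for t x x'
    unfolding F_def using trunc_field_bound trunc_field_lipschitz a that by auto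
  have F_cont: "continuous_on ({a..} \<times> UNIV) (\<lambda>(t, x). F t x)"
    unfolding F_def using a by (intro trunc_field_cont) simp
  obtain x where x: "x a = (y1, \<phi>1)" "continuous_on {a..} x"
    "\<And>t. a < t \<Longrightarrow> (x has_vector_derivative F t (x t)) (at t)"
    by (rule ode_exists_global[OF F_cont F_bound F_lip, of "(y1, \<phi>1)"]) (assumption | rule that)+
  define Y1 where "Y1 t = fst (x t)" for t
  define \<Phi> where "\<Phi> t = snd (x t)" for t
  have x_cont: "continuous_on {a..b} Y1" "continuous_on {a..b} \<Phi>" for b
  proof -
    have "continuous_on {a..b} x" by (rule continuous_on_subset[OF x(2)]) auto
    then show "continuous_on {a..b} Y1" "continuous_on {a..b} \<Phi>"
      unfolding Y1_def \<Phi>_def by (intro continuous_on_fst continuous_on_snd; assumption)+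
  qed
  have Y1'_raw: "(Y1 has_real_derivative - (Acf 1 t * decay (r_of_t t)) * exp (- 2 * max (\<Phi> t) \<phi>1)) (at t)"
    and \<Phi>': "(\<Phi> has_real_derivative Acf 1 t * max 0 (min (Y1 t) y1)) (at t)" if "a < t" for t
    using bounded_linear.has_vector_derivative[OF bounded_linear_fst x(3)[OF that]]
      bounded_linear.has_vector_derivative[OF bounded_linear_snd x(3)[OF that]]
    by (simp_all add: F_def trunc_field_def Y1_def[abs_def] \<Phi>_def[abs_def]
        has_real_derivative_iff_has_vector_derivative)
  \<comment> \<open>The components of the truncated field have fixed signs everywhere, nonpositive
    and nonnegative. So \<open>Y1\<close> never exceeds \<open>y1\<close> and \<open>\<Phi>\<close>
    never falls below \<open>\<phi>1\<close>: two of the three cut-offs are inactive.\<close>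
  have Y1_le: "Y1 b \<le> y1" if "a \<le> b" for b
  proof -
    have "Y1 b \<le> Y1 a"
    proof (rule DERIV_nonpos_imp_decreasing_open[OF that _ x_cont(1)])
      fix t assume t: "a < t"
      have "- (Acf 1 t * decay (r_of_t t)) * exp (- 2 * max (\<Phi> t) \<phi>1) \<le> 0"
        using Acf_decay_bounds(1)[of t] a t by (intro mult_nonpos_nonneg) auto
      then show "\<exists>z. (Y1 has_real_derivative z) (at t) \<and> z \<le> 0" using Y1'_raw[OF t] by blast
    qed
    then show ?thesis by (simp add: Y1_def x(1))
  qed
  have \<Phi>_ge: "\<phi>1 \<le> \<Phi> b" if "a \<le> b" for b
  proof -
    have "\<Phi> a \<le> \<Phi> b"
    proof (rule DERIV_nonneg_imp_increasing_open[OF that _ x_cont(2)])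
      fix t assume t: "a < t"
      have "Acf 1 t * max 0 (min (Y1 t) y1) \<ge> 0"
        using Acf_decay_bounds(3)[of t] a t by (intro mult_nonneg_nonneg) auto
      then show "\<exists>z. (\<Phi> has_real_derivative z) (at t) \<and> z \<ge> 0" using \<Phi>'[OF t] by blast
    qed
    then show ?thesis by (simp add: \<Phi>_def x(1))
  qed
  define D1 where "D1 t = exp (- \<Phi> t)" for t
  have Y1': "Y_ode Y1 D1 t" if "a < t" for t
  proof -
    have "exp (- 2 * \<Phi> t) = (D1 t)\<^sup>2"
      by (simp add: D1_def power2_eq_square exp_add[symmetric])
    then show ?thesis
      using Y1'_raw[OF that] \<Phi>_ge[of t] that by (simp add: max_def)
  qed
  have D1'_raw: "(D1 has_real_derivative - Acf 1 t * max 0 (Y1 t) * D1 t) (at t)" if "a < t" for t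
  proof -
    have "(D1 has_real_derivative exp (- \<Phi> t) * - (Acf 1 t * max 0 (min (Y1 t) y1))) (at t)"
      unfolding D1_def[abs_def] by (rule derivative_eq_intros \<Phi>'[OF that] refl)+
    then show ?thesis
      using Y1_le[of t] that by (simp add: D1_def min_def mult_ac)
  qed
  \<comment> \<open>The barrier is applied while the cut-off at \<open>Y = 0\<close> is still in
    place, with \<open>w = max 0 Y1\<close>. Its conclusion forces \<open>Y1 \<ge> 0\<close> and so
    removes this last cut-off.\<close>
  have reg1: "D1 b > 0 \<and> Y1 b \<ge> sqrt (decay (r_of_t b)) * D1 b" if "a \<le> b" for b
  proof (rule barrier[where a = a and w = "\<lambda>t. max 0 (Y1 t)"])
    show "continuous_on {a..b} D1"
      unfolding D1_def by (intro continuous_intros x_cont)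
    show "continuous_on {a..b} (\<lambda>t. max 0 (Y1 t))"
      by (intro continuous_intros x_cont)
    show "0 < D1 a" "Y1 a \<ge> sqrt (decay (r_of_t a)) * D1 a"
      using reg0[of a] a exp_\<phi>1 by (auto simp: D1_def \<Phi>_def Y1_def x(1) y1_def)
  qed (use a that x_cont Y1' D1'_raw in auto)
  have Y1_nonneg: "Y1 b \<ge> 0" if "a \<le> b" for b
    using reg1[OF that] mult_nonneg_nonneg[OF m_nonneg[of b], of "D1 b"] that a by auto
  \<comment> \<open>The given solution also solves the truncated system here, since
    \<open>Y0\<close> and \<open>D0\<close> do not exceed their values at \<open>a\<close>.
    Uniqueness is therefore applied to the globally Lipschitz field.\<close>
  have agree: "Y1 b = Y0 b \<and> D1 b = D0 b" if b: "a \<le> b" "b < \<epsilon>" for b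
  proof -
    define y where "y t = (Y0 t, - ln (D0 t))" for t
    have cont: "continuous_on {a..b} Y0" "continuous_on {a..b} D0"
      using cont0[OF b(2)] a by (auto elim!: continuous_on_subset)
    have y_cont: "continuous_on {a..b} y"
      unfolding y_def using pos0 a b
      by (intro continuous_intros cont) (auto simp: order_less_imp_not_eq2)
    have Y0_le: "Y0 t \<le> y1" and D0_le: "D0 t \<le> D0 a" if t: "a \<le> t" "t \<le> b" for t
    proof -
      show "Y0 t \<le> y1"
        unfolding y1_def
      proof (rule DERIV_nonpos_imp_decreasing_open[OF t(1)])
        show "continuous_on {a..t} Y0"
          by (rule continuous_on_subset[OF cont(1)]) (use t in auto)
        fix s assume s: "a < s" "s < t"
        have "- (Acf 1 s * decay (r_of_t s)) * (D0 s)\<^sup>2 \<le> 0"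
          using Acf_decay_bounds(1)[of s] s a by (intro mult_nonpos_nonneg) auto
        then show "\<exists>z. (Y0 has_real_derivative z) (at s) \<and> z \<le> 0"
          using Y0'[of s] s a b t by auto
      qed
      show "D0 t \<le> D0 a"
      proof (rule DERIV_nonpos_imp_decreasing_open[OF t(1)])
        show "continuous_on {a..t} D0"
          by (rule continuous_on_subset[OF cont(2)]) (use t in auto)
        fix s assume s: "a < s" "s < t"
        have "- Acf 1 s * Y0 s * D0 s \<le> 0"
          using Acf_decay_bounds(3)[of s] pos0[of s] s a b t by (simp add: mult_nonneg_nonneg)
        then show "\<exists>z. (D0 has_real_derivative z) (at s) \<and> z \<le> 0"
          using D0'[of s] s a b t by auto
      qed
    qed
    have y': "(y has_vector_derivative F t (y t)) (at t)" if t: "a < t" "t < b" for t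
    proof -
      have t0: "0 < t" "t < \<epsilon>" "0 \<le> t" using t a b by auto
      have D0_pos: "D0 t > 0" using pos0(1)[of t] t0 by simp
      have 1: "((\<lambda>t. - ln (D0 t)) has_real_derivative Acf 1 t * Y0 t) (at t)"
        using DERIV_minus[OF DERIV_chain2[OF DERIV_ln[OF D0_pos] D0'[OF t0(1,2)]]] D0_pos
        by (simp add: field_simps)
      have "ln (D0 t) \<le> ln (D0 a)" using D0_le[of t] D0_pos t by simp
      then have "max (- ln (D0 t)) \<phi>1 = - ln (D0 t)" by (simp add: \<phi>1_def)
      moreover have "exp (2 * ln (D0 t)) = (D0 t)\<^sup>2"
        using D0_pos exp_double[of "ln (D0 t)"] by simp
      moreover have "max 0 (min (Y0 t) y1) = Y0 t"
        using Y0_le[of t] pos0(2)[of t] t t0 by simp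
      ultimately have "F t (y t) = (- (Acf 1 t * decay (r_of_t t)) * (D0 t)\<^sup>2, Acf 1 t * Y0 t)"
        by (simp add: F_def trunc_field_def y_def)
      then show ?thesis
        using has_vector_derivative_Pair[OF Y0'[OF t0(1,2), unfolded has_real_derivative_iff_has_vector_derivative]
            1[unfolded has_real_derivative_iff_has_vector_derivative]]
        by (simp add: y_def[abs_def])
    qed
    have "x b = y b"
    proof (rule ode_unique[OF b(1) _ y_cont, where F = F and L = "2 * exp (- 2 * \<phi>1) + 1"])
      show "continuous_on {a..b} x" by (rule continuous_on_subset[OF x(2)]) auto
      show "x a = y a" by (simp add: x(1) y_def y1_def \<phi>1_def)
    qed (use x(3) y' F_lip less_imp_le in blast)+
    then show ?thesis
      using pos0(1)[of b] a b by (simp add: Y1_def D1_def \<Phi>_def y_def)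
  qed
  define Y2 where "Y2 t = (if t < \<epsilon> then Y0 t else Y1 t)" for t
  define D2 where "D2 t = (if t < \<epsilon> then D0 t else D1 t)" for t
  \<comment> \<open>The agreement on the overlap makes \<open>Y2\<close> and \<open>D2\<close> equal
    to \<open>Y1\<close> and \<open>D1\<close> on a neighbourhood of \<open>\<epsilon>\<close>, so
    the case distinction does not spoil differentiability there.\<close>
  have eq1: "Y2 t = Y1 t" "D2 t = D1 t" if "a \<le> t" for t
    using agree[of t] that by (auto simp: Y2_def D2_def)
  have Y2': "Y_ode Y2 D2 t"
    and D2': "D_ode Y2 D2 t" if t: "0 < t" for t
  proof -
    have *: "Y_ode Y2 D2 t \<and> D_ode Y2 D2 t"
    proof (cases "t < \<epsilon>")
      case True
      have "Y_ode Y2 D0 t"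
        by (rule has_field_derivative_transform_within_open[OF Y0'[OF t True], of "{..<\<epsilon>}"])
           (use True in \<open>auto simp: Y2_def\<close>)
      moreover have "(D2 has_real_derivative - Acf 1 t * Y0 t * D0 t) (at t)"
        by (rule has_field_derivative_transform_within_open[OF D0'[OF t True], of "{..<\<epsilon>}"])
           (use True in \<open>auto simp: D2_def\<close>)
      ultimately show ?thesis using True by (simp add: Y2_def D2_def)
    next
      case False
      then have at: "a < t" using a by simp
      have "0 \<le> Y1 t" by (rule Y1_nonneg) (use at in simp)
      then have D1': "D_ode Y1 D1 t"
        using D1'_raw[OF at] by simp
      have "Y_ode Y2 D1 t"
        by (rule has_field_derivative_transform_within_open[OF Y1'[OF at], of "{a<..}"])
           (use at in \<open>auto simp: eq1\<close>)
      moreover have "(D2 has_real_derivative - Acf 1 t * Y1 t * D1 t) (at t)"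
        by (rule has_field_derivative_transform_within_open[OF D1', of "{a<..}"])
           (use at in \<open>auto simp: eq1\<close>)
      ultimately show ?thesis using at by (simp add: eq1)
    qed
    then show "Y_ode Y2 D2 t"
      and "D_ode Y2 D2 t" by simp_all
  qed
  have nonneg: "0 \<le> Y2 t \<and> 0 \<le> D2 t" if "0 < t" for t
    using pos0[of t] reg1[of t] Y1_nonneg[of t] a that
    by (cases "t < \<epsilon>") (auto simp: Y2_def D2_def)
  have le: "Y2 t \<le> y0 \<and> D2 t \<le> d0" if t: "0 < t" for t
  proof -
    have c0: "continuous (at s within {0..t}) Y2 \<and> continuous (at s within {0..t}) D2" if s: "s \<in> {0..t}" for s
    proof (cases "s = 0")
      case False
      then show ?thesis
        using Y2'[of s] D2'[of s] s by (auto intro: continuous_at_imp_continuous_within DERIV_isCont)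
    next
      case True
      have "at 0 within {0..t} = at 0 within {0..a}"
        by (rule at_within_nhd[of _ "{..< min t a}"]) (use t a in auto)
      moreover have "continuous (at 0 within {0..a}) Y2 \<and> continuous (at 0 within {0..a}) D2"
      proof -
        have "continuous_on {0..a} Y2 \<longleftrightarrow> continuous_on {0..a} Y0"
             "continuous_on {0..a} D2 \<longleftrightarrow> continuous_on {0..a} D0"
          using a by (auto intro!: continuous_on_cong simp: Y2_def D2_def)
        then show ?thesis
          using cont0[of a] a by (auto simp: continuous_on_eq_continuous_within)
      qed
      ultimately show ?thesis using True by simp
    qed
    have "Y2 t \<le> Y2 0"
    proof (rule DERIV_nonpos_imp_decreasing_open[where f = Y2 and a = 0 and b = t])
      fix s assume s: "0 < s" "s < t"
      have "- (Acf 1 s * decay (r_of_t s)) * (D2 s)\<^sup>2 \<le> 0"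
        using Acf_decay_bounds(1)[of s] s by (simp add: mult_nonneg_nonneg)
      then show "\<exists>z. (Y2 has_real_derivative z) (at s) \<and> z \<le> 0" using Y2'[OF s(1)] by blast
    qed (use c0 t in \<open>auto simp: continuous_on_eq_continuous_within\<close>)
    moreover have "D2 t \<le> D2 0"
    proof (rule DERIV_nonpos_imp_decreasing_open[where f = D2 and a = 0 and b = t])
      fix s assume s: "0 < s" "s < t"
      have "- Acf 1 s * Y2 s * D2 s \<le> 0"
        using Acf_decay_bounds(3)[of s] nonneg[OF s(1)] s by (simp add: mult_nonneg_nonneg)
      then show "\<exists>z. (D2 has_real_derivative z) (at s) \<and> z \<le> 0" using D2'[OF s(1)] by blast
    qed (use c0 t in \<open>auto simp: continuous_on_eq_continuous_within\<close>)
    ultimately show ?thesis using eps by (simp add: Y2_def D2_def Y0_def D0_def)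
  qed
  show thesis
  proof (rule that[of Y2 D2 "max y0 d0"])
    show "Y2 t = Y t \<and> D2 t = D t" if "0 < t" "t < \<epsilon>" for t
      using that by (simp add: Y2_def D2_def Y0_def D0_def)
    show "0 \<le> Y2 t \<and> Y2 t \<le> max y0 d0 \<and> 0 \<le> D2 t \<and> D2 t \<le> max y0 d0" if "0 < t" for t
      using nonneg[OF that] le[OF that] by auto
  qed (use Y2' D2' in auto)
qed

text \<open>The integrating factors: \<open>Y = a Q - 1\<close>, where \<open>Q = 1 / A\<^sub>1\<^sup>2\<close>, and \<open>D = b W\<close>.\<close>

definition Qf :: "real \<Rightarrow> real" where
  "Qf r = ((r - 3/4) * (r + 3/4)) / ((r - 9/4) * (r + 9/4))"

definition Wf :: "real \<Rightarrow> real" where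
  "Wf r = (r + 9/4)\<^sup>2 * sqrt r / (r - 9/4)"

text \<open>The derivatives with respect to \<open>r\<close> that the instanton equation prescribes.
  In terms of the metric they are
  \<open>(a - b\<^sup>2) / A\<^sub>2\<^sup>2 - a / B\<^sub>2\<^sup>2\<close> and, for
  \<open>rate_b\<close>, \<open>b ((1 - a) / A\<^sub>1\<^sup>2 - A\<^sub>2 / (A\<^sub>1 B\<^sub>1
  B\<^sub>2))\<close>.\<close>

definition rate_a :: "real \<Rightarrow> real \<Rightarrow> real \<Rightarrow> real" where
  "rate_a r a b = 3 * (a - b\<^sup>2) / ((r - 9/4) * (r + 3/4)) - 3 * a / ((r - 3/4) * (r + 9/4))"

definition rate_b :: "real \<Rightarrow> real \<Rightarrow> real \<Rightarrow> real" where
  "rate_b r a b = b * ((1 - a) * Qf r - 3 * (r + 3/4) / (2 * r * (r + 9/4)))"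

abbreviation a_ode :: "(real \<Rightarrow> real) \<Rightarrow> (real \<Rightarrow> real) \<Rightarrow> real \<Rightarrow> bool" where
  "a_ode a b t \<equiv> (a has_real_derivative Acf 1 t * rate_a (r_of_t t) (a t) (b t)) (at t)"

abbreviation b_ode :: "(real \<Rightarrow> real) \<Rightarrow> (real \<Rightarrow> real) \<Rightarrow> real \<Rightarrow> bool" where
  "b_ode a b t \<equiv> (b has_real_derivative Acf 1 t * rate_b (r_of_t t) (a t) (b t)) (at t)"

text \<open>The origin of \<open>Qf\<close> and \<open>Wf\<close>. The linear coefficient in the
  equation for \<open>a\<close> is the logarithmic derivative of \<open>1 / Qf\<close>. For
  \<open>a = 1 / Qf\<close>, i.e. \<open>Y = 0\<close>, the equation for \<open>b\<close> has the
  coefficient \<open>Qf r - 1 - 3 * (r + 3/4) / (2 * r * (r + 9/4))\<close>, which is the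
  logarithmic derivative of \<open>1 / Wf\<close>.\<close>

lemma partial_fractions:
  assumes "r > (9/4::real)"
  shows "3 / ((r - 9/4) * (r + 3/4)) = 1 / (r - 9/4) - 1 / (r + 3/4)"
    and "3 / ((r - 3/4) * (r + 9/4)) = 1 / (r - 3/4) - 1 / (r + 9/4)"
    and "3 * (r + 3/4) / (2 * r * (r + 9/4)) = 1 / (2 * r) + 1 / (r + 9/4)"
    and "Qf r = 1 + 1 / (r - 9/4) - 1 / (r + 9/4)"
  using assms by (simp_all add: Qf_def divide_simps) (simp_all add: algebra_simps)

lemma Qf_pos: "r > 9/4 \<Longrightarrow> Qf r > 0" and Wf_pos: "r > 9/4 \<Longrightarrow> Wf r > 0"
  by (simp_all add: Qf_def Wf_def)

lemma Qf_deriv: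
  assumes "r > 9/4"
  shows "(Qf has_real_derivative
    - (Qf r * (3 / ((r - 9/4) * (r + 3/4)) - 3 / ((r - 3/4) * (r + 9/4))))) (at r)"
proof -
  have *: "((\<lambda>r. 1 + 1 / (r - 9/4) - 1 / (r + 9/4)) has_real_derivative
      1 / (r + 9/4)\<^sup>2 - 1 / (r - 9/4)\<^sup>2) (at r)"
  proof -
    have inv: "((\<lambda>r. 1 / (r + c)) has_real_derivative - (1 / (r + c)\<^sup>2)) (at r)" if "r + c \<noteq> 0" for c
      using that by (auto intro!: derivative_eq_intros simp: power2_eq_square)
    from DERIV_diff[OF DERIV_add[OF DERIV_const inv[of "- 9/4"]] inv[of "9/4"], of 1] show ?thesis
      using assms by simp
  qed
  have "1 / (r + 9/4)\<^sup>2 - 1 / (r - 9/4)\<^sup>2 =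
      - (Qf r * (3 / ((r - 9/4) * (r + 3/4)) - 3 / ((r - 3/4) * (r + 9/4))))"
    using assms unfolding Qf_def by (simp add: divide_simps power2_eq_square) (simp add: algebra_simps)
  then show ?thesis
    using has_field_derivative_transform_within_open[OF *, of "{9/4<..}" Qf] assms
    by (simp add: partial_fractions(4))
qed

lemma Wf_deriv:
  assumes "r > 9/4"
  shows "(Wf has_real_derivative Wf r * (3 * (r + 3/4) / (2 * r * (r + 9/4)) + 1 - Qf r)) (at r)"
proof -
  have "(Wf has_real_derivative
      ((2 * (r + 9/4) * sqrt r + (r + 9/4)\<^sup>2 * (inverse (sqrt r) / 2)) * (r - 9/4) - (r + 9/4)\<^sup>2 * sqrt r)
        / ((r - 9/4) * (r - 9/4))) (at r)"
    unfolding Wf_def[abs_def] using assms by (auto intro!: derivative_eq_intros)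
  also have "((2 * (r + 9/4) * sqrt r + (r + 9/4)\<^sup>2 * (inverse (sqrt r) / 2)) * (r - 9/4) - (r + 9/4)\<^sup>2 * sqrt r)
        / ((r - 9/4) * (r - 9/4)) = Wf r * (2 / (r + 9/4) + 1 / (2 * r) - 1 / (r - 9/4))"
  proof -
    have inv: "inverse (sqrt r) = sqrt r / r"
      using assms by (simp add: field_simps)
    have "(2 * p * q + P * (q / r / 2)) * m - P * q = q * ((2 * p + P * (1 / (2 * r))) * m - P)"
      for p q P m :: real
      by (simp add: algebra_simps)
    then have num: "(2 * (r + 9/4) * sqrt r + (r + 9/4)\<^sup>2 * (inverse (sqrt r) / 2)) * (r - 9/4) - (r + 9/4)\<^sup>2 * sqrt r
        = sqrt r * ((2 * (r + 9/4) + (r + 9/4)\<^sup>2 * (1 / (2 * r))) * (r - 9/4) - (r + 9/4)\<^sup>2)"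
      unfolding inv .
    have "sqrt r * ((2 * (r + 9/4) + (r + 9/4)\<^sup>2 * (1 / (2 * r))) * (r - 9/4) - (r + 9/4)\<^sup>2)
        / ((r - 9/4) * (r - 9/4)) = Wf r * (2 / (r + 9/4) + 1 / (2 * r) - 1 / (r - 9/4))"
    proof -
      have "((2 * (r + 9/4) + (r + 9/4)\<^sup>2 * (1 / (2 * r))) * (r - 9/4) - (r + 9/4)\<^sup>2) / ((r - 9/4) * (r - 9/4))
          = (r + 9/4)\<^sup>2 / (r - 9/4) * (2 / (r + 9/4) + 1 / (2 * r) - 1 / (r - 9/4))"
        using assms by (simp add: divide_simps power2_eq_square) (simp add: algebra_simps)
      then show ?thesis
        unfolding Wf_def times_divide_eq_right[symmetric]
        by (simp only: times_divide_eq_left times_divide_eq_right mult.assoc mult.left_commute)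
    qed
    then show ?thesis unfolding num .
  qed
  also have "\<dots> = Wf r * (3 * (r + 3/4) / (2 * r * (r + 9/4)) + 1 - Qf r)"
  proof -
    have "2 / (r + 9/4) = 1 / (r + 9/4) + 1 / (r + 9/4)"
      by (simp add: add_divide_distrib[symmetric])
    then have "2 / (r + 9/4) + 1 / (2 * r) - 1 / (r - 9/4) = 3 * (r + 3/4) / (2 * r * (r + 9/4)) + 1 - Qf r"
      using partial_fractions(3,4)[OF assms] by linarith
    then show ?thesis by (rule arg_cong)
  qed
  finally show ?thesis .
qed

lemma Acf_1_Qf: "t > 0 \<Longrightarrow> (Acf 1 t)\<^sup>2 * Qf (r_of_t t) = 1"
  using r_of_t_gt[of t] by (simp add: Acf_1_sq Qf_def)

text \<open>The left-hand side is the equation in the form that the 6-form delivers, with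
  denominators cleared; off the singular orbit the metric coefficients are positive and can be
  divided out.\<close>

lemma rate_a_iff:
  assumes t: "t > 0"
  shows "a' * ((Acf 2 t)\<^sup>2 * (Bcf 2 t)\<^sup>2) = Acf 1 t * ((a - b\<^sup>2) * (Bcf 2 t)\<^sup>2 - a * (Acf 2 t)\<^sup>2)
    \<longleftrightarrow> a' = Acf 1 t * rate_a (r_of_t t) a b"
proof -
  let ?r = "r_of_t t"
  have p: "(Acf 2 t)\<^sup>2 > 0" "(Bcf 2 t)\<^sup>2 > 0" using Acf_pos[OF t, of 2] Bcf_pos[OF t, of 2] by simp_all
  have "rate_a ?r a b = (a - b\<^sup>2) / (Acf 2 t)\<^sup>2 - a / (Bcf 2 t)\<^sup>2"
    using t by (simp add: rate_a_def Acf_2_sq Bcf_2_sq algebra_simps)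
  also have "\<dots> = ((a - b\<^sup>2) * (Bcf 2 t)\<^sup>2 - a * (Acf 2 t)\<^sup>2) / ((Acf 2 t)\<^sup>2 * (Bcf 2 t)\<^sup>2)"
    using p by (simp add: diff_frac_eq)
  finally have "(a - b\<^sup>2) * (Bcf 2 t)\<^sup>2 - a * (Acf 2 t)\<^sup>2 = rate_a ?r a b * ((Acf 2 t)\<^sup>2 * (Bcf 2 t)\<^sup>2)"
    using p by (simp add: eq_divide_eq)
  then show ?thesis
    using p by (simp add: mult.assoc[symmetric])
qed

lemma rate_b_iff:
  assumes t: "t > 0"
  shows "b' * (Acf 1 t * Bcf 1 t * Bcf 2 t) = b * (1 - a) * (Bcf 1 t * Bcf 2 t) - b * Acf 1 t * Acf 2 t
    \<longleftrightarrow> b' = Acf 1 t * rate_b (r_of_t t) a b"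
proof -
  let ?r = "r_of_t t"
  have r: "?r > 9/4" by (rule r_of_t_gt[OF t])
  have p: "Acf 1 t > 0" "Bcf 1 t > 0" "Bcf 2 t > 0"
    using Acf_pos[OF t] Bcf_pos[OF t] by simp_all
  have A2: "Acf 2 t = (?r + 3/4) * Acf 1 t * Bcf 2 t / (?r + 9/4)"
    using Acf_2_eq[of t] t r by (simp add: eq_divide_eq)
  have "Acf 1 t * rate_b ?r a b * (Acf 1 t * Bcf 1 t * Bcf 2 t) =
      b * (1 - a) * ((Acf 1 t)\<^sup>2 * Qf ?r) * (Bcf 1 t * Bcf 2 t)
      - b * Acf 1 t * ((?r + 3/4) * Acf 1 t * Bcf 2 t / (?r + 9/4)) * (3 * Bcf 1 t / (2 * ?r))"
    using r by (simp add: rate_b_def power2_eq_square divide_simps) (simp add: algebra_simps)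
  also have "\<dots> = b * (1 - a) * (Bcf 1 t * Bcf 2 t) - b * Acf 1 t * Acf 2 t"
    unfolding A2[symmetric] Acf_1_Qf[OF t] using r by (simp add: Bcf_1)
  finally have *: "Acf 1 t * rate_b ?r a b * (Acf 1 t * Bcf 1 t * Bcf 2 t) =
      b * (1 - a) * (Bcf 1 t * Bcf 2 t) - b * Acf 1 t * Acf 2 t" .
  show ?thesis
    unfolding *[symmetric] using p by simp
qed

text \<open>The logarithmic derivatives of \<open>Qf\<close> and \<open>Wf\<close> cancel the linear
  terms. The surviving quadratic term carries \<open>3 * Qf r / ((r - 9/4) * (r + 3/4))\<close>, and
  dividing this by \<open>(Wf r)\<^sup>2\<close> gives exactly \<open>decay r\<close>.\<close>

lemma reduced_deriv:
  assumes t: "t > 0"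
    and a: "a_ode a b t"
    and b: "b_ode a b t"
  shows "((\<lambda>t. a t * Qf (r_of_t t) - 1) has_real_derivative
      - (Acf 1 t * decay (r_of_t t)) * (b t * Wf (r_of_t t))\<^sup>2) (at t)" (is ?A)
    and "((\<lambda>t. b t * Wf (r_of_t t)) has_real_derivative
      - Acf 1 t * (a t * Qf (r_of_t t) - 1) * (b t * Wf (r_of_t t))) (at t)" (is ?B)
proof -
  define r where "r = r_of_t t"
  have r: "r > 9/4" using r_of_t_gt[OF t] by (simp add: r_def)
  note Q = DERIV_chain2[OF Qf_deriv[OF r, unfolded r_def] r_of_t_deriv[OF t], folded r_def]
  note W = DERIV_chain2[OF Wf_deriv[OF r, unfolded r_def] r_of_t_deriv[OF t], folded r_def]
  have "rate_a r (a t) (b t) * Qf r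
      - a t * (Qf r * (3 / ((r - 9/4) * (r + 3/4)) - 3 / ((r - 3/4) * (r + 9/4))))
      = - (3 * (b t)\<^sup>2 / ((r - 9/4) * (r + 3/4)) * Qf r)"
    by (simp add: rate_a_def algebra_simps diff_divide_distrib)
  also have "3 * (b t)\<^sup>2 / ((r - 9/4) * (r + 3/4)) * Qf r = decay r * (b t * Wf r)\<^sup>2"
    using r by (simp add: decay_def Qf_def Wf_def divide_simps power_mult_distrib)
      (simp add: power2_eq_square power_eq_if algebra_simps)
  finally have 1: "rate_a r (a t) (b t) * Qf r
      - a t * (Qf r * (3 / ((r - 9/4) * (r + 3/4)) - 3 / ((r - 3/4) * (r + 9/4))))
      = - (decay r * (b t * Wf r)\<^sup>2)" .
  have "((\<lambda>t. a t * Qf (r_of_t t) - 1) has_real_derivative Acf 1 t * (rate_a r (a t) (b t) * Qf r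
      - a t * (Qf r * (3 / ((r - 9/4) * (r + 3/4)) - 3 / ((r - 3/4) * (r + 9/4)))))) (at t)"
    using DERIV_diff[OF DERIV_mult[OF a Q] DERIV_const[of 1]] by (simp add: r_def algebra_simps)
  then show ?A unfolding 1 by (simp add: r_def mult.assoc)
  have 2: "rate_b r (a t) (b t) * Wf r + b t * (Wf r * (3 * (r + 3/4) / (2 * r * (r + 9/4)) + 1 - Qf r))
      = - ((a t * Qf r - 1) * (b t * Wf r))"
    by (simp add: rate_b_def algebra_simps)
  have "((\<lambda>t. b t * Wf (r_of_t t)) has_real_derivative Acf 1 t * (rate_b r (a t) (b t) * Wf r
      + b t * (Wf r * (3 * (r + 3/4) / (2 * r * (r + 9/4)) + 1 - Qf r)))) (at t)"
    using DERIV_mult[OF b W] by (simp add: r_def algebra_simps)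
  then show ?B unfolding 2 by (simp add: r_def mult.assoc)
qed

lemma reduced_deriv_inverse:
  assumes t: "t > 0"
    and Y: "Y_ode Y D t"
    and D: "D_ode Y D t"
  defines "a \<equiv> \<lambda>t. (1 + Y t) / Qf (r_of_t t)" and "b \<equiv> \<lambda>t. D t / Wf (r_of_t t)"
  shows "a_ode a b t" (is ?A)
    and "b_ode a b t" (is ?B)
proof -
  define r where "r = r_of_t t"
  have r: "r > 9/4" using r_of_t_gt[OF t] by (simp add: r_def)
  have QW: "Qf r \<noteq> 0" "Wf r \<noteq> 0" using Qf_pos[OF r] Wf_pos[OF r] by simp_all
  let ?m = "3 * (r + 3/4) / (2 * r * (r + 9/4))"
  note Q = DERIV_chain2[OF Qf_deriv[OF r, unfolded r_def] r_of_t_deriv[OF t], folded r_def]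
  note W = DERIV_chain2[OF Wf_deriv[OF r, unfolded r_def] r_of_t_deriv[OF t], folded r_def]
  have at: "1 + Y t = a t * Qf r" and bt: "D t = b t * Wf r"
    using QW by (simp_all add: a_def b_def r_def)
  define K where "K = 3 * (b t)\<^sup>2 / ((r - 9/4) * (r + 3/4))"
  define l where "l = 3 / ((r - 9/4) * (r + 3/4)) - 3 / ((r - 3/4) * (r + 9/4))"
  have K: "decay r * (b t * Wf r)\<^sup>2 = K * Qf r"
    using r by (simp add: K_def decay_def Qf_def Wf_def divide_simps power_mult_distrib)
      (simp add: power2_eq_square power_eq_if algebra_simps)
  have rate: "rate_a r (a t) (b t) = a t * l - K"
    by (simp add: rate_a_def K_def l_def diff_divide_distrib right_diff_distrib mult.commute)
  have "- (Acf 1 t * decay r) * (D t)\<^sup>2 * Qf r = - (Acf 1 t * (decay r * (b t * Wf r)\<^sup>2) * Qf r)"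
    by (simp add: bt mult.assoc)
  then have 1: "- (Acf 1 t * decay r) * (D t)\<^sup>2 * Qf r - (1 + Y t) * (- (Qf r * l) * Acf 1 t)
      = Acf 1 t * rate_a r (a t) (b t) * (Qf r * Qf r)"
    unfolding at K rate by (simp only: algebra_simps) simp
  have "(a has_real_derivative
      (- (Acf 1 t * decay r) * (D t)\<^sup>2 * Qf r - (1 + Y t) * (- (Qf r * l) * Acf 1 t)) / (Qf r * Qf r)) (at t)"
    unfolding a_def l_def
    by (rule DERIV_cong[OF DERIV_divide[OF DERIV_add[OF DERIV_const[of 1] Y] Q QW(1)[unfolded r_def]]])
       (simp only: r_def add_0_left)
  then show ?A
    unfolding 1 using QW by (simp add: r_def)
  have 2: "- Acf 1 t * Y t * D t * Wf r - D t * (Wf r * (?m + 1 - Qf r) * Acf 1 t)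
      = Acf 1 t * rate_b r (a t) (b t) * (Wf r * Wf r)"
  proof -
    have Yt: "Y t = a t * Qf r - 1" using at by linarith
    show ?thesis unfolding bt Yt by (simp add: rate_b_def algebra_simps)
  qed
  have "(b has_real_derivative
      (- Acf 1 t * Y t * D t * Wf r - D t * (Wf r * (?m + 1 - Qf r) * Acf 1 t)) / (Wf r * Wf r)) (at t)"
    unfolding b_def
    by (rule DERIV_cong[OF DERIV_divide[OF D W QW(2)[unfolded r_def]]]) (simp only: r_def)
  then show ?B
    unfolding 2 using QW by (simp add: r_def)
qed

section \<open>Initial values at the singular orbit\<close>

lemma r_of_t_tendsto: "(r_of_t \<longlongrightarrow> 9/4) (at_right 0)"
proof -
  have "(r_of_t \<longlongrightarrow> r_of_t 0) (at 0 within {0..})"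
    using r_of_t_cont by (auto simp: continuous_on_def)
  then have "(r_of_t \<longlongrightarrow> r_of_t 0) (at_right 0)"
    by (rule tendsto_within_subset) auto
  then show ?thesis by (simp add: r_of_t_0)
qed

lemma bigo_imp_slope:
  fixes f :: "real \<Rightarrow> real"
  assumes "(\<lambda>t. f t - c * t) \<in> O[at_right 0](\<lambda>t. t ^ 3)"
  shows "((\<lambda>t. f t / t) \<longlongrightarrow> c) (at_right 0)"
proof -
  obtain C where C: "\<forall>\<^sub>F t in at_right 0. norm (f t - c * t) \<le> C * norm (t ^ 3)"
    using assms by (auto simp: bigo_def)
  have "\<forall>\<^sub>F t::real in at_right 0. t > 0" by (rule eventually_at_right_less)
  with C have "\<forall>\<^sub>F t in at_right 0. norm (f t / t - c) \<le> C * t\<^sup>2"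
  proof eventually_elim
    case (elim t)
    have "f t / t - c = (f t - c * t) / t" using elim by (simp add: field_simps)
    then have "norm (f t / t - c) = norm (f t - c * t) / t" using elim by simp
    also have "\<dots> \<le> C * norm (t ^ 3) / t"
      using elim by (intro divide_right_mono) auto
    finally show ?case using elim by (simp add: power_eq_if)
  qed
  moreover have "((\<lambda>t. C * t\<^sup>2) \<longlongrightarrow> 0) (at_right 0)"
    by (auto intro!: tendsto_eq_intros)
  ultimately have "((\<lambda>t. f t / t - c) \<longlongrightarrow> 0) (at_right 0)"
    by (rule Lim_null_comparison)
  then show ?thesis by (simp add: LIM_zero_iff)
qed

text \<open>\<open>A\<^sub>1 Q = 1 / A\<^sub>1\<close> and \<open>A\<^sub>2 W\<close> blow up like
  \<open>1 / sqrt (r - 9/4)\<close>, while \<open>f\<close> and \<open>g\<close> vanish like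
  \<open>t\<close>. Splitting off \<open>f t / t\<close> and \<open>t / sqrt (r - 9/4)\<close>,
  whose limits are known, leaves factors that are regular at \<open>r = 9/4\<close>; for
  \<open>g\<close> the value is \<open>2 * (81/4) * (3/2) = 243/4\<close>.\<close>

lemma reduced_limits:
  fixes f g :: "real \<Rightarrow> real"
  assumes f: "((\<lambda>t. f t / t) \<longlongrightarrow> f1) (at_right 0)" and g: "((\<lambda>t. g t / t) \<longlongrightarrow> g1) (at_right 0)"
  shows "((\<lambda>t. (Acf 1 t * f t) * Qf (r_of_t t) - 1) \<longlongrightarrow> 2 * f1 - 1) (at_right 0)" (is ?A)
    and "((\<lambda>t. (Acf 2 t * g t) * Wf (r_of_t t)) \<longlongrightarrow> 243/4 * g1) (at_right 0)" (is ?B)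
proof -
  have ev: "\<forall>\<^sub>F t::real in at_right 0. t > 0" by (rule eventually_at_right_less)
  let ?u = "\<lambda>t. sqrt (r_of_t t - 9/4)"
  have sq: "sqrt (9/4) = (3/2 :: real)"
    by (rule real_sqrt_unique) (auto simp: power2_eq_square)
  have "((\<lambda>t. (f t / t) * (t / ?u t) * sqrt ((r_of_t t - 3/4) * (r_of_t t + 3/4) / (r_of_t t + 9/4)) - 1) \<longlongrightarrow>
      f1 * 2 * sqrt ((9/4 - 3/4) * (9/4 + 3/4) / (9/4 + 9/4)) - 1) (at_right 0)"
    by (intro tendsto_intros f sqrt_r_of_t_asymp r_of_t_tendsto) simp
  also have "f1 * 2 * sqrt ((9/4 - 3/4) * (9/4 + 3/4) / (9/4 + 9/4)) - 1 = 2 * f1 - 1"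
    by simp
  finally show ?A
  proof (rule Lim_transform_eventually)
    show "\<forall>\<^sub>F t in at_right 0. (f t / t) * (t / ?u t) * sqrt ((r_of_t t - 3/4) * (r_of_t t + 3/4) / (r_of_t t + 9/4)) - 1
        = (Acf 1 t * f t) * Qf (r_of_t t) - 1"
      using ev
    proof eventually_elim
      case (elim t)
      define r where "r = r_of_t t"
      have r: "r > 9/4" using r_of_t_gt[OF elim] by (simp add: r_def)
      have A: "Acf 1 t = ?u t * sqrt (r + 9/4) / sqrt ((r - 3/4) * (r + 3/4))"
        by (simp add: Acf_def r_def Let_def real_sqrt_mult)
      have "Acf 1 t * (Acf 1 t * Qf r) = 1"
        using Acf_1_Qf[OF elim] by (simp add: r_def power2_eq_square mult.assoc)
      then have "Acf 1 t * Qf r = inverse (Acf 1 t)"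
        by (rule inverse_unique[symmetric])
      also have "\<dots> = sqrt ((r - 3/4) * (r + 3/4) / (r + 9/4)) / ?u t"
        unfolding A by (simp add: real_sqrt_divide)
      finally have AQ: "Acf 1 t * Qf r = sqrt ((r - 3/4) * (r + 3/4) / (r + 9/4)) / ?u t" .
      have "Acf 1 t * f t * Qf r = f t * (Acf 1 t * Qf r)" by simp
      then show ?case
        unfolding AQ using elim by (simp add: r_def)
    qed
  qed
  have "((\<lambda>t. (g t / t) * (t / ?u t) * (sqrt ((r_of_t t + 3/4) / 3) * ((r_of_t t + 9/4) * (r_of_t t + 9/4)) * sqrt (r_of_t t))) \<longlongrightarrow>
      g1 * 2 * (sqrt ((9/4 + 3/4) / 3) * ((9/4 + 9/4) * (9/4 + 9/4)) * sqrt (9/4))) (at_right 0)"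
    by (intro tendsto_intros g sqrt_r_of_t_asymp r_of_t_tendsto) simp
  also have "g1 * 2 * (sqrt ((9/4 + 3/4) / 3) * ((9/4 + 9/4) * (9/4 + 9/4)) * sqrt (9/4)) = 243/4 * g1"
    unfolding sq by simp
  finally show ?B
  proof (rule Lim_transform_eventually)
    show "\<forall>\<^sub>F t in at_right 0. (g t / t) * (t / ?u t) * (sqrt ((r_of_t t + 3/4) / 3) * ((r_of_t t + 9/4) * (r_of_t t + 9/4)) * sqrt (r_of_t t))
        = (Acf 2 t * g t) * Wf (r_of_t t)"
      using ev
    proof eventually_elim
      case (elim t)
      define r where "r = r_of_t t"
      have r: "r > 9/4" using r_of_t_gt[OF elim] by (simp add: r_def)
      define u where "u = ?u t"
      have u: "u \<noteq> 0" "r - 9/4 = u * u" using r by (simp_all add: u_def r_def)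
      have "Acf 2 t = u * sqrt ((r + 3/4) / 3)"
        unfolding u_def real_sqrt_mult[symmetric] by (simp add: Acf_def r_def Let_def)
      moreover have "Wf r = ((r + 9/4) * (r + 9/4)) * sqrt r / (u * u)"
        unfolding Wf_def power2_eq_square u(2) ..
      ultimately have "Acf 2 t * Wf r = sqrt ((r + 3/4) / 3) * ((r + 9/4) * (r + 9/4)) * sqrt r / u"
        using u(1) by simp
      moreover have "Acf 2 t * g t * Wf r = g t * (Acf 2 t * Wf r)" by simp
      ultimately show ?case
        using elim by (simp add: r_def u_def)
    qed
  qed
qed

subsection \<open>Quaternions and the invariant coframe\<close>

lemma qmul_eq: "qmul a b = (fst a * fst b - snd a \<bullet> snd b,
    fst a *\<^sub>R snd b + fst b *\<^sub>R snd a + cross3 (snd a) (snd b))"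
  by (cases a; cases b) simp

lemma qcnj_eq: "qcnj a = (fst a, - snd a)"
  by (cases a) simp

lemma bounded_bilinear_qmul: "bounded_bilinear qmul"
  unfolding bilinear_conv_bounded_bilinear[symmetric] bilinear_def
  by (auto intro!: linearI simp: qmul_eq algebra_simps inner_add_left inner_add_right
      cross3_simps scaleR_add_right)

lemma bounded_linear_qcnj: "bounded_linear qcnj"
  unfolding linear_conv_bounded_linear[symmetric]
  by (rule linearI) (auto simp: qcnj_eq)

interpretation qmul: bounded_bilinear qmul by (rule bounded_bilinear_qmul)

lemmas qcnj_scaleR = linear_scale[OF bounded_linear.linear[OF bounded_linear_qcnj]]
lemmas qcnj_diff = linear_diff[OF bounded_linear.linear[OF bounded_linear_qcnj]]

lemma qmul_assoc: "qmul (qmul a b) c = qmul a (qmul b c)"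
  by (cases a; cases b; cases c)
     (simp add: inner_vec_def sum_3 cross3_def vec_eq_iff forall_3 algebra_simps)

lemma qcnj_qmul: "qcnj (qmul a b) = qmul (qcnj b) (qcnj a)"
  by (cases a; cases b) (simp add: inner_commute cross3_def vec_eq_iff forall_3 algebra_simps)

lemma qcnj_qcnj [simp]: "qcnj (qcnj a) = a"
  by (simp add: qcnj_eq)

lemma qmul_1_right [simp]: "qmul a (1, 0) = a" and qmul_1_left [simp]: "qmul (1, 0) a = a"
  by (cases a, simp)+

lemma qmul_real_right: "qmul a (c, 0) = c *\<^sub>R a" and qmul_real_left: "qmul (c, 0) a = c *\<^sub>R a"
  by (cases a, simp)+

lemma qmul_qcnj_self: "qmul (qcnj a) a = ((norm a)\<^sup>2, 0)" and qmul_self_qcnj: "qmul a (qcnj a) = ((norm a)\<^sup>2, 0)"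
  by (cases a, simp add: power2_norm_eq_inner power2_eq_square[of "fst a"] inner_commute cross_minus_right norm_Pair; simp add: power2_eq_square)+

lemma qmul_qcnj_cancel: "norm a = 1 \<Longrightarrow> qmul (qcnj a) (qmul a b) = b"
  "norm a = 1 \<Longrightarrow> qmul a (qmul (qcnj a) b) = b"
  by (simp_all add: qmul_assoc[symmetric] qmul_qcnj_self qmul_self_qcnj)

lemma inner_quat: "a \<bullet> b = fst (qmul (qcnj a) b)" and inner_quat': "a \<bullet> b = fst (qmul a (qcnj b))"
  for a b :: quat
  by (cases a; cases b; simp)+

lemma norm_qcnj [simp]: "norm (qcnj a) = norm a"
  by (cases a) (simp add: norm_Pair)

lemma norm_qmul: "norm (qmul a b) = norm a * norm b"
proof -
  have "((norm (qmul a b))\<^sup>2, 0::real^3) = qmul (qcnj b) (qmul (qmul (qcnj a) a) b)"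
    unfolding qmul_qcnj_self[symmetric] by (simp add: qcnj_qmul qmul_assoc)
  also have "\<dots> = ((norm a)\<^sup>2 * (norm b)\<^sup>2, 0)"
    by (simp add: qmul_qcnj_self qmul_real_left qmul.scaleR_right)
  finally have "(norm (qmul a b))\<^sup>2 = (norm a * norm b)\<^sup>2"
    by (simp add: power_mult_distrib)
  then show ?thesis
    by (rule power2_eq_imp_eq) simp_all
qed

text \<open>\<open>mu\<close> and \<open>nu\<close> are \<open>|p|\<^sup>2 \<eta>\<^sup>+\<close> and \<open>|p|\<^sup>2 \<eta>\<^sup>-\<close> at \<open>(p, q)\<close>, extended to the ambient space by the
  retraction.\<close>

definition mu :: "amb \<Rightarrow> amb \<Rightarrow> real^3" where
  "mu x v = snd (qmul (qcnj (fst x)) (fst v)) + (1/2 * inverse (snd x \<bullet> snd x)) *\<^sub>R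
     snd (qmul (qmul (qcnj (fst x)) (qmul (snd x) (qcnj (snd v)))) (fst x))"

definition nu :: "amb \<Rightarrow> amb \<Rightarrow> real^3" where
  "nu x v = (- 1/2 * inverse (snd x \<bullet> snd x)) *\<^sub>R
     snd (qmul (qmul (qcnj (fst x)) (qmul (snd x) (qcnj (snd v)))) (fst x))"

lemma sgn_has_derivative:
  fixes x :: "'a::real_inner"
  assumes "x \<noteq> 0"
  shows "((\<lambda>x. x /\<^sub>R norm x) has_derivative
    (\<lambda>v. v /\<^sub>R norm x - ((x \<bullet> v) / norm x ^ 3) *\<^sub>R x)) (at x)"
proof -
  have n: "(norm has_derivative (\<lambda>v. (x \<bullet> v) / norm x)) (at x)"
    using has_derivative_norm[OF assms] by (simp add: sgn_div_norm divide_inverse mult.commute inner_commute)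
  have "((\<lambda>x. x /\<^sub>R norm x) has_derivative
     (\<lambda>v. inverse (norm x) *\<^sub>R v + (- (inverse (norm x) * ((x \<bullet> v) / norm x) * inverse (norm x))) *\<^sub>R x)) (at x)"
    by (rule has_derivative_scaleR Deriv.has_derivative_inverse n has_derivative_ident | simp add: assms)+
  then show ?thesis
    using assms by (simp add: divide_inverse power3_eq_cube mult_ac)
qed

lemma retr_has_derivative:
  assumes "snd x \<noteq> 0"
  shows "(retr has_derivative
    (\<lambda>v. (fst v, snd v /\<^sub>R norm (snd x) - ((snd x \<bullet> snd v) / norm (snd x) ^ 3) *\<^sub>R snd x))) (at x)"
proof -
  have "((\<lambda>x. snd x /\<^sub>R norm (snd x)) has_derivative
      (\<lambda>v. snd v /\<^sub>R norm (snd x) - ((snd x \<bullet> snd v) / norm (snd x) ^ 3) *\<^sub>R snd x)) (at x)"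
    by (rule has_derivative_compose[OF has_derivative_snd[OF has_derivative_ident] sgn_has_derivative[OF assms]])
  then show ?thesis
    unfolding retr_def[abs_def] by (intro has_derivative_Pair has_derivative_fst has_derivative_ident)
qed

lemma retr_deriv:
  assumes "snd x \<noteq> 0"
  shows "frechet_derivative retr (at x) v =
    (fst v, snd v /\<^sub>R norm (snd x) - ((snd x \<bullet> snd v) / norm (snd x) ^ 3) *\<^sub>R snd x)"
  unfolding frechet_derivative_at[OF retr_has_derivative[OF assms], symmetric] ..

lemma norm_fst_has_derivative:
  fixes x :: amb
  assumes "fst x \<noteq> 0"
  shows "((\<lambda>x. norm (fst x)) has_derivative (\<lambda>v. (fst x \<bullet> fst v) / norm (fst x))) (at x)"
proof -
  have "(norm has_derivative (\<lambda>v. (fst x \<bullet> v) / norm (fst x))) (at (fst x))"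
    using has_derivative_norm[OF assms] by (simp add: sgn_div_norm divide_inverse mult.commute inner_commute)
  then show ?thesis
    by (rule has_derivative_compose[OF has_derivative_fst[OF has_derivative_ident]])
qed

lemma orbit_chart_inv_has_derivative:
  assumes "fst x \<noteq> 0"
  defines "\<xi> \<equiv> \<lambda>v. v /\<^sub>R norm (fst x) - ((fst x \<bullet> v) / norm (fst x) ^ 3) *\<^sub>R fst x"
  shows "(orbit_chart_inv has_derivative (\<lambda>v. ((fst x \<bullet> fst v) / norm (fst x), \<xi> (fst v),
    qmul (qcnj (snd x)) (\<xi> (fst v)) + qmul (qcnj (snd v)) (fst x /\<^sub>R norm (fst x))))) (at x)"
proof -
  have s: "((\<lambda>x::amb. fst x /\<^sub>R norm (fst x)) has_derivative (\<lambda>v. \<xi> (fst v))) (at x)"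
    unfolding \<xi>_def
    by (rule has_derivative_compose[OF has_derivative_fst[OF has_derivative_ident] sgn_has_derivative[OF assms(1)]])
  have "((\<lambda>x::amb. qmul (qcnj (snd x)) (fst x /\<^sub>R norm (fst x))) has_derivative
      (\<lambda>v. qmul (qcnj (snd x)) (\<xi> (fst v)) + qmul (qcnj (snd v)) (fst x /\<^sub>R norm (fst x)))) (at x)"
    by (rule qmul.FDERIV[OF bounded_linear.has_derivative[OF bounded_linear_qcnj has_derivative_snd[OF has_derivative_ident]] s])
  then show ?thesis
    unfolding orbit_chart_inv_def[abs_def] by (intro has_derivative_Pair norm_fst_has_derivative[OF assms(1)] s)
qed

text \<open>The radial correction in the derivative of \<open>p / |p|\<close> adds only a real
  quaternion to \<open>qmul (qcnj a1) \<xi>\<close> and disappears in the imaginary part. What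
  remains is polynomial in \<open>p\<close> up to the factor \<open>1 / |p|\<^sup>2\<close>.\<close>

lemma eta_mu_nu:
  assumes p: "fst x \<noteq> 0" and q: "norm (snd x) = 1"
  shows "dt x v = (fst x \<bullet> fst v) / norm (fst x)"
    and "etap i x v = mu x v $ i / (norm (fst x))\<^sup>2"
    and "etam i x v = nu x v $ i / (norm (fst x))\<^sup>2"
proof -
  define t where "t = norm (fst x)"
  have t: "t > 0" using p by (simp add: t_def)
  note D = frechet_derivative_at[OF orbit_chart_inv_has_derivative[OF p], symmetric]
  show "dt x v = (fst x \<bullet> fst v) / norm (fst x)"
    by (simp add: dt_def D)
  define \<xi> where "\<xi> = fst v /\<^sub>R t - ((fst x \<bullet> fst v) / t ^ 3) *\<^sub>R fst x"
  define a1 where "a1 = fst x /\<^sub>R t"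
  define S where "S = snd (qmul (qcnj (fst x)) (fst v)) /\<^sub>R t\<^sup>2"
  define R where "R = snd (qmul (qmul (qcnj (fst x)) (qmul (snd x) (qcnj (snd v)))) (fst x)) /\<^sub>R t\<^sup>2"
  have S: "snd (qmul (qcnj a1) \<xi>) = S"
    using t by (simp add: a1_def \<xi>_def S_def qmul.diff_right qmul.scaleR_left qmul.scaleR_right
        qcnj_scaleR qmul_qcnj_self power2_eq_square)
  have a2: "qcnj (qmul (qcnj (snd x)) a1) = qmul (qcnj a1) (snd x)"
    by (simp add: qcnj_qmul)
  have R: "qmul (qmul (qcnj a1) (snd x)) (qmul (qcnj (snd v)) a1)
      = qmul (qmul (qcnj (fst x)) (qmul (snd x) (qcnj (snd v)))) (fst x) /\<^sub>R t\<^sup>2"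
    by (simp add: a1_def qmul.scaleR_left qmul.scaleR_right qcnj_scaleR qmul_assoc power2_eq_square)
  have S': "qmul (qmul (qcnj a1) (snd x)) (qmul (qcnj (snd x)) \<xi>) = qmul (qcnj a1) \<xi>"
    using q by (simp add: qmul_assoc qmul_qcnj_cancel)
  have oc: "orbit_chart_inv x = (t, a1, qmul (qcnj (snd x)) a1)"
    by (simp add: orbit_chart_inv_def t_def a1_def)
  have eta: "eta s i (orbit_chart_inv x) (frechet_derivative orbit_chart_inv (at x) v)
      = (S $ i + s * (S $ i + R $ i)) / 2" for s
    unfolding oc D by (simp add: t_def[symmetric] \<xi>_def[symmetric] a1_def[symmetric] a2 qmul.add_right S' R S R_def)
  have q': "snd x \<bullet> snd x = 1" using q by (simp add: dot_square_norm)
  have "mu x v = t\<^sup>2 *\<^sub>R (S + (1/2) *\<^sub>R R)" "nu x v = t\<^sup>2 *\<^sub>R ((- 1/2) *\<^sub>R R)"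
    using t unfolding mu_def nu_def q' S_def R_def by (simp_all add: scaleR_right_distrib)
  then have "mu x v $ i = t\<^sup>2 * (S $ i + R $ i / 2)" "nu x v $ i = t\<^sup>2 * (- R $ i / 2)"
    by simp_all
  then have "mu x v $ i / t\<^sup>2 = S $ i + R $ i / 2" "nu x v $ i / t\<^sup>2 = - R $ i / 2"
    using t by simp_all
  then show "etap i x v = mu x v $ i / (norm (fst x))\<^sup>2" "etam i x v = nu x v $ i / (norm (fst x))\<^sup>2"
    unfolding etap_def etam_def eta t_def[symmetric] by simp_all
qed

section \<open>The retraction and the group actions\<close>

lemma retr_in_M: "snd y \<noteq> 0 \<Longrightarrow> retr y \<in> M"
  by (auto simp: retr_def M_def)

lemma fst_retr [simp]: "fst (retr y) = fst y"
  by (simp add: retr_def)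

lemma retr_deriv_tangent:
  assumes "snd y \<noteq> 0"
  shows "frechet_derivative retr (at y) v \<in> tangent (retr y)"
proof -
  define n where "n = norm (snd y)"
  have n: "n \<noteq> 0" "snd y \<bullet> snd y = n * n"
    using assms by (simp_all add: n_def dot_square_norm power2_eq_square)
  have "(snd y /\<^sub>R n) \<bullet> (snd v /\<^sub>R n - ((snd y \<bullet> snd v) / n ^ 3) *\<^sub>R snd y) = 0"
    using n(1) by (simp add: inner_diff_right n(2) power3_eq_cube field_simps)
  then show ?thesis
    unfolding tangent_def retr_deriv[OF assms] by (simp add: retr_def n_def)
qed

text \<open>The normal component that the retraction removes is a multiple of \<open>q\<close>. It
  enters the product with \<open>qcnj\<close> as a real quaternion \<open>(c, 0)\<close>, which
  stays real when multiplied by \<open>qcnj p\<close> and \<open>p\<close> from the two sides. So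
  pulled-back forms can be differentiated through \<open>mu\<close> itself.\<close>

lemma mu_retr:
  assumes "snd y \<noteq> 0"
  shows "mu (retr y) (frechet_derivative retr (at y) v) = mu y v"
proof -
  define n where "n = norm (snd y)"
  have n: "n > 0" using assms by (simp add: n_def)
  have i1: "(snd y /\<^sub>R n) \<bullet> (snd y /\<^sub>R n) = 1" "snd y \<bullet> snd y = n\<^sup>2"
    using n by (simp_all add: n_def dot_square_norm power2_eq_square)
  define p where "p = fst y"
  define E where "E = qmul (snd y) (qcnj (snd v))"
  define c where "c = (snd y \<bullet> snd v) / n\<^sup>2"
  have E: "qmul (snd y /\<^sub>R n) (qcnj (snd v /\<^sub>R n - ((snd y \<bullet> snd v) / n ^ 3) *\<^sub>R snd y))
      = E /\<^sub>R n\<^sup>2 - (c, 0)"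
    using n by (simp add: qcnj_diff qcnj_scaleR qmul.diff_right qmul.scaleR_left qmul.scaleR_right
        qmul_self_qcnj n_def[symmetric] power2_eq_square power3_eq_cube E_def c_def)
  have "snd (qmul (qmul (qcnj p) (c, 0)) p) = 0"
    by (simp add: qmul_real_right qmul.scaleR_left qmul_qcnj_self)
  then have K: "snd (qmul (qmul (qcnj p) (E /\<^sub>R n\<^sup>2 - (c, 0))) p) = snd (qmul (qmul (qcnj p) E) p) /\<^sub>R n\<^sup>2"
    by (simp add: qmul.diff_left qmul.diff_right qmul.scaleR_left qmul.scaleR_right)
  have "mu (retr y) (frechet_derivative retr (at y) v) =
      snd (qmul (qcnj p) (fst v)) + (1/2 * inverse 1) *\<^sub>R snd (qmul (qmul (qcnj p) (E /\<^sub>R n\<^sup>2 - (c, 0))) p)"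
    unfolding mu_def retr_deriv[OF assms] retr_def fst_conv snd_conv n_def[symmetric] i1(1) E p_def[symmetric] ..
  also have "\<dots> = mu y v"
    unfolding K mu_def i1(2) p_def[symmetric] E_def[symmetric] by simp
  finally show ?thesis .
qed

lemma su2_action_eq: "su2_action b1 b2 x = (qmul b1 (fst x), qmul (qmul b1 (snd x)) (qcnj b2))"
  by (cases x) simp

lemma u1_action_eq: "u1_action u x = (qmul (fst x) u, snd x)"
  by (cases x) simp

lemma inner_qmul_left: "norm b = 1 \<Longrightarrow> qmul b u \<bullet> qmul b v = u \<bullet> v"
  by (simp add: inner_quat qcnj_qmul qmul_assoc qmul_qcnj_cancel)

lemma inner_qmul_right: "norm b = 1 \<Longrightarrow> qmul u (qcnj b) \<bullet> qmul v (qcnj b) = u \<bullet> v"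
  by (simp add: inner_quat' qcnj_qmul qmul_assoc qmul_qcnj_cancel)

context
  fixes b1 b2 :: quat
  assumes b: "norm b1 = 1" "norm b2 = 1"
begin

lemma su2_action_inner:
  "fst (su2_action b1 b2 x) \<bullet> fst (su2_action b1 b2 v) = fst x \<bullet> fst v"
  "snd (su2_action b1 b2 x) \<bullet> snd (su2_action b1 b2 v) = snd x \<bullet> snd v"
  using b by (simp_all add: su2_action_eq inner_qmul_left inner_qmul_right)

lemma su2_action_norm:
  "norm (fst (su2_action b1 b2 x)) = norm (fst x)" "norm (snd (su2_action b1 b2 x)) = norm (snd x)"
  using b by (simp_all add: su2_action_eq norm_qmul)

lemma su2_action_M: "x \<in> M \<Longrightarrow> su2_action b1 b2 x \<in> M"
  using su2_action_norm(2)[of x] by (cases x) (auto simp: M_def)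

lemma su2_action_tangent: "v \<in> tangent x \<Longrightarrow> su2_action b1 b2 v \<in> tangent (su2_action b1 b2 x)"
  using su2_action_inner(2)[of x v] by (auto simp: tangent_def case_prod_beta)

lemma su2_action_middle:
  "qmul (qmul (qcnj (fst (su2_action b1 b2 x))) (qmul (snd (su2_action b1 b2 x)) (qcnj (snd (su2_action b1 b2 v)))))
     (fst (su2_action b1 b2 x)) = qmul (qmul (qcnj (fst x)) (qmul (snd x) (qcnj (snd v)))) (fst x)"
  using b by (simp add: su2_action_eq qcnj_qmul qmul_assoc qmul_qcnj_cancel)

lemma su2_action_mu: "mu (su2_action b1 b2 x) (su2_action b1 b2 v) = mu x v"
  unfolding mu_def su2_action_middle su2_action_inner
  using b by (simp add: su2_action_eq qcnj_qmul qmul_assoc qmul_qcnj_cancel)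

lemma su2_action_nu: "nu (su2_action b1 b2 x) (su2_action b1 b2 v) = nu x v"
  unfolding nu_def su2_action_middle su2_action_inner ..

end

text \<open>\<open>b1\<close> makes \<open>p\<close> real and \<open>b2 = b1 q\<close> then takes
  \<open>q\<close> to 1. So \<open>SU(2)\<^sup>2\<close> is transitive on each level of
  \<open>|p|\<close>, and invariant identities need checking at one point only.\<close>

lemma su2_action_to_base:
  assumes "x \<in> M" "fst x \<noteq> 0"
  obtains b1 b2 where "norm b1 = 1" "norm b2 = 1" "su2_action b1 b2 x = ((norm (fst x), 0), (1, 0))"
proof -
  define b1 where "b1 = qcnj (fst x) /\<^sub>R norm (fst x)"
  have q: "norm (snd x) = 1" using assms(1) by (cases x) (auto simp: M_def)
  have b1: "norm b1 = 1" using assms(2) by (simp add: b1_def)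
  have "qmul b1 (fst x) = (norm (fst x), 0)"
    using assms(2) by (simp add: b1_def qmul.scaleR_left qmul_qcnj_self power2_eq_square)
  moreover have "qmul (qmul b1 (snd x)) (qcnj (qmul b1 (snd x))) = (1, 0)"
    using q b1 by (simp add: qmul_self_qcnj norm_qmul)
  ultimately show thesis
    using that[of b1 "qmul b1 (snd x)"] q b1 by (simp add: su2_action_eq norm_qmul)
qed

section \<open>The invariant connections\<close>

definition diag_abb :: "real \<Rightarrow> real \<Rightarrow> real^3 \<Rightarrow> real^3" where
  "diag_abb a b u = (a * u $ 1) *\<^sub>R T 1 + b *\<^sub>R (u $ 2 *\<^sub>R T 2 + u $ 3 *\<^sub>R T 3)"

lemma diag_abb_nth [simp]: "diag_abb a b u $ 1 = a * u $ 1" "diag_abb a b u $ 2 = b * u $ 2" "diag_abb a b u $ 3 = b * u $ 3"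
  by (simp_all add: diag_abb_def T_def axis_def)

lemma diag_abb_linear: "linear (diag_abb a b)"
  by (rule linearI) (simp_all add: vec_eq_iff forall_3 algebra_simps)

lemma diag_abb_split: "diag_abb a b u = a *\<^sub>R diag_abb 1 0 u + b *\<^sub>R diag_abb 0 1 u"
  by (simp add: vec_eq_iff forall_3)

lemma bounded_linear_diag_abb: "bounded_linear (diag_abb a b)"
  using diag_abb_linear by (simp add: linear_conv_bounded_linear)

definition abform :: "(real \<Rightarrow> real) \<Rightarrow> (real \<Rightarrow> real) \<Rightarrow> conn" where
  "abform a b x v = (a (norm (fst x)) * etap 1 x v) *\<^sub>R T 1
     + b (norm (fst x)) *\<^sub>R (etap 2 x v *\<^sub>R T 2 + etap 3 x v *\<^sub>R T 3)"

lemma ansatz_abform: "ansatz f g = abform (\<lambda>t. Acf 1 t * f t) (\<lambda>t. Acf 2 t * g t)"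
  by (intro ext) (simp add: ansatz_def abform_def Let_def)

lemma abform_mu:
  assumes "fst x \<noteq> 0" "norm (snd x) = 1"
  shows "abform a b x v = diag_abb (a (norm (fst x)) / (norm (fst x))\<^sup>2) (b (norm (fst x)) / (norm (fst x))\<^sup>2) (mu x v)"
  by (simp add: abform_def diag_abb_def eta_mu_nu[OF assms] scaleR_right_distrib)

lemma abform_su2:
  assumes "fst x \<noteq> 0" "norm (snd x) = 1" "norm b1 = 1" "norm b2 = 1"
  shows "abform a b (su2_action b1 b2 x) (su2_action b1 b2 v) = abform a b x v"
proof -
  have "fst (su2_action b1 b2 x) \<noteq> 0"
    using su2_action_norm(1)[OF assms(3,4), of x] assms(1) by (metis norm_eq_zero)
  then show ?thesis
    using assms by (simp add: abform_mu su2_action_norm su2_action_mu)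
qed

lemma norm_expT1: "norm (expT1 \<theta>) = 1"
  by (simp add: expT1_def norm_Pair T_def)

lemma snd_conj: "snd (qmul (qmul (qcnj u) X) u) = Ad (qcnj u) (snd X)"
proof -
  have "snd (qmul (qmul (qcnj u) (fst X, 0)) u) = 0"
    by (simp add: qmul_real_right qmul.scaleR_left qmul_qcnj_self)
  moreover have "snd (qmul (qmul (qcnj u) (Y + Z)) u) =
      snd (qmul (qmul (qcnj u) Y) u) + snd (qmul (qmul (qcnj u) Z) u)" for Y Z
    by (simp add: qmul.add_left qmul.add_right)
  from this[of "(fst X, 0)" "(0, snd X)"]
  have "snd (qmul (qmul (qcnj u) X) u) =
      snd (qmul (qmul (qcnj u) (fst X, 0)) u) + snd (qmul (qmul (qcnj u) (0, snd X)) u)" by simp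
  ultimately show ?thesis by (simp add: Ad_def)
qed

lemma mu_u1:
  "mu (u1_action u x) (u1_action u v) = Ad (qcnj u) (mu x v)"
proof -
  have lin: "Ad (qcnj u) (X + c *\<^sub>R Y) = Ad (qcnj u) X + c *\<^sub>R Ad (qcnj u) Y" for X Y c
  proof -
    have "(0, X + c *\<^sub>R Y) = (0, X) + c *\<^sub>R (0::real, Y)" by simp
    then show ?thesis
      unfolding Ad_def by (simp only: qmul.add_left qmul.add_right qmul.scaleR_left qmul.scaleR_right snd_add snd_scaleR)
  qed
  have "qmul (qcnj (qmul (fst x) u)) (qmul (fst v) u) = qmul (qmul (qcnj u) (qmul (qcnj (fst x)) (fst v))) u"
    by (simp add: qcnj_qmul qmul_assoc)
  moreover have "qmul (qmul (qcnj (qmul (fst x) u)) X) (qmul (fst x) u)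
      = qmul (qmul (qcnj u) (qmul (qmul (qcnj (fst x)) X) (fst x))) u" for X
    by (simp add: qcnj_qmul qmul_assoc)
  ultimately show ?thesis
    unfolding mu_def u1_action_eq fst_conv snd_conv lin by (simp only: snd_conj)
qed

text \<open>The subgroup fixes \<open>T 1\<close> and rotates the plane of \<open>T 2\<close> and
  \<open>T 3\<close>, on which \<open>diag_abb a b\<close> is a multiple of the identity.\<close>

lemma Ad_expT1_diag_abb: "Ad (qcnj (expT1 \<theta>)) (diag_abb a b u) = diag_abb a b (Ad (qcnj (expT1 \<theta>)) u)"
  by (simp add: Ad_def expT1_def qmul_eq vec_eq_iff forall_3 cross3_def T_def axis_def inner_vec_def sum_3
      algebra_simps)

lemma abform_u1:
  assumes "fst x \<noteq> 0" "norm (snd x) = 1"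
  shows "abform a b (u1_action (expT1 \<theta>) x) (u1_action (expT1 \<theta>) v) = Ad (qcnj (expT1 \<theta>)) (abform a b x v)"
proof -
  have n: "norm (fst (u1_action (expT1 \<theta>) x)) = norm (fst x)"
    by (simp add: u1_action_eq norm_qmul norm_expT1)
  then have "fst (u1_action (expT1 \<theta>) x) \<noteq> 0" using assms(1) by (metis norm_eq_zero)
  moreover have "norm (snd (u1_action (expT1 \<theta>) x)) = 1" using assms(2) by (simp add: u1_action_eq)
  ultimately show ?thesis
    using assms by (simp add: abform_mu n mu_u1 Ad_expT1_diag_abb)
qed

subsection \<open>Curvature\<close>

text \<open>\<open>w\<close> is the constant vector field on which the form is evaluated,
  \<open>v\<close> the direction of differentiation. The last summand stems from the normalising
  factor \<open>inverse (snd x \<bullet> snd x)\<close>.\<close>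

definition mu_deriv :: "amb \<Rightarrow> amb \<Rightarrow> amb \<Rightarrow> real^3" where
  "mu_deriv x w v = (let E = qmul (snd x) (qcnj (snd w)); i = inverse (snd x \<bullet> snd x) in
     snd (qmul (qcnj (fst v)) (fst w))
     + ((1/2 * i) *\<^sub>R snd (qmul (qmul (qcnj (fst x)) E) (fst v)
          + qmul (qmul (qcnj (fst x)) (qmul (snd v) (qcnj (snd w))) + qmul (qcnj (fst v)) E) (fst x))
        + (- (i * (snd x \<bullet> snd v) * i)) *\<^sub>R snd (qmul (qmul (qcnj (fst x)) E) (fst x))))"

lemma mu_has_derivative:
  assumes "snd x \<noteq> 0"
  shows "((\<lambda>x. mu x w) has_derivative mu_deriv x w) (at x)"
proof -
  have q: "snd x \<bullet> snd x \<noteq> 0" using assms by simp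
  have f: "(fst has_derivative fst) (at x)" and s: "(snd has_derivative snd) (at x)" for x :: amb
    by (intro bounded_linear_imp_has_derivative bounded_linear_fst bounded_linear_snd)+
  have cf: "((\<lambda>x::amb. qcnj (fst x)) has_derivative (\<lambda>v. qcnj (fst v))) (at x)"
    by (rule bounded_linear.has_derivative[OF bounded_linear_qcnj f])
  have E: "((\<lambda>x::amb. qmul (snd x) (qcnj (snd w))) has_derivative (\<lambda>v. qmul (snd v) (qcnj (snd w)))) (at x)"
    by (rule bounded_linear.has_derivative[OF qmul.bounded_linear_left s])
  have 1: "((\<lambda>x::amb. snd (qmul (qcnj (fst x)) (fst w))) has_derivative (\<lambda>v. snd (qmul (qcnj (fst v)) (fst w)))) (at x)"
    by (intro has_derivative_snd bounded_linear.has_derivative[OF qmul.bounded_linear_left cf])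
  note 2 = has_derivative_snd[OF qmul.FDERIV[OF qmul.FDERIV[OF cf E] f]]
  have 3: "((\<lambda>x::amb. 1/2 * inverse (snd x \<bullet> snd x)) has_derivative
      (\<lambda>v. - (inverse (snd x \<bullet> snd x) * (snd x \<bullet> snd v) * inverse (snd x \<bullet> snd x)))) (at x)"
    by (rule has_derivative_eq_rhs[OF has_derivative_mult_right[OF
          Deriv.has_derivative_inverse[OF q has_derivative_inner[OF s s]]]])
       (simp add: fun_eq_iff inner_commute algebra_simps)
  show ?thesis
    unfolding mu_def[abs_def] mu_deriv_def[abs_def] Let_def
    by (rule has_derivative_add[OF 1 has_derivative_scaleR[OF 3 2]])
qed

lemma retr_pull_abform:
  assumes A: "\<And>x v. x \<in> M \<Longrightarrow> norm (fst x) \<in> J \<Longrightarrow> v \<in> tangent x \<Longrightarrow> A x v = abform a b x v"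
    and y: "norm (fst y) \<in> J" "J \<subseteq> {0<..}" "snd y \<noteq> 0"
  shows "retr_pull A y w = diag_abb (a (norm (fst y)) / (norm (fst y))\<^sup>2) (b (norm (fst y)) / (norm (fst y))\<^sup>2) (mu y w)"
proof -
  have "norm (snd (retr y)) = 1" "fst y \<noteq> 0" using y by (auto simp: retr_def)
  then show ?thesis
    unfolding retr_pull_def
    by (subst A[OF retr_in_M[OF y(3)] _ retr_deriv_tangent[OF y(3)]])
       (use y in \<open>auto simp: abform_mu mu_retr\<close>)
qed

lemma open_norm_fst: "open J \<Longrightarrow> open {y :: amb. norm (fst y) \<in> J \<and> snd y \<noteq> 0}"
proof -
  assume "open J"
  then have "open ((\<lambda>y::amb. norm (fst y)) -` J)" by (intro open_vimage continuous_intros)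
  moreover have "open {y :: amb. snd y \<noteq> 0}" by (intro open_Collect_neq continuous_intros)
  ultimately have "open ((\<lambda>y::amb. norm (fst y)) -` J \<inter> {y. snd y \<noteq> 0})" by (rule open_Int)
  then show ?thesis by (simp add: vimage_def Collect_conj_eq[symmetric])
qed

lemma retr_pull_has_derivative:
  assumes A: "\<And>x v. x \<in> M \<Longrightarrow> norm (fst x) \<in> J \<Longrightarrow> v \<in> tangent x \<Longrightarrow> A x v = abform a b x v"
    and J: "open J" "J \<subseteq> {0<..}"
    and x: "norm (fst x) \<in> J" "snd x \<noteq> 0"
    and a: "(a has_real_derivative a') (at (norm (fst x)))"
    and b: "(b has_real_derivative b') (at (norm (fst x)))"
  shows "((\<lambda>y. retr_pull A y w) has_derivative (\<lambda>v.
     let t = norm (fst x); s = (fst x \<bullet> fst v) / t in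
     diag_abb (a t / t\<^sup>2) (b t / t\<^sup>2) (mu_deriv x w v)
     + s *\<^sub>R diag_abb (a' / t\<^sup>2 - 2 * a t / t ^ 3) (b' / t\<^sup>2 - 2 * b t / t ^ 3) (mu x w))) (at x)"
proof -
  define t where "t = norm (fst x)"
  define N where "N = (\<lambda>y::amb. norm (fst y))"
  have t: "t > 0" and p: "fst x \<noteq> 0" using x J by (auto simp: t_def)
  have N: "(N has_derivative (\<lambda>v. (fst x \<bullet> fst v) / t)) (at x)"
    unfolding N_def t_def by (rule norm_fst_has_derivative[OF p])
  have quot: "((\<lambda>t. c t / t\<^sup>2) has_real_derivative c' / t\<^sup>2 - 2 * c t / t ^ 3) (at t)"
    if "(c has_real_derivative c') (at t)" for c c'
    using t by (auto intro!: derivative_eq_intros that simp: power2_eq_square power3_eq_cube field_simps)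
  have co: "((\<lambda>y. c (N y) / (N y)\<^sup>2) has_derivative (\<lambda>v. (fst x \<bullet> fst v) / t * (c' / t\<^sup>2 - 2 * c t / t ^ 3))) (at x)"
    if "(c has_real_derivative c') (at t)" for c c'
    using DERIV_compose_FDERIV[where f = "\<lambda>t. c t / t\<^sup>2" and g = N and x = x, OF _ N] quot[OF that]
    by (simp add: N_def t_def)
  have lin: "((\<lambda>y. diag_abb c c' (mu y w)) has_derivative (\<lambda>v. diag_abb c c' (mu_deriv x w v))) (at x)" for c c'
    by (rule bounded_linear.has_derivative[OF bounded_linear_diag_abb mu_has_derivative[OF x(2)]])
  have "((\<lambda>y. (a (N y) / (N y)\<^sup>2) *\<^sub>R diag_abb 1 0 (mu y w) + (b (N y) / (N y)\<^sup>2) *\<^sub>R diag_abb 0 1 (mu y w)) has_derivative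
      (\<lambda>v. ((a (N x) / (N x)\<^sup>2) *\<^sub>R diag_abb 1 0 (mu_deriv x w v)
          + ((fst x \<bullet> fst v) / t * (a' / t\<^sup>2 - 2 * a t / t ^ 3)) *\<^sub>R diag_abb 1 0 (mu x w))
        + ((b (N x) / (N x)\<^sup>2) *\<^sub>R diag_abb 0 1 (mu_deriv x w v)
          + ((fst x \<bullet> fst v) / t * (b' / t\<^sup>2 - 2 * b t / t ^ 3)) *\<^sub>R diag_abb 0 1 (mu x w)))) (at x)"
    using a b by (intro has_derivative_add has_derivative_scaleR co lin) (simp_all add: t_def)
  then have "((\<lambda>y. diag_abb (a (N y) / (N y)\<^sup>2) (b (N y) / (N y)\<^sup>2) (mu y w)) has_derivative
      (\<lambda>v. diag_abb (a t / t\<^sup>2) (b t / t\<^sup>2) (mu_deriv x w v)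
     + ((fst x \<bullet> fst v) / t) *\<^sub>R diag_abb (a' / t\<^sup>2 - 2 * a t / t ^ 3) (b' / t\<^sup>2 - 2 * b t / t ^ 3) (mu x w))) (at x)"
    unfolding diag_abb_split[symmetric]
  proof (rule has_derivative_eq_rhs)
    have "N x = t" by (simp add: N_def t_def)
    then show "(\<lambda>v. ((a (N x) / (N x)\<^sup>2) *\<^sub>R diag_abb 1 0 (mu_deriv x w v)
          + ((fst x \<bullet> fst v) / t * (a' / t\<^sup>2 - 2 * a t / t ^ 3)) *\<^sub>R diag_abb 1 0 (mu x w))
        + ((b (N x) / (N x)\<^sup>2) *\<^sub>R diag_abb 0 1 (mu_deriv x w v)
          + ((fst x \<bullet> fst v) / t * (b' / t\<^sup>2 - 2 * b t / t ^ 3)) *\<^sub>R diag_abb 0 1 (mu x w))) =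
      (\<lambda>v. diag_abb (a t / t\<^sup>2) (b t / t\<^sup>2) (mu_deriv x w v)
     + ((fst x \<bullet> fst v) / t) *\<^sub>R diag_abb (a' / t\<^sup>2 - 2 * a t / t ^ 3) (b' / t\<^sup>2 - 2 * b t / t ^ 3) (mu x w))"
      by (simp add: diag_abb_split[of "a t / t\<^sup>2" "b t / t\<^sup>2"]
          diag_abb_split[of "a' / t\<^sup>2 - 2 * a t / t ^ 3" "b' / t\<^sup>2 - 2 * b t / t ^ 3"]
          scaleR_add_right add_ac)
  qed
  then show ?thesis
    unfolding Let_def t_def[symmetric]
  proof (rule has_derivative_transform_within_open[OF _ open_norm_fst[OF J(1)]])
    show "x \<in> {y. norm (fst y) \<in> J \<and> snd y \<noteq> 0}" using x by simp
    fix y :: amb assume "y \<in> {y. norm (fst y) \<in> J \<and> snd y \<noteq> 0}"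
    then show "diag_abb (a (N y) / (N y)\<^sup>2) (b (N y) / (N y)\<^sup>2) (mu y w) = retr_pull A y w"
      using retr_pull_abform[where A = A, OF A] J by (simp add: N_def)
  qed
qed

text \<open>The order is \<open>dt, \<eta>\<^sub>1\<^sup>+, \<eta>\<^sub>2\<^sup>+, \<eta>\<^sub>3\<^sup>+, \<eta>\<^sub>1\<^sup>-, \<eta>\<^sub>2\<^sup>-, \<eta>\<^sub>3\<^sup>-\<close>.\<close>

definition coframe :: "amb \<Rightarrow> nat \<Rightarrow> amb \<Rightarrow> real" where
  "coframe x n = (if n = 0 then dt x else if n = 1 then etap 1 x else if n = 2 then etap 2 x
     else if n = 3 then etap 3 x else if n = 4 then etam 1 x else if n = 5 then etam 2 x else etam 3 x)"

lemma coframe_simps: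
  "coframe x 0 = dt x" "coframe x (Suc 0) = etap 1 x" "coframe x 1 = etap 1 x" "coframe x 2 = etap 2 x" "coframe x 3 = etap 3 x"
  "coframe x 4 = etam 1 x" "coframe x 5 = etam 2 x" "coframe x 6 = etam 3 x"
  by (simp_all add: coframe_def)

text \<open>The curvature expanded with the Maurer-Cartan equation \<open>d\<eta>\<^sub>1\<^sup>+ =
  - 2 (\<eta>\<^sub>2\<^sup>+ \<and> \<eta>\<^sub>3\<^sup>+ + \<eta>\<^sub>2\<^sup>- \<and>
  \<eta>\<^sub>3\<^sup>-)\<close> and its cyclic analogues. The terms \<open>b\<^sup>2\<close> and
  \<open>a * b\<close> come from the bracket.\<close>

definition curv_form :: "real \<Rightarrow> real \<Rightarrow> real \<Rightarrow> real \<Rightarrow> amb \<Rightarrow> (amb, real^3) form" where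
  "curv_form a b a' b' x v = vector [
     a' * alti (coframe x) [0, 1] v + 2 * (b\<^sup>2 - a) * alti (coframe x) [2, 3] v - 2 * a * alti (coframe x) [5, 6] v,
     b' * alti (coframe x) [0, 2] v + 2 * (a * b - b) * alti (coframe x) [3, 1] v - 2 * b * alti (coframe x) [6, 4] v,
     b' * alti (coframe x) [0, 3] v + 2 * (a * b - b) * alti (coframe x) [1, 2] v - 2 * b * alti (coframe x) [4, 5] v]"

text \<open>For coefficients \<open>P\<close> of the fields \<open>T\<^sub>i\<^sup>+\<close> and
  \<open>m\<close> of \<open>T\<^sub>i\<^sup>-\<close>, the two group factors move with velocities
  \<open>P + m\<close> and \<open>P - m\<close>. In \<open>(p, q)\<close> this becomes
  \<open>t (P + m)\<close> and \<open>2 m\<close>, so the coframe simply reads off the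
  parameters.\<close>

lemma base_coframe:
  assumes t: "t > 0"
  defines "x \<equiv> ((t, 0), (1, 0)) :: amb" and "e \<equiv> \<lambda>s P m. ((s, t *\<^sub>R (P + m)), (0, 2 *\<^sub>R m)) :: amb"
  shows "coframe x 0 (e s P m) = s" "coframe x 1 (e s P m) = P $ 1" "coframe x 2 (e s P m) = P $ 2"
    "coframe x 3 (e s P m) = P $ 3" "coframe x 4 (e s P m) = m $ 1" "coframe x 5 (e s P m) = m $ 2"
    "coframe x 6 (e s P m) = m $ 3"
proof -
  have n: "norm (fst x) = t" "fst x \<noteq> 0" "norm (snd x) = 1" using t by (auto simp: x_def zero_prod_def)
  have mu: "mu x (e s P m) = t\<^sup>2 *\<^sub>R P"
    by (simp add: mu_def x_def e_def qmul_eq qcnj_eq power2_eq_square vec_eq_iff algebra_simps)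
  have nu: "nu x (e s P m) = t\<^sup>2 *\<^sub>R m"
    by (simp add: nu_def x_def e_def qmul_eq qcnj_eq power2_eq_square)
  have d: "fst x \<bullet> fst (e s P m) = t * s" by (simp add: x_def e_def)
  show "coframe x 0 (e s P m) = s" "coframe x 1 (e s P m) = P $ 1" "coframe x 2 (e s P m) = P $ 2"
    "coframe x 3 (e s P m) = P $ 3" "coframe x 4 (e s P m) = m $ 1" "coframe x 5 (e s P m) = m $ 2"
    "coframe x 6 (e s P m) = m $ 3"
    using t by (simp_all add: coframe_simps eta_mu_nu[OF n(2,3)] n mu nu d)
qed

lemma bracket_cross: "bracket u v = 2 *\<^sub>R cross3 u v"
  by (simp add: bracket_def cross_skew[of v u] scaleR_2)

lemma curvature_base:
  assumes A: "\<And>x v. x \<in> M \<Longrightarrow> norm (fst x) \<in> J \<Longrightarrow> v \<in> tangent x \<Longrightarrow> A x v = abform a b x v"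
    and J: "open J" "J \<subseteq> {0<..}" "t \<in> J"
    and a: "(a has_real_derivative a') (at t)" and b: "(b has_real_derivative b') (at t)"
    and x: "x = ((t, 0), (1, 0))"
    and v: "v 0 \<in> tangent x" "v 1 \<in> tangent x"
  shows "curvature A x v = curv_form (a t) (b t) a' b' x v"
proof -
  have t: "t > 0" using J by auto
  have n: "norm (fst x) = t" "norm (snd x) = 1" "snd x \<noteq> 0" "fst x \<noteq> 0" using t by (auto simp: x zero_prod_def)
  have xM: "x \<in> M" by (simp add: M_def x)
  note H = retr_pull_has_derivative[where A = A and x = x and a' = a' and b' = b', unfolded n(1), OF A J(1,2,3) n(3) a b]
  have D: "frechet_derivative (\<lambda>y. retr_pull A y w) (at x) u = diag_abb (a t / t\<^sup>2) (b t / t\<^sup>2) (mu_deriv x w u)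
     + ((fst x \<bullet> fst u) / t) *\<^sub>R diag_abb (a' / t\<^sup>2 - 2 * a t / t ^ 3) (b' / t\<^sup>2 - 2 * b t / t ^ 3) (mu x w)" for w u
    using fun_cong[OF frechet_derivative_at[OF H[of w]], of u] by (simp only: Let_def)
  have param: "\<exists>s P m. v i = ((s, t *\<^sub>R (P + m)), (0, 2 *\<^sub>R m))" if "v i \<in> tangent x" for i
  proof -
    obtain s y w z where "v i = ((s, y), (w, z))" by (metis prod.exhaust)
    then have "v i = ((s, t *\<^sub>R ((y /\<^sub>R t - z /\<^sub>R 2) + z /\<^sub>R 2)), (0, 2 *\<^sub>R (z /\<^sub>R 2)))"
      using that t by (simp add: tangent_def x)
    then show ?thesis by blast
  qed
  obtain s P m where v0: "v 0 = ((s, t *\<^sub>R (P + m)), (0, 2 *\<^sub>R m))" using param[OF v(1)] by blast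
  obtain s' P' m' where v1: "v 1 = ((s', t *\<^sub>R (P' + m')), (0, 2 *\<^sub>R m'))" using param[OF v(2)] by blast
  have mu: "mu x ((s, t *\<^sub>R (P + m)), (0, 2 *\<^sub>R m)) = t\<^sup>2 *\<^sub>R P" for s P m
    by (simp add: mu_def x qmul_eq qcnj_eq power2_eq_square vec_eq_iff algebra_simps)
  have mu_deriv: "mu_deriv x ((s, t *\<^sub>R (P + m)), (0, 2 *\<^sub>R m)) ((s', t *\<^sub>R (P' + m')), (0, 2 *\<^sub>R m')) =
      (t * s') *\<^sub>R (P - m) - (t * s) *\<^sub>R (P' + m') - t\<^sup>2 *\<^sub>R cross3 (P' + m') (P - m) - (2 * t\<^sup>2) *\<^sub>R cross3 m' m"
    for s P m s' P' m'
    by (simp add: mu_deriv_def x qmul_eq qcnj_eq Let_def vec_eq_iff forall_3 cross3_def field_simps power2_eq_square)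
  have px: "(fst x \<bullet> fst ((s, y), w)) / t = s" for s y and w :: quat
    using t by (simp add: x)
  \<comment> \<open>In terms of these quotients no division by \<open>t\<close> is left, and the
    final comparison becomes a polynomial identity.\<close>
  define \<alpha> \<alpha>' \<beta> \<beta>' where "\<alpha> = a t / t\<^sup>2" and "\<alpha>' = a' / t\<^sup>2 - 2 * a t / t ^ 3"
    and "\<beta> = b t / t\<^sup>2" and "\<beta>' = b' / t\<^sup>2 - 2 * b t / t ^ 3"
  have coeffs: "a t = \<alpha> * t\<^sup>2" "a' = \<alpha>' * t\<^sup>2 + 2 * \<alpha> * t" "b t = \<beta> * t\<^sup>2" "b' = \<beta>' * t\<^sup>2 + 2 * \<beta> * t"
    using t by (simp_all add: \<alpha>_def \<alpha>'_def \<beta>_def \<beta>'_def power2_eq_square power3_eq_cube field_simps)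
  have Av: "A x (v i) = diag_abb \<alpha> \<beta> (mu x (v i))" if "v i \<in> tangent x" for i
    using A[OF xM _ that] J(3) abform_mu[OF n(4,2)] by (simp add: n \<alpha>_def \<beta>_def)
  have al: "alti (coframe x) [i, j] v = coframe x i (v 0) * coframe x j (v 1) - coframe x i (v 1) * coframe x j (v 0)" for i j
    by (simp add: alti_def alt_2)
  note D' = D[folded \<alpha>_def \<alpha>'_def \<beta>_def \<beta>'_def]
  show ?thesis
    unfolding curvature_def ext_d_def D' bracket_cross Av[OF v(1)] Av[OF v(2)] coeffs
    unfolding v0 v1 mu mu_deriv px curv_form_def al[unfolded v0 v1] base_coframe[OF t, folded x]
    unfolding vec_eq_iff forall_3 vector_3
    by (simp add: cross3_def) (simp add: algebra_simps power2_eq_square)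
qed

lemma coframe_su2:
  assumes "fst x \<noteq> 0" "norm (snd x) = 1" "norm b1 = 1" "norm b2 = 1"
  shows "coframe (su2_action b1 b2 x) n (su2_action b1 b2 v) = coframe x n v"
proof -
  have n: "fst (su2_action b1 b2 x) \<noteq> 0" "norm (snd (su2_action b1 b2 x)) = 1"
    using su2_action_norm[OF assms(3,4), of x] assms(1,2) by (metis norm_eq_zero)+
  show ?thesis
    unfolding coframe_def
    by (simp add: eta_mu_nu[OF n] eta_mu_nu[OF assms(1,2)] su2_action_mu su2_action_nu su2_action_inner
        su2_action_norm assms)
qed

lemma mu_deriv_su2:
  assumes b: "norm b1 = 1" "norm b2 = 1"
  shows "mu_deriv (su2_action b1 b2 x) (su2_action b1 b2 w) (su2_action b1 b2 v) = mu_deriv x w v"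
proof -
  have i: "snd (su2_action b1 b2 x) \<bullet> snd (su2_action b1 b2 v) = snd x \<bullet> snd v" for x v
    by (rule su2_action_inner[OF b])
  show ?thesis
    unfolding mu_deriv_def Let_def i
    using b by (simp add: su2_action_eq qcnj_qmul qmul_assoc qmul_qcnj_cancel qmul.add_left qmul.add_right)
qed

text \<open>The action carries \<open>x\<close> to the base point, where the formula is known. Being
  linear, it maps constant fields to constant fields, so the invariance of the exterior derivative
  can be read off from the explicit derivatives at both points.\<close>

lemma curvature_abform:
  assumes A: "\<And>x v. x \<in> M \<Longrightarrow> norm (fst x) \<in> J \<Longrightarrow> v \<in> tangent x \<Longrightarrow> A x v = abform a b x v"
    and J: "open J" "J \<subseteq> {0<..}" "norm (fst x) \<in> J"
    and a: "(a has_real_derivative a') (at (norm (fst x)))" and b: "(b has_real_derivative b') (at (norm (fst x)))"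
    and x: "x \<in> M" and v: "v 0 \<in> tangent x" "v 1 \<in> tangent x"
  shows "curvature A x v = curv_form (a (norm (fst x))) (b (norm (fst x))) a' b' x v"
proof -
  have p: "fst x \<noteq> 0" using J by auto
  have q: "norm (snd x) = 1" using x by (cases x) (auto simp: M_def)
  obtain b1 b2 where bb: "norm b1 = 1" "norm b2 = 1" "su2_action b1 b2 x = ((norm (fst x), 0), (1, 0))"
    using su2_action_to_base[OF x p] .
  define L where "L = su2_action b1 b2"
  have nL: "norm (fst (L x)) = norm (fst x)" "norm (snd (L x)) = 1"
    using su2_action_norm[OF bb(1,2)] q by (simp_all add: L_def)
  have sn: "snd x \<noteq> 0" "snd (L x) \<noteq> 0" using q nL(2) by auto
  have in0: "fst (L x) \<bullet> fst (L u) = fst x \<bullet> fst u" for u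
    unfolding L_def by (rule su2_action_inner(1)[OF bb(1,2)])
  have D: "frechet_derivative (\<lambda>y. retr_pull A y (L w)) (at (L x)) (L u)
      = frechet_derivative (\<lambda>y. retr_pull A y w) (at x) u" for w u
  proof -
    note H1 = retr_pull_has_derivative[where A = A and x = x and w = w, OF A J(1,2,3) sn(1) a b]
    have Lx: "norm (fst (L x)) \<in> J" "(a has_real_derivative a') (at (norm (fst (L x))))"
      "(b has_real_derivative b') (at (norm (fst (L x))))"
      using J(3) a b by (simp_all only: nL)
    note H2 = retr_pull_has_derivative[where A = A and x = "L x" and w = "L w", OF A J(1,2) Lx(1) sn(2) Lx(2,3)]
    have m: "mu_deriv (L x) (L w) (L u) = mu_deriv x w u" "mu (L x) (L w) = mu x w"
      unfolding L_def by (rule mu_deriv_su2[OF bb(1,2)], rule su2_action_mu[OF bb(1,2)])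
    show ?thesis
      using fun_cong[OF frechet_derivative_at[OF H1], of u] fun_cong[OF frechet_derivative_at[OF H2], of "L u"]
      by (simp only: Let_def m in0 nL)
  qed
  have AL: "A (L x) (L u) = A x u" if "u \<in> tangent x" for u
  proof -
    have "A (L x) (L u) = abform a b (L x) (L u)"
      by (rule A) (use su2_action_M[OF bb(1,2) x] su2_action_tangent[OF bb(1,2) that] nL J in \<open>auto simp: L_def\<close>)
    also have "\<dots> = abform a b x u"
      unfolding L_def by (rule abform_su2[OF p q bb(1,2)])
    finally show ?thesis using A[OF x J(3) that] by simp
  qed
  have "curvature A x v = curvature A (L x) (\<lambda>i. L (v i))"
    unfolding curvature_def ext_d_def D AL[OF v(1)] AL[OF v(2)] ..
  also have "\<dots> = curv_form (a (norm (fst x))) (b (norm (fst x))) a' b' (L x) (\<lambda>i. L (v i))"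
  proof (rule curvature_base[where A = A and J = J, OF A J a b])
    show "L x = ((norm (fst x), 0), (1, 0))" by (simp only: L_def bb(3))
    show "L (v 0) \<in> tangent (L x)" "L (v 1) \<in> tangent (L x)"
      unfolding L_def by (rule su2_action_tangent[OF bb(1,2)], rule v)+
  qed
  also have "\<dots> = curv_form (a (norm (fst x))) (b (norm (fst x))) a' b' x v"
  proof -
    have "coframe (L x) n (L u) = coframe x n u" for n u
      unfolding L_def by (rule coframe_su2[OF p q bb(1,2)])
    then have "alti (coframe (L x)) [i, j] (\<lambda>i. L (v i)) = alti (coframe x) [i, j] v" for i j
      by (simp add: alti_def alt_2)
    then show ?thesis by (simp add: curv_form_def)
  qed
  finally show ?thesis .
qed

subsection \<open>The instanton equation\<close>

lemma levi_civita_nth: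
  "levi_civita i j k = (if (i, j, k) \<in> {(1, 2, 3), (2, 3, 1), (3, 1, 2)} then 1
     else if (i, j, k) \<in> {(2, 1, 3), (3, 2, 1), (1, 3, 2)} then - 1 else 0)"
  using exhaust_3[of i] exhaust_3[of j] exhaust_3[of k]
  by (auto simp: levi_civita_def cross3_def axis_def)

context
  fixes x :: amb and A1 A2 B1 B2 :: real
  defines "A1 \<equiv> Acf 1 (norm (fst x))" and "A2 \<equiv> Acf 2 (norm (fst x))"
    and "B1 \<equiv> Bcf 1 (norm (fst x))" and "B2 \<equiv> Bcf 2 (norm (fst x))"
begin

lemma omega_alti:
  "omega x = (\<lambda>v. 4 * A1 * B1 * alti (coframe x) [4, 1] v
     + (4 * A2 * B2 * alti (coframe x) [5, 2] v + 4 * A2 * B2 * alti (coframe x) [6, 3] v))"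
  by (intro ext) (simp add: omega_def Let_def sum_3 wedge2_alt alti_def coframe_simps Acf_3 Bcf_3
      A1_def A2_def B1_def B2_def algebra_simps)

lemma Omega2_alti:
  "Omega2 x = (\<lambda>v. - 8 * A1 * A2\<^sup>2 * alti (coframe x) [1, 2, 3] v
     + (8 * B1 * B2 * A2 * alti (coframe x) [4, 5, 3] v
     + (8 * B2\<^sup>2 * A1 * alti (coframe x) [5, 6, 1] v
     + 8 * B1 * B2 * A2 * alti (coframe x) [6, 4, 2] v)))" (is "_ = ?R")
proof
  fix v
  \<comment> \<open>Exchanging \<open>i\<close> and \<open>j\<close> changes the sign of
    \<open>levi_civita\<close> and of the form alike, so each term occurs twice and the coefficient
    4 becomes 8.\<close>
  have "alt [\<beta>, \<alpha>, \<gamma>] v = - alt [\<alpha>, \<beta>, \<gamma>] v" for \<alpha> \<beta> \<gamma> :: "amb \<Rightarrow> real"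
    using alt_swap[of "[]" \<beta> \<alpha> "[\<gamma>]" v] by simp
  then have swap: "alt [etam 2 x, etam 1 x, etap 3 x] v = - alt [etam 1 x, etam 2 x, etap 3 x] v"
    "alt [etam 3 x, etam 2 x, etap 1 x] v = - alt [etam 2 x, etam 3 x, etap 1 x] v"
    "alt [etam 1 x, etam 3 x, etap 2 x] v = - alt [etam 3 x, etam 1 x, etap 2 x] v"
    by blast+
  show "Omega2 x v = ?R v"
    by (simp add: Omega2_def Let_def sum_3 levi_civita_nth wedge3_alt alti_def coframe_simps Acf_3 Bcf_3 swap
        A1_def A2_def B1_def B2_def power2_eq_square)
qed

text \<open>In the square of \<open>omega\<close> the squares of single terms have a repeated factor
  and vanish. Mixed terms occur twice because 2-forms commute, which cancels the factor 1/2.\<close>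

lemma psi_alti:
  "psi x = (\<lambda>v. 16 * (A1 * B1 * A2 * B2) * alti (coframe x) [4, 1, 5, 2] v
     + (16 * (A1 * B1 * A2 * B2) * alti (coframe x) [4, 1, 6, 3] v
     + (16 * (A2\<^sup>2 * B2\<^sup>2) * alti (coframe x) [5, 2, 6, 3] v
     + (8 * (A1 * A2\<^sup>2) * alti (coframe x) [0, 1, 2, 3] v
     + ((- 8 * (B1 * B2 * A2)) * alti (coframe x) [0, 4, 5, 3] v
     + ((- 8 * (B2\<^sup>2 * A1)) * alti (coframe x) [0, 5, 6, 1] v
     + (- 8 * (B1 * B2 * A2)) * alti (coframe x) [0, 6, 4, 2] v))))))" (is "_ = ?R")
proof
  fix v
  have dt: "(\<lambda>w. dt x (w 0)) = alti (coframe x) [0]"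
    by (simp add: alti_def alt_1 coframe_simps)
  have sym: "alti (coframe x) [5, 2, 4, 1] v = alti (coframe x) [4, 1, 5, 2] v"
    "alti (coframe x) [6, 3, 4, 1] v = alti (coframe x) [4, 1, 6, 3] v"
    "alti (coframe x) [6, 3, 5, 2] v = alti (coframe x) [5, 2, 6, 3] v"
    by (simp_all add: alti_sort del: One_nat_def)
  show "psi x v = ?R v"
    unfolding psi_def omega_alti Omega2_alti dt wedge_add_left wedge_add_right wedge_scale_left wedge_scale_right
    by (simp add: wedge_alti alti_not_distinct sym power2_eq_square algebra_simps del: One_nat_def)
qed

end

definition defect_a :: "real \<Rightarrow> real \<Rightarrow> real \<Rightarrow> real \<Rightarrow> real" where
  "defect_a t a b a' = a' * ((Acf 2 t)\<^sup>2 * (Bcf 2 t)\<^sup>2) - Acf 1 t * ((a - b\<^sup>2) * (Bcf 2 t)\<^sup>2 - a * (Acf 2 t)\<^sup>2)"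

definition defect_b :: "real \<Rightarrow> real \<Rightarrow> real \<Rightarrow> real \<Rightarrow> real" where
  "defect_b t a b b' = b' * (Acf 1 t * Bcf 1 t * Bcf 2 t) - (b * (1 - a) * (Bcf 1 t * Bcf 2 t) - b * Acf 1 t * Acf 2 t)"

text \<open>In the \<open>T i\<close> component every product has a repeated factor unless it omits
  exactly \<open>\<eta>\<^sub>i\<^sup>-\<close>, so a single 6-form survives. Components 2 and 3
  share one defect because the metric coefficients for 2 and 3 coincide; two scalar equations
  remain.\<close>

lemma wedge_curv_form_psi:
  fixes x :: amb
  defines "t \<equiv> norm (fst x)"
  shows "wedge 2 4 (curv_form a b a' b' x) (psi x) v $ 1 =
      - 16 * defect_a t a b a' * alti (coframe x) [0, 1, 2, 3, 5, 6] v"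
    and "wedge 2 4 (curv_form a b a' b' x) (psi x) v $ 2 =
      16 * Acf 2 t * defect_b t a b b' * alti (coframe x) [0, 1, 2, 3, 4, 6] v"
    and "wedge 2 4 (curv_form a b a' b' x) (psi x) v $ 3 =
      - 16 * Acf 2 t * defect_b t a b b' * alti (coframe x) [0, 1, 2, 3, 4, 5] v"
  unfolding wedge_nth
  unfolding psi_alti t_def[symmetric] curv_form_def vector_3 diff_conv_add_uminus mult_minus_left[symmetric]
    wedge_add_left wedge_add_right wedge_scale_left wedge_scale_right
  by (simp_all add: wedge_alti alti_not_distinct del: One_nat_def)
     (simp_all add: alti_sort defect_a_def defect_b_def power2_eq_square algebra_simps del: One_nat_def)

subsection \<open>Bounds on the curvature\<close>

lemma coframe_bounds:
  assumes "gmetric x u u = 1" "fst x \<noteq> 0"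
  defines "t \<equiv> norm (fst x)"
  shows "\<bar>coframe x 0 u\<bar> \<le> 1" "\<bar>coframe x 1 u\<bar> \<le> 1 / (2 * Acf 1 t)"
    "\<bar>coframe x 2 u\<bar> \<le> 1 / (2 * Acf 2 t)" "\<bar>coframe x 3 u\<bar> \<le> 1 / (2 * Acf 2 t)"
    "\<bar>coframe x 4 u\<bar> \<le> 1 / (2 * Bcf 1 t)"
    "\<bar>coframe x 5 u\<bar> \<le> 1 / (2 * Bcf 2 t)" "\<bar>coframe x 6 u\<bar> \<le> 1 / (2 * Bcf 2 t)"
proof -
  have t: "t > 0" using assms by simp
  have sq: "(2 * c)\<^sup>2 * (y * y) = (2 * c * y)\<^sup>2" for c y :: real
    by (simp add: power2_eq_square)
  have "(dt x u)\<^sup>2 + (2 * Acf 1 t * etap 1 x u)\<^sup>2 + (2 * Bcf 1 t * etam 1 x u)\<^sup>2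
      + (2 * Acf 2 t * etap 2 x u)\<^sup>2 + (2 * Bcf 2 t * etam 2 x u)\<^sup>2
      + (2 * Acf 2 t * etap 3 x u)\<^sup>2 + (2 * Bcf 2 t * etam 3 x u)\<^sup>2 = 1"
    using assms(1) unfolding gmetric_def Let_def t_def[symmetric] sum_3 sq Acf_3 Bcf_3
    by (simp add: power2_eq_square add_ac)
  moreover note zero_le_power2[of "dt x u"] zero_le_power2[of "2 * Acf 1 t * etap 1 x u"]
    zero_le_power2[of "2 * Acf 2 t * etap 2 x u"] zero_le_power2[of "2 * Acf 2 t * etap 3 x u"]
    zero_le_power2[of "2 * Bcf 1 t * etam 1 x u"] zero_le_power2[of "2 * Bcf 2 t * etam 2 x u"]
    zero_le_power2[of "2 * Bcf 2 t * etam 3 x u"]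
  ultimately have sqs: "(dt x u)\<^sup>2 \<le> 1" "(2 * Acf 1 t * etap 1 x u)\<^sup>2 \<le> 1"
      "(2 * Acf 2 t * etap 2 x u)\<^sup>2 \<le> 1" "(2 * Acf 2 t * etap 3 x u)\<^sup>2 \<le> 1"
      "(2 * Bcf 1 t * etam 1 x u)\<^sup>2 \<le> 1" "(2 * Bcf 2 t * etam 2 x u)\<^sup>2 \<le> 1"
      "(2 * Bcf 2 t * etam 3 x u)\<^sup>2 \<le> 1"
    by linarith+
  have le: "\<bar>y\<bar> \<le> 1 / (2 * c)" if "(2 * c * y)\<^sup>2 \<le> 1" "c > 0" for c y :: real
  proof -
    have "\<bar>2 * c * y\<bar> \<le> 1" using that(1) by (simp add: abs_square_le_1)
    then show ?thesis using that(2) by (simp add: abs_mult field_simps)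
  qed
  show "\<bar>coframe x 0 u\<bar> \<le> 1" using sqs(1) by (simp add: coframe_simps abs_square_le_1)
  show "\<bar>coframe x 1 u\<bar> \<le> 1 / (2 * Acf 1 t)"
    "\<bar>coframe x 2 u\<bar> \<le> 1 / (2 * Acf 2 t)" "\<bar>coframe x 3 u\<bar> \<le> 1 / (2 * Acf 2 t)"
    "\<bar>coframe x 4 u\<bar> \<le> 1 / (2 * Bcf 1 t)"
    "\<bar>coframe x 5 u\<bar> \<le> 1 / (2 * Bcf 2 t)" "\<bar>coframe x 6 u\<bar> \<le> 1 / (2 * Bcf 2 t)"
    unfolding coframe_simps using sqs Acf_pos[OF t] Bcf_pos[OF t] by (auto intro!: le)
qed

lemma alti_2_bound:
  assumes "\<bar>\<theta> i (v 0)\<bar> \<le> c" "\<bar>\<theta> i (v 1)\<bar> \<le> c" "\<bar>\<theta> j (v 0)\<bar> \<le> d" "\<bar>\<theta> j (v 1)\<bar> \<le> d"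
  shows "\<bar>alti \<theta> [i, j] v\<bar> \<le> 2 * (c * d)"
proof -
  have "0 \<le> c" "0 \<le> d" using assms by linarith+
  then have "\<bar>\<theta> i (v 0) * \<theta> j (v 1)\<bar> \<le> c * d" "\<bar>\<theta> i (v 1) * \<theta> j (v 0)\<bar> \<le> c * d"
    using assms by (auto simp: abs_mult intro!: mult_mono)
  then show ?thesis by (simp add: alti_def alt_2)
qed

text \<open>The 2-forms built from \<open>\<eta>\<^sub>i\<^sup>+\<close> have lengths of order
  \<open>1 / (A\<^sub>i A\<^sub>j)\<close>, unbounded at the singular orbit. These estimates say
  that \<open>a\<close> and \<open>b\<close> vanish correspondingly there; they follow from
  \<open>1 / Qf r = A\<^sub>1\<^sup>2\<close> and
  \<open>1 / Wf r \<le> (r - 9/4) / (r + 9/4)\<^sup>2\<close>.\<close>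

lemma solution_bounds:
  assumes t: "t > 0" and Y: "0 \<le> Y" "Y \<le> C" and D: "0 \<le> D" "D \<le> C"
  defines "r \<equiv> r_of_t t"
  defines "a \<equiv> (1 + Y) / Qf r" and "b \<equiv> D / Wf r"
  shows "(Acf 1 t)\<^sup>2 \<le> 2 * (Acf 2 t)\<^sup>2" "0 \<le> a" "a \<le> 1 + C" "0 \<le> b" "b \<le> C" "a \<le> 2 * (1 + C) * (Acf 2 t)\<^sup>2" "b \<le> C * (Acf 1 t)\<^sup>2"
    "b \<le> C * (Acf 2 t)\<^sup>2" "b \<le> C * (Acf 1 t * Acf 2 t)"
proof -
  have r: "r > 9/4" using r_of_t_gt[OF t] by (simp add: r_def)
  have C: "C \<ge> 0" using Y by linarith
  have A1: "(Acf 1 t)\<^sup>2 = (r - 9/4) * (r + 9/4) / ((r - 3/4) * (r + 3/4))"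
    and A2: "(Acf 2 t)\<^sup>2 = (r - 9/4) * (r + 3/4) / 3"
    using t by (simp_all add: Acf_1_sq Acf_2_sq r_def)
  have Qi: "1 / Qf r = (Acf 1 t)\<^sup>2" using r by (simp add: A1 Qf_def)
  have a_eq: "a = (1 + Y) * (Acf 1 t)\<^sup>2" unfolding a_def Qi[symmetric] by simp
  have A1_le: "(Acf 1 t)\<^sup>2 \<le> 1"
    using Acf_1_le[of t] Acf_pos[OF t, of 1] t by (simp add: power_le_one)
  show A12: "(Acf 1 t)\<^sup>2 \<le> 2 * (Acf 2 t)\<^sup>2"
  proof -
    have "(r + 9/4) * 3 \<le> 2 * ((r + 3/4) * ((r - 3/4) * (r + 3/4)))"
    proof -
      have "(r + 3/4) * (r - 3/4) \<ge> 3 * (3/2)" using r by (intro mult_mono) auto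
      then have "2 * (r + 3/4) * (9/2) \<le> 2 * (r + 3/4) * ((r + 3/4) * (r - 3/4))"
        using r by (intro mult_left_mono) auto
      moreover have "(r + 9/4) * 3 \<le> 2 * (r + 3/4) * (9/2)" using r by simp
      moreover have "2 * (r + 3/4) * ((r + 3/4) * (r - 3/4)) = 2 * ((r + 3/4) * ((r - 3/4) * (r + 3/4)))"
        by (simp only: mult_ac)
      ultimately show ?thesis by linarith
    qed
    then have "(r + 9/4) / ((r - 3/4) * (r + 3/4)) \<le> 2 * ((r + 3/4) / 3)"
    proof -
      have "(r + 9/4) / P \<le> 2 * ((r + 3/4) / 3)" if "(r + 9/4) * 3 \<le> 2 * ((r + 3/4) * P)" "P > 0" for P
        using that by (simp add: pos_divide_le_eq algebra_simps)
      then show ?thesis using \<open>(r + 9/4) * 3 \<le> _\<close> r by simp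
    qed
    then have "(r - 9/4) * ((r + 9/4) / ((r - 3/4) * (r + 3/4))) \<le> (r - 9/4) * (2 * ((r + 3/4) / 3))"
      using r by (intro mult_left_mono) auto
    then show ?thesis unfolding A1 A2 by (simp only: times_divide_eq_right mult.left_commute)
  qed
  show "0 \<le> a" using Y by (simp add: a_eq)
  show "a \<le> 1 + C"
    using mult_mono[of "1 + Y" "1 + C" "(Acf 1 t)\<^sup>2" 1] A1_le Y by (simp add: a_eq)
  have "a \<le> (1 + C) * (2 * (Acf 2 t)\<^sup>2)"
    unfolding a_eq using A12 Y by (intro mult_mono) auto
  then show "a \<le> 2 * (1 + C) * (Acf 2 t)\<^sup>2" by (simp only: mult.assoc mult.left_commute)
  have W: "1 / Wf r \<le> (r - 9/4) / (r + 9/4)\<^sup>2"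
  proof -
    have "1 \<le> sqrt r" using r by simp
    then have "(r - 9/4) / ((r + 9/4)\<^sup>2 * sqrt r) \<le> (r - 9/4) / ((r + 9/4)\<^sup>2 * 1)"
      using r by (intro divide_left_mono mult_left_mono) auto
    then show ?thesis by (simp add: Wf_def)
  qed
  have Wp: "Wf r > 0" by (rule Wf_pos[OF r])
  show b0: "0 \<le> b" using D Wp by (simp add: b_def)
  have b_le: "b \<le> C * X" if "(r - 9/4) / (r + 9/4)\<^sup>2 \<le> X" for X
  proof -
    have "D * (1 / Wf r) \<le> C * X"
      using W that D Wp C by (intro mult_mono) (auto intro: order_trans)
    then show ?thesis by (simp add: b_def)
  qed
  have p2: "(r + 9/4)\<^sup>2 > 0" using r by simp
  have "(r - 9/4) / (r + 9/4)\<^sup>2 \<le> 1"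
  proof -
    have "r - 9/4 \<le> (r + 9/4) * 1" by simp
    also have "\<dots> \<le> (r + 9/4) * (r + 9/4)" using r by (intro mult_left_mono) auto
    finally show ?thesis using p2 by (simp add: divide_le_eq power2_eq_square)
  qed
  from b_le[OF this] show "b \<le> C" by simp
  have "(r - 9/4) * (1 / (r + 9/4)\<^sup>2) \<le> (r - 9/4) * ((r + 9/4) / ((r - 3/4) * (r + 3/4)))"
  proof (rule mult_left_mono)
    have "1 * ((r - 3/4) * (r + 3/4)) \<le> (r + 9/4) * ((r + 9/4) * (r + 9/4))"
      using r by (intro mult_mono) auto
    moreover have "1 / p\<^sup>2 \<le> p / P" if "1 * P \<le> p * (p * p)" "P > 0" "p > 0" for p P :: real
      using that by (simp add: divide_simps power2_eq_square mult_ac)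
    ultimately show "1 / (r + 9/4)\<^sup>2 \<le> (r + 9/4) / ((r - 3/4) * (r + 3/4))"
      using r by simp
  qed (use r in simp)
  then show b1: "b \<le> C * (Acf 1 t)\<^sup>2"
    using b_le[of "(Acf 1 t)\<^sup>2"] by (simp add: A1)
  have "(r - 9/4) * (1 / (r + 9/4)\<^sup>2) \<le> (r - 9/4) * ((r + 3/4) / 3)"
  proof (rule mult_left_mono)
    have "1 / (r + 9/4)\<^sup>2 \<le> 1" using r by (simp add: divide_le_eq_1 power_le_one_iff one_le_power)
    also have "1 \<le> (r + 3/4) / 3" using r by simp
    finally show "1 / (r + 9/4)\<^sup>2 \<le> (r + 3/4) / 3" .
  qed (use r in simp)
  then show b2: "b \<le> C * (Acf 2 t)\<^sup>2"
    using b_le[of "(Acf 2 t)\<^sup>2"] by (simp add: A2)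
  \<comment> \<open>The geometric mean of the two bounds just obtained.\<close>
  show "b \<le> C * (Acf 1 t * Acf 2 t)"
  proof (rule power2_le_imp_le)
    have "b * b \<le> (C * (Acf 1 t)\<^sup>2) * (C * (Acf 2 t)\<^sup>2)"
      using b0 b1 b2 C by (intro mult_mono) auto
    then show "b\<^sup>2 \<le> (C * (Acf 1 t * Acf 2 t))\<^sup>2" by (simp add: power2_eq_square mult_ac)
    show "0 \<le> C * (Acf 1 t * Acf 2 t)" using C Acf_pos[OF t] by (simp add: less_imp_le)
  qed
qed

text \<open>In each term the coefficient is bounded by a multiple of the same metric coefficients
  that the size of the 2-form has in its denominator, and \<open>prod\<close> cancels them. For the
  terms with \<open>dt\<close> the factor \<open>A\<^sub>1\<close> of the time derivative does this,
  in view of \<open>A\<^sub>1 \<le> 2 A\<^sub>2\<close>.\<close>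

lemma curv_form_bound:
  assumes Y: "0 \<le> Y" "Y \<le> C" and D: "0 \<le> D" "D \<le> C" and p: "fst x \<noteq> 0"
    and v: "gmetric x (v 0) (v 0) = 1" "gmetric x (v 1) (v 1) = 1"
  defines "t \<equiv> norm (fst x)"
  defines "a \<equiv> (1 + Y) / Qf (r_of_t t)" and "b \<equiv> D / Wf (r_of_t t)"
  shows "norm (curv_form a b (Acf 1 t * rate_a (r_of_t t) a b) (Acf 1 t * rate_b (r_of_t t) a b) x v)
    \<le> 100 * (1 + C)\<^sup>2"
proof -
  let ?S = "(1 + C)\<^sup>2" and ?w = "\<lambda>i j. alti (coframe x) [i, j] v"
  define r where "r = r_of_t t"
  have t: "t > 0" using p by (simp add: t_def)
  have r: "r > 9/4" using r_of_t_gt[OF t] by (simp add: r_def)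
  have C: "C \<ge> 0" using Y by linarith
  note bounds = solution_bounds[OF t Y D, folded a_def b_def]
  note cf0 = coframe_bounds[OF v(1) p, folded t_def] and cf1 = coframe_bounds[OF v(2) p, folded t_def]
  note alt2 = alti_2_bound[where \<theta> = "coframe x" and v = v]
  define A1 A2 B1 B2 where "A1 = Acf 1 t" and "A2 = Acf 2 t" and "B1 = Bcf 1 t" and "B2 = Bcf 2 t"
  have pos: "A1 > 0" "A2 > 0" "B1 > 0" "B2 > 0"
    using Acf_pos[OF t] Bcf_pos[OF t] by (simp_all add: A1_def A2_def B1_def B2_def)
  have w01: "\<bar>?w 0 1\<bar> \<le> 1 / A1"
    using alt2[OF cf0(1) cf1(1) cf0(2) cf1(2)] by (simp add: A1_def)
  have w02: "\<bar>?w 0 2\<bar> \<le> 1 / A2"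
    using alt2[OF cf0(1) cf1(1) cf0(3) cf1(3)] by (simp add: A2_def)
  have w03: "\<bar>?w 0 3\<bar> \<le> 1 / A2"
    using alt2[OF cf0(1) cf1(1) cf0(4) cf1(4)] by (simp add: A2_def)
  have w23: "\<bar>2 * ?w 2 3\<bar> \<le> 1 / A2\<^sup>2"
    using alt2[OF cf0(3) cf1(3) cf0(4) cf1(4)] by (simp add: A2_def power2_eq_square)
  have w31: "\<bar>2 * ?w 3 1\<bar> \<le> 1 / (A1 * A2)"
    using alt2[OF cf0(4) cf1(4) cf0(2) cf1(2)] by (simp add: A1_def A2_def mult.commute)
  have w12: "\<bar>2 * ?w 1 2\<bar> \<le> 1 / (A1 * A2)"
    using alt2[OF cf0(2) cf1(2) cf0(3) cf1(3)] by (simp add: A1_def A2_def)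
  have w56: "\<bar>2 * ?w 5 6\<bar> \<le> 1 / B2\<^sup>2"
    using alt2[OF cf0(6) cf1(6) cf0(7) cf1(7)] by (simp add: B2_def power2_eq_square)
  have w64: "\<bar>2 * ?w 6 4\<bar> \<le> 1 / (B1 * B2)"
    using alt2[OF cf0(7) cf1(7) cf0(5) cf1(5)] by (simp add: B1_def B2_def mult.commute)
  have w45: "\<bar>2 * ?w 4 5\<bar> \<le> 1 / (B1 * B2)"
    using alt2[OF cf0(5) cf1(5) cf0(6) cf1(6)] by (simp add: B1_def B2_def)
  have prod: "\<bar>c * w\<bar> \<le> K" if "\<bar>w\<bar> \<le> 1 / d" "\<bar>c\<bar> \<le> K * d" "d > 0" for c w d K :: real
  proof -
    have "\<bar>c * w\<bar> \<le> (K * d) * (1 / d)"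
      unfolding abs_mult using that by (intro mult_mono) auto
    then show ?thesis using that(3) by simp
  qed
  \<comment> \<open>The first component needs \<open>5 + 3 + 2\<close> multiples of
    \<open>?S\<close>, the others fewer; three components stay well below the claimed factor
    100.\<close>
  define K where "K = 10 * ?S"
  have CC: "C * C \<le> ?S" "1 + C \<le> ?S" "C * (2 + C) \<le> ?S" "C \<le> ?S"
    using C by (auto simp: power2_eq_square algebra_simps)
  have A2B2: "A2\<^sup>2 \<le> B2\<^sup>2" "1 \<le> B1 * B2"
  proof -
    have "(r - 9/4) * (r + 3/4) \<le> (r - 3/4) * (r + 9/4)" using r by (simp add: field_simps)
    then show "A2\<^sup>2 \<le> B2\<^sup>2"
      using t by (simp only: A2_def B2_def Acf_2_sq Bcf_2_sq r_def[symmetric] less_imp_le divide_right_mono)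
    have "(r - 3/4) * (r + 9/4) \<ge> (3/2) * (9/2)" using r by (intro mult_mono) auto
    moreover have "B2\<^sup>2 = (r - 3/4) * (r + 9/4) / 3"
      using Bcf_2_sq[of t] t by (simp add: B2_def r_def)
    moreover have "1\<^sup>2 \<le> B" if "3/2 * (9/2) \<le> X" "B = X / 3" for X B :: real
      using that by simp
    ultimately have "1\<^sup>2 \<le> B2\<^sup>2" by blast
    then have "1 \<le> B2" using pos(4) by (rule power2_le_imp_le[OF _ less_imp_le])
    moreover have "1 \<le> B1" using r by (simp add: B1_def Bcf_1 r_def[symmetric])
    ultimately show "1 \<le> B1 * B2" using mult_mono[of 1 B1 1 B2] by simp
  qed
  have ab: "\<bar>b\<^sup>2 - a\<bar> \<le> 3 * ?S * A2\<^sup>2"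
  proof -
    have "b * b \<le> C * (C * A2\<^sup>2)" using bounds C by (intro mult_mono) (auto simp: A2_def)
    also have "\<dots> \<le> ?S * A2\<^sup>2"
      using CC(1) by (simp add: mult.assoc[symmetric] mult_right_mono)
    finally have "b\<^sup>2 \<le> ?S * A2\<^sup>2" by (simp add: power2_eq_square)
    moreover have "a \<le> 2 * ?S * A2\<^sup>2"
    proof -
      have "2 * (1 + C) * A2\<^sup>2 \<le> 2 * ?S * A2\<^sup>2" using CC(2) by (intro mult_right_mono) auto
      then show ?thesis using bounds(6) by (simp add: A2_def)
    qed
    moreover have "0 \<le> ?S * A2\<^sup>2" by simp
    moreover note bounds(2) zero_le_power2[of b]
    ultimately show ?thesis unfolding abs_le_iff mult.assoc by linarith
  qed
  have aB: "\<bar>a\<bar> \<le> 2 * ?S * B2\<^sup>2"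
  proof -
    have "2 * (1 + C) * A2\<^sup>2 \<le> 2 * ?S * B2\<^sup>2" using CC(2) A2B2 C by (intro mult_mono) auto
    then show ?thesis using bounds(2,6) by (simp add: A2_def)
  qed
  have ba: "\<bar>b * (a - 1)\<bar> \<le> ?S * X" if "b \<le> C * X" "X > 0" for X
  proof -
    have "\<bar>b * (a - 1)\<bar> \<le> (C * X) * (2 + C)"
      unfolding abs_mult using bounds that C by (intro mult_mono) auto
    also have "\<dots> \<le> ?S * X"
      using mult_right_mono[OF CC(3), of X] that(2) by (simp add: mult_ac)
    finally show ?thesis .
  qed
  have ra: "\<bar>rate_a r a b\<bar> \<le> 5 * ?S"
  proof -
    have "rate_a r a b = (a - b\<^sup>2) / A2\<^sup>2 - a / B2\<^sup>2"
      using t by (simp add: rate_a_def A2_def B2_def Acf_2_sq Bcf_2_sq r_def[symmetric] algebra_simps)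
    moreover have "\<bar>(a - b\<^sup>2) / A2\<^sup>2\<bar> \<le> 3 * ?S"
      using ab pos by (simp add: divide_le_eq abs_minus_commute)
    moreover have "\<bar>a / B2\<^sup>2\<bar> \<le> 2 * ?S"
      using aB pos by (simp add: divide_le_eq)
    ultimately show ?thesis by linarith
  qed
  have rb: "\<bar>rate_b r a b\<bar> \<le> 2 * ?S"
  proof -
    have Q: "Qf r * A1\<^sup>2 = 1" using Acf_1_Qf[OF t] by (simp add: A1_def r_def mult.commute)
    have "\<bar>b * (a - 1)\<bar> \<le> ?S * A1\<^sup>2" using ba[of "A1\<^sup>2"] bounds(7) pos by (simp add: A1_def)
    then have "\<bar>b * (a - 1)\<bar> * Qf r \<le> ?S * A1\<^sup>2 * Qf r"
      using Qf_pos[OF r] by (intro mult_right_mono) auto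
    then have 1: "\<bar>b * (a - 1) * Qf r\<bar> \<le> ?S"
      using Q Qf_pos[OF r] by (simp add: abs_mult mult.assoc mult.commute[of "A1\<^sup>2"])
    have "0 \<le> 3 * (r + 3/4) / (2 * r * (r + 9/4))" using r by simp
    moreover have "3 * (r + 3/4) / (2 * r * (r + 9/4)) \<le> 1"
    proof -
      have "3 * (r + 3/4) \<le> (9/2) * (r + 9/4)" using r by simp
      also have "\<dots> \<le> 2 * r * (r + 9/4)" using r by (intro mult_right_mono) auto
      finally show ?thesis using r by (simp add: divide_le_eq_1)
    qed
    moreover have "\<bar>b * X\<bar> \<le> ?S" if "0 \<le> X" "X \<le> 1" for X
      using bounds(4,5) CC(4) mult_mono[of b C X 1] C that by (simp add: abs_mult)
    ultimately have 2: "\<bar>b * (3 * (r + 3/4) / (2 * r * (r + 9/4)))\<bar> \<le> ?S"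
      by blast
    have rate: "rate_b r a b = - (b * (a - 1) * Qf r) - b * (3 * (r + 3/4) / (2 * r * (r + 9/4)))"
      by (simp only: rate_b_def right_diff_distrib left_diff_distrib)
    have "\<bar>- U - V\<bar> \<le> 2 * K" if "\<bar>U\<bar> \<le> K" "\<bar>V\<bar> \<le> K" for U V K :: real
      using that by linarith
    from this[OF 1 2] show ?thesis unfolding rate .
  qed
  have A1A2: "A1 \<le> 2 * A2"
  proof -
    have "A1\<^sup>2 \<le> 2 * A2\<^sup>2" using bounds(1) by (simp add: A1_def A2_def)
    also have "\<dots> \<le> (2 * A2)\<^sup>2" by (simp add: power_mult_distrib)
    finally have "A1\<^sup>2 \<le> (2 * A2)\<^sup>2" .
    then show ?thesis by (rule power2_le_imp_le) (use pos in simp)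
  qed
  have e1: "\<bar>Acf 1 t * rate_a r a b * ?w 0 1\<bar> \<le> 5 * ?S"
  proof (rule prod[OF w01])
    have "A1 * \<bar>rate_a r a b\<bar> \<le> A1 * (5 * ?S)" using ra pos by (intro mult_left_mono) auto
    then show "\<bar>Acf 1 t * rate_a r a b\<bar> \<le> 5 * ?S * A1"
      using pos(1) unfolding A1_def[symmetric] abs_mult by (simp only: abs_of_pos mult.commute)
  qed (rule pos)
  have rbA: "\<bar>A1 * rate_b r a b\<bar> \<le> 4 * ?S * A2"
  proof -
    have "A1 * \<bar>rate_b r a b\<bar> \<le> (2 * A2) * (2 * ?S)"
      using A1A2 rb pos by (intro mult_mono) auto
    then show ?thesis using pos by (simp add: abs_mult mult_ac)
  qed
  have e2: "\<bar>Acf 1 t * rate_b r a b * ?w 0 2\<bar> \<le> 4 * ?S"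
    "\<bar>Acf 1 t * rate_b r a b * ?w 0 3\<bar> \<le> 4 * ?S"
    by (rule prod[OF w02], use rbA pos in \<open>simp_all add: A1_def\<close>) (rule prod[OF w03], use rbA pos in \<open>simp_all add: A1_def\<close>)
  have e3: "\<bar>(b\<^sup>2 - a) * (2 * ?w 2 3)\<bar> \<le> 3 * ?S"
    by (rule prod[OF w23]) (use ab pos in auto)
  have e4: "\<bar>a * (2 * ?w 5 6)\<bar> \<le> 2 * ?S"
    by (rule prod[OF w56]) (use aB pos in auto)
  have ba': "\<bar>a * b - b\<bar> \<le> ?S * (A1 * A2)"
    using ba[of "A1 * A2"] bounds(9) pos by (simp add: A1_def A2_def algebra_simps)
  have e5: "\<bar>(a * b - b) * (2 * ?w 3 1)\<bar> \<le> ?S"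
    "\<bar>(a * b - b) * (2 * ?w 1 2)\<bar> \<le> ?S"
    by (rule prod[OF w31 ba'], use pos in simp) (rule prod[OF w12 ba'], use pos in simp)
  have bB: "\<bar>b\<bar> \<le> ?S * (B1 * B2)"
    using mult_mono[OF order_trans[OF bounds(5) CC(4)] A2B2(2)] bounds(4) by simp
  have e6: "\<bar>b * (2 * ?w 6 4)\<bar> \<le> ?S"
    "\<bar>b * (2 * ?w 4 5)\<bar> \<le> ?S"
    by (rule prod[OF w64 bB], use pos in simp) (rule prod[OF w45 bB], use pos in simp)
  define F where "F = curv_form a b (Acf 1 t * rate_a r a b) (Acf 1 t * rate_b r a b) x v"
  have comp: "\<bar>F $ 1\<bar> \<le> K" "\<bar>F $ 2\<bar> \<le> K" "\<bar>F $ 3\<bar> \<le> K"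
  proof -
    have "F $ 1 = Acf 1 t * rate_a r a b * ?w 0 1 + (b\<^sup>2 - a) * (2 * ?w 2 3)
        - a * (2 * ?w 5 6)"
      by (simp add: F_def curv_form_def)
    then show "\<bar>F $ 1\<bar> \<le> K" using e1 e3 e4 unfolding K_def by linarith
    have "F $ 2 = Acf 1 t * rate_b r a b * ?w 0 2 + (a * b - b) * (2 * ?w 3 1)
        - b * (2 * ?w 6 4)"
      by (simp add: F_def curv_form_def)
    then show "\<bar>F $ 2\<bar> \<le> K" using e2(1) e5(1) e6(1) zero_le_power2[of "1 + C"] unfolding K_def by linarith
    have "F $ 3 = Acf 1 t * rate_b r a b * ?w 0 3 + (a * b - b) * (2 * ?w 1 2)
        - b * (2 * ?w 4 5)"
      by (simp add: F_def curv_form_def)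
    then show "\<bar>F $ 3\<bar> \<le> K" using e2(2) e5(2) e6(2) zero_le_power2[of "1 + C"] unfolding K_def by linarith
  qed
  have "norm F \<le> \<bar>F $ 1\<bar> + \<bar>F $ 2\<bar> + \<bar>F $ 3\<bar>"
    using norm_le_l1_cart[of F] by (simp add: sum_3)
  then show ?thesis
    using comp zero_le_power2[of "1 + C"] unfolding F_def[symmetric, unfolded r_def] K_def by (simp add: F_def r_def)
qed

subsection \<open>Instantons and solutions of the differential equation\<close>

text \<open>On these vectors the vanishing of the 6-form becomes the vanishing of its scalar
  coefficient.\<close>

lemma base_dual_vectors:
  fixes t :: real
  assumes t: "t > 0"
  defines "x \<equiv> ((t, 0), (1, 0)) :: amb"
  shows "\<exists>v. (\<forall>i. v i \<in> tangent x) \<and> alti (coframe x) [0, 1, 2, 3, 5, 6] v = 1"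
    and "\<exists>v. (\<forall>i. v i \<in> tangent x) \<and> alti (coframe x) [0, 1, 2, 3, 4, 6] v = 1"
proof -
  define e where "e s P m = (((s, t *\<^sub>R (P + m)), (0, 2 *\<^sub>R m)) :: amb)" for s P m
  note cf = base_coframe[OF t, folded x_def e_def]
  have tan: "e s P m \<in> tangent x" for s P m by (simp add: e_def x_def tangent_def)
  define w where "w k = (\<lambda>i::nat. if i = 0 then e 1 0 0 else if i = 1 then e 0 (axis 1 1) 0
      else if i = 2 then e 0 (axis 2 1) 0 else if i = 3 then e 0 (axis 3 1) 0
      else if i = 4 then e 0 0 (axis k 1) else e 0 0 (axis 3 1))" for k :: 3
  have six: "s < Suc (Suc (Suc (Suc (Suc (Suc 0))))) \<longleftrightarrow> s = 0 \<or> s = 1 \<or> s = 2 \<or> s = 3 \<or> s = 4 \<or> s = 5" for s :: nat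
    by auto
  have tw: "w k i \<in> tangent x" for k i by (simp add: w_def tan)
  have "alti (coframe x) [0, 1, 2, 3, 5, 6] (w 2) = 1"
    unfolding alti_def
  proof (rule alt_dual)
    fix s j assume "s < length (map (coframe x) [0, 1, 2, 3, 5, 6])" "j < length (map (coframe x) [0, 1, 2, 3, 5, 6])"
    then have "s = 0 \<or> s = 1 \<or> s = 2 \<or> s = 3 \<or> s = 4 \<or> s = 5" "j = 0 \<or> j = 1 \<or> j = 2 \<or> j = 3 \<or> j = 4 \<or> j = 5"
      by (auto simp: six)
    then show "(map (coframe x) [0, 1, 2, 3, 5, 6] ! s) (w 2 j) = (if s = j then 1 else 0)"
      by (elim disjE) (simp_all add: w_def cf axis_def del: One_nat_def)
  qed
  then show "\<exists>v. (\<forall>i. v i \<in> tangent x) \<and> alti (coframe x) [0, 1, 2, 3, 5, 6] v = 1" using tw by blast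
  have "alti (coframe x) [0, 1, 2, 3, 4, 6] (w 1) = 1"
    unfolding alti_def
  proof (rule alt_dual)
    fix s j assume "s < length (map (coframe x) [0, 1, 2, 3, 4, 6])" "j < length (map (coframe x) [0, 1, 2, 3, 4, 6])"
    then have "s = 0 \<or> s = 1 \<or> s = 2 \<or> s = 3 \<or> s = 4 \<or> s = 5" "j = 0 \<or> j = 1 \<or> j = 2 \<or> j = 3 \<or> j = 4 \<or> j = 5"
      by (auto simp: six)
    then show "(map (coframe x) [0, 1, 2, 3, 4, 6] ! s) (w 1 j) = (if s = j then 1 else 0)"
      by (elim disjE) (simp_all add: w_def cf axis_def del: One_nat_def)
  qed
  then show "\<exists>v. (\<forall>i. v i \<in> tangent x) \<and> alti (coframe x) [0, 1, 2, 3, 4, 6] v = 1" using tw by blast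
qed

lemma wedge_curvature:
  assumes A: "\<And>x v. x \<in> M \<Longrightarrow> norm (fst x) \<in> J \<Longrightarrow> v \<in> tangent x \<Longrightarrow> A x v = abform a b x v"
    and J: "open J" "J \<subseteq> {0<..}" "norm (fst x) \<in> J"
    and ab: "(a has_real_derivative a') (at (norm (fst x)))" "(b has_real_derivative b') (at (norm (fst x)))"
    and x: "x \<in> M" and v: "\<And>i. i < 6 \<Longrightarrow> v i \<in> tangent x"
  shows "wedge 2 4 (curvature A x) (psi x) v =
    wedge 2 4 (curv_form (a (norm (fst x))) (b (norm (fst x))) a' b' x) (psi x) v"
proof (rule wedge_cong)
  fix \<sigma> :: "nat \<Rightarrow> nat" assume s: "\<sigma> permutes {..<2 + 4}"
  then have "\<sigma> i < 6" if "i < 6" for i using permutes_in_image[OF s, of i] that by auto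
  then have "v (\<sigma> 0) \<in> tangent x" "v (\<sigma> 1) \<in> tangent x" using v by auto
  then show "curvature A x (\<lambda>i. v (\<sigma> i)) = curv_form (a (norm (fst x))) (b (norm (fst x))) a' b' x (\<lambda>i. v (\<sigma> i))"
    by (intro curvature_abform[where A = A and J = J, OF A J ab x])
qed (rule refl)

text \<open>The coefficients are differentiable because they can be recovered from the smooth
  pulled-back connection along a ray. Evaluating the instanton equation on dual vectors at a point
  of the ray then gives the two scalar equations.\<close>

lemma instanton_ode:
  assumes inst: "G2_instanton_on (tube \<epsilon>) A"
    and A: "\<And>x v. x \<in> tube \<epsilon> \<Longrightarrow> fst x \<noteq> 0 \<Longrightarrow> v \<in> tangent x \<Longrightarrow> A x v = abform a b x v"
    and t: "0 < t" "t < \<epsilon>"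
  shows "a_ode a b t"
    and "b_ode a b t"
proof -
  define J where "J = {0<..<\<epsilon>}"
  have J: "open J" "J \<subseteq> {0<..}" "t \<in> J" using t by (auto simp: J_def)
  have AJ: "A x v = abform a b x v" if "x \<in> M" "norm (fst x) \<in> J" "v \<in> tangent x" for x v
    using A[of x v] that by (auto simp: tube_def J_def)
  define \<gamma> where "\<gamma> s = (((s, 0), (1, 0)) :: amb)" for s
  have \<gamma>: "(\<gamma> has_derivative (\<lambda>s. ((s, 0), (0, 0)))) (at t)"
    unfolding \<gamma>_def by (intro has_derivative_Pair has_derivative_ident has_derivative_const)
  \<comment> \<open>Along the ray, \<open>mu\<close> sends this constant vector to \<open>s\<close>
    times \<open>axis i 1\<close>, so the connection has the component \<open>a s / s\<close> or
    \<open>b s / s\<close>; the factor \<open>s\<close> in front restores the coefficient.\<close>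
  have coef: "\<exists>c'. ((\<lambda>s. s * (retr_pull A (\<gamma> s) ((0, axis i 1), (0, 0)) $ i)) has_real_derivative c') (at t)" for i :: 3
  proof -
    have "smooth_on {y. snd y \<noteq> 0 \<and> retr y \<in> tube \<epsilon>} (\<lambda>y. retr_pull A y ((0, axis i 1), (0, 0)))"
      using inst by (auto simp: G2_instanton_on_def connection_on_def)
    then have "Ck_on (Suc 0) {y. snd y \<noteq> 0 \<and> retr y \<in> tube \<epsilon>} (\<lambda>y. retr_pull A y ((0, axis i 1), (0, 0)))"
      unfolding smooth_on_def by blast
    moreover have "snd (\<gamma> t) \<noteq> 0 \<and> retr (\<gamma> t) \<in> tube \<epsilon>"
      using t by (simp add: \<gamma>_def retr_def tube_def M_def zero_prod_def)
    ultimately have "(\<lambda>y. retr_pull A y ((0, axis i 1), (0, 0))) differentiable (at (\<gamma> t))"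
      unfolding Ck_on.simps by blast
    then have "((\<lambda>s. retr_pull A (\<gamma> s) ((0, axis i 1), (0, 0))) differentiable (at t))"
      using \<gamma> by (auto simp: differentiable_def intro: has_derivative_compose)
    then have "(\<lambda>s. retr_pull A (\<gamma> s) ((0, axis i 1), (0, 0)) $ i) differentiable (at t)"
      using bounded_linear.has_derivative[OF bounded_linear_vec_nth] by (fastforce simp: differentiable_def)
    then have "(\<lambda>s. s * (retr_pull A (\<gamma> s) ((0, axis i 1), (0, 0)) $ i)) differentiable (at t)"
      by (intro differentiable_mult differentiable_ident)
    then show ?thesis by (auto simp: real_differentiable_def)
  qed
  have coef_eq: "s * (retr_pull A (\<gamma> s) ((0, axis i 1), (0, 0)) $ i) = (if i = 1 then a s else b s)" if "s \<in> J" for i s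
  proof -
    have s: "s > 0" using that by (simp add: J_def)
    have "retr_pull A (\<gamma> s) ((0, axis i 1), (0, 0)) = diag_abb (a s / s\<^sup>2) (b s / s\<^sup>2) (mu (\<gamma> s) ((0, axis i 1), (0, 0)))"
      using retr_pull_abform[where A = A and y = "\<gamma> s" and J = J, OF AJ _ J(2)] that s
      by (simp add: \<gamma>_def zero_prod_def)
    also have "mu (\<gamma> s) ((0, axis i 1), (0, 0)) = s *\<^sub>R axis i 1"
      by (simp add: mu_def \<gamma>_def qmul_eq qcnj_eq)
    finally show ?thesis
      using s exhaust_3[of i] by (auto simp: axis_def power2_eq_square)
  qed
  have "\<exists>c'. ((\<lambda>s. if i = 1 then a s else b s) has_real_derivative c') (at t)" for i :: 3
  proof -
    obtain c' where "((\<lambda>s. s * (retr_pull A (\<gamma> s) ((0, axis i 1), (0, 0)) $ i)) has_real_derivative c') (at t)"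
      using coef by blast
    then have "((\<lambda>s. if i = 1 then a s else b s) has_real_derivative c') (at t)"
      by (rule has_field_derivative_transform_within_open[OF _ J(1,3)]) (rule coef_eq)
    then show ?thesis by blast
  qed
  from this[of 1] this[of 2] obtain a' b'
    where ab: "(a has_real_derivative a') (at t)" "(b has_real_derivative b') (at t)" by auto
  define x where "x = \<gamma> t"
  have n: "norm (fst x) = t" using t by (simp add: x_def \<gamma>_def)
  have Jx: "norm (fst x) \<in> J" and abx: "(a has_real_derivative a') (at (norm (fst x)))"
    "(b has_real_derivative b') (at (norm (fst x)))"
    using J(3) ab by (simp_all only: n)
  have xM: "x \<in> M" and xt: "x \<in> tube \<epsilon>" and x0: "fst x \<noteq> 0"
    using t by (auto simp: x_def \<gamma>_def M_def tube_def zero_prod_def)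
  have zero: "wedge 2 4 (curv_form (a t) (b t) a' b' x) (psi x) v = 0" if "\<And>i. v i \<in> tangent x" for v
  proof -
    have "wedge 2 4 (curvature A x) (psi x) v = 0"
      using inst xt x0 that by (simp add: G2_instanton_on_def)
    then show ?thesis
      using wedge_curvature[where A = A and J = J and x = x and v = v, OF AJ J(1,2) Jx abx xM that] by (simp add: n)
  qed
  obtain v where v: "\<And>i. v i \<in> tangent x" "alti (coframe x) [0, 1, 2, 3, 5, 6] v = 1"
    using base_dual_vectors(1)[OF t(1), folded \<gamma>_def] by (auto simp: x_def)
  have "defect_a t (a t) (b t) a' = 0"
    using wedge_curv_form_psi(1)[of "a t" "b t" a' b' x v] zero[of v] v by (simp add: n)
  then have "a' = Acf 1 t * rate_a (r_of_t t) (a t) (b t)"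
    using rate_a_iff[OF t(1)] by (simp add: defect_a_def)
  then show "a_ode a b t" using ab(1) by simp
  obtain v where v: "\<And>i. v i \<in> tangent x" "alti (coframe x) [0, 1, 2, 3, 4, 6] v = 1"
    using base_dual_vectors(2)[OF t(1), folded \<gamma>_def] by (auto simp: x_def)
  have "defect_b t (a t) (b t) b' = 0"
    using wedge_curv_form_psi(2)[of "a t" "b t" a' b' x v] zero[of v] v Acf_pos[OF t(1), of 2] by (simp add: n)
  then have "b' = Acf 1 t * rate_b (r_of_t t) (a t) (b t)"
    using rate_b_iff[OF t(1)] by (simp add: defect_b_def)
  then show "b_ode a b t" using ab(2) by simp
qed

lemma ode_instanton:
  assumes A: "\<And>x v. x \<in> M \<Longrightarrow> norm (fst x) \<in> {0<..} \<Longrightarrow> v \<in> tangent x \<Longrightarrow> A x v = abform a b x v"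
    and a: "\<And>t. 0 < t \<Longrightarrow> a_ode a b t"
    and b: "\<And>t. 0 < t \<Longrightarrow> b_ode a b t"
    and x: "x \<in> M" "fst x \<noteq> 0" and v: "\<And>i. i < 6 \<Longrightarrow> v i \<in> tangent x"
  shows "wedge 2 4 (curvature A x) (psi x) v = 0"
proof -
  let ?t = "norm (fst x)"
  have t: "?t > 0" using x by simp
  have "defect_a ?t (a ?t) (b ?t) (Acf 1 ?t * rate_a (r_of_t ?t) (a ?t) (b ?t)) = 0"
    "defect_b ?t (a ?t) (b ?t) (Acf 1 ?t * rate_b (r_of_t ?t) (a ?t) (b ?t)) = 0"
    using rate_a_iff[OF t] rate_b_iff[OF t] by (simp_all add: defect_a_def defect_b_def)
  then show ?thesis
    using wedge_curvature[where A = A and J = "{0<..}", OF A _ _ _ a[OF t] b[OF t] x(1) v] t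
    by (simp add: vec_eq_iff forall_3 wedge_curv_form_psi)
qed

subsection \<open>Smoothness of the extension\<close>

lemma open_off_axes: "open {y :: amb. fst y \<noteq> 0 \<and> snd y \<noteq> 0}"
proof -
  have "{y :: amb. fst y \<noteq> 0 \<and> snd y \<noteq> 0} = {y. norm (fst y) \<in> {0<..} \<and> snd y \<noteq> 0}" by auto
  then show ?thesis using open_norm_fst[of "{0<..}"] by simp
qed

context
  fixes S :: "amb set"
  assumes S: "open S" "\<And>y. y \<in> S \<Longrightarrow> fst y \<noteq> 0" "\<And>y. y \<in> S \<Longrightarrow> snd y \<noteq> 0"
begin

lemma Ck_on_norm_fst: "Ck_on n S (\<lambda>y. norm (fst y))"
proof -
  have "Ck_on n S (\<lambda>y. sqrt (fst y \<bullet> fst y))"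
    by (intro Ck_on_sqrt[OF S(1)] Ck_on_inner[OF S(1)] Ck_on_linear[OF S(1)] bounded_linear_fst)
       (simp add: S(2))
  then show ?thesis by (simp add: norm_eq_sqrt_inner)
qed

lemma Ck_on_mu: "Ck_on n S (\<lambda>y. mu y w)"
proof -
  note L = Ck_on_linear[OF S(1)] and C = Ck_on_const[OF S(1)] and B = Ck_on_bilinear[OF S(1) bounded_bilinear_qmul]
  have p: "Ck_on n S (\<lambda>y. qcnj (fst y))"
    by (intro L bounded_linear_compose[OF bounded_linear_qcnj] bounded_linear_fst)
  have f: "Ck_on n S fst" and s: "Ck_on n S snd" by (intro L bounded_linear_fst bounded_linear_snd)+
  have "Ck_on n S (\<lambda>y. snd (qmul (qcnj (fst y)) (fst w)))"
    by (rule Ck_on_compose_linear[OF S(1) bounded_linear_snd B[OF p C]])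
  moreover have "Ck_on n S (\<lambda>y. snd (qmul (qmul (qcnj (fst y)) (qmul (snd y) (qcnj (snd w)))) (fst y)))"
    by (rule Ck_on_compose_linear[OF S(1) bounded_linear_snd B[OF B[OF p B[OF s C]] f]])
  moreover have "Ck_on n S (\<lambda>y. 1/2 * inverse (snd y \<bullet> snd y))"
    by (intro Ck_on_mult[OF S(1)] C Ck_on_inverse[OF S(1)] Ck_on_inner[OF S(1)] s) (simp add: S(3))
  ultimately show ?thesis
    unfolding mu_def[abs_def] by (intro Ck_on_add[OF S(1)] Ck_on_scaleR[OF S(1)])
qed

text \<open>Off \<open>p = 0\<close> the radius is smooth, so by the chain rule a radial function is
  one order more regular than its derivative. This is the gain in the bootstrap below.\<close>

lemma Ck_on_radial_Suc:
  assumes h: "\<And>t. 0 < t \<Longrightarrow> (h has_real_derivative h' t) (at t)"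
    and h': "Ck_on n S (\<lambda>y. h' (norm (fst y)))"
  shows "Ck_on (Suc n) S (\<lambda>y. h (norm (fst y)))"
proof (rule Ck_on_SucI[OF S(1)])
  fix x assume "x \<in> S"
  then have p: "fst x \<noteq> 0" by (rule S(2))
  then show "((\<lambda>y. h (norm (fst y))) has_derivative (\<lambda>v. (fst x \<bullet> fst v) / norm (fst x) * h' (norm (fst x)))) (at x)"
    by (intro DERIV_compose_FDERIV[where f = h, OF h norm_fst_has_derivative]) simp_all
next
  fix v
  have "Ck_on n S (\<lambda>x. fst x \<bullet> fst v)"
    by (intro Ck_on_inner[OF S(1)] Ck_on_linear[OF S(1)] bounded_linear_fst Ck_on_const[OF S(1)])
  then show "Ck_on n S (\<lambda>x. (fst x \<bullet> fst v) / norm (fst x) * h' (norm (fst x)))"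
    by (intro Ck_on_mult[OF S(1)] Ck_on_divide[OF S(1)] Ck_on_norm_fst h') (simp_all add: S(2))
qed

text \<open>Bootstrapping: the right-hand sides of the differential equations for \<open>r_of_t\<close>, \<open>Y\<close> and
  \<open>D\<close> are smooth functions of these three, so every gain of regularity feeds back.\<close>

lemma Ck_on_solution:
  assumes Y: "\<And>t. 0 < t \<Longrightarrow> Y_ode Y D t"
    and D: "\<And>t. 0 < t \<Longrightarrow> D_ode Y D t"
  shows "Ck_on n S (\<lambda>y. r_of_t (norm (fst y)))" "Ck_on n S (\<lambda>y. Y (norm (fst y)))" "Ck_on n S (\<lambda>y. D (norm (fst y)))"
proof -
  have r: "r_of_t (norm (fst y)) > 9/4" if "y \<in> S" for y
    using r_of_t_gt[of "norm (fst y)"] S(2)[OF that] by simp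
  have "Ck_on n S (\<lambda>y. r_of_t (norm (fst y))) \<and> Ck_on n S (\<lambda>y. Y (norm (fst y))) \<and> Ck_on n S (\<lambda>y. D (norm (fst y)))"
  proof (induction n)
    case 0
    have c: "continuous_on S (\<lambda>y. h (norm (fst y)))" if "\<And>t. 0 < t \<Longrightarrow> isCont h t" for h :: "real \<Rightarrow> real"
    proof -
      have "continuous_on {0<..} h" using that by (intro continuous_at_imp_continuous_on) auto
      moreover have "(\<lambda>y. norm (fst y)) ` S \<subseteq> {0<..}"
        unfolding image_subset_iff greaterThan_iff zero_less_norm_iff using S(2) by blast
      ultimately show ?thesis
        by (rule continuous_on_compose2[OF _ continuous_on_norm[OF continuous_on_fst[OF continuous_on_id]]])
    qed
    show ?case
      using c[of r_of_t] c[of Y] c[of D] DERIV_isCont[OF r_of_t_deriv] DERIV_isCont[OF Y] DERIV_isCont[OF D] by auto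
  next
    case (Suc n)
    note R = Suc[THEN conjunct1] and Y' = Suc[THEN conjunct2, THEN conjunct1] and D' = Suc[THEN conjunct2, THEN conjunct2]
    note add = Ck_on_add[OF S(1)] and diff = Ck_on_diff[OF S(1)] and const = Ck_on_const[OF S(1)] and mult = Ck_on_mult[OF S(1)]
    have A: "Ck_on n S (\<lambda>y. Acf 1 (norm (fst y)))"
      unfolding Acf_def Let_def simp_thms if_True
      by (intro Ck_on_divide[OF S(1)] Ck_on_sqrt[OF S(1)] mult diff add const R; use r in force)
    have dec: "Ck_on n S (\<lambda>y. decay (r_of_t (norm (fst y))))"
      unfolding decay_def
      by (intro Ck_on_divide[OF S(1)] Ck_on_power[OF S(1)] mult diff add const R; use r in force)
    show ?case
      by (intro conjI Ck_on_radial_Suc[of r_of_t, OF r_of_t_deriv] Ck_on_radial_Suc[of Y, OF Y] Ck_on_radial_Suc[of D, OF D]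
          A Ck_on_minus[OF S(1)] mult dec Ck_on_power[OF S(1)] Y' D')
  qed
  then show "Ck_on n S (\<lambda>y. r_of_t (norm (fst y)))" "Ck_on n S (\<lambda>y. Y (norm (fst y)))" "Ck_on n S (\<lambda>y. D (norm (fst y)))"
    by blast+
qed

lemma Ck_on_abform:
  assumes Y: "\<And>t. 0 < t \<Longrightarrow> Y_ode Y D t"
    and D: "\<And>t. 0 < t \<Longrightarrow> D_ode Y D t"
  defines "a \<equiv> \<lambda>t. (1 + Y t) / Qf (r_of_t t)" and "b \<equiv> \<lambda>t. D t / Wf (r_of_t t)"
  shows "Ck_on n S (\<lambda>y. diag_abb (a (norm (fst y)) / (norm (fst y))\<^sup>2) (b (norm (fst y)) / (norm (fst y))\<^sup>2) (mu y w))"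
proof -
  have r: "r_of_t (norm (fst y)) > 9/4" if "y \<in> S" for y
    using r_of_t_gt[of "norm (fst y)"] S(2)[OF that] by simp
  note add = Ck_on_add[OF S(1)] and diff = Ck_on_diff[OF S(1)] and const = Ck_on_const[OF S(1)] and mult = Ck_on_mult[OF S(1)]
  note sol = Ck_on_solution[OF Y D]
  have Q: "Ck_on n S (\<lambda>y. Qf (r_of_t (norm (fst y))))"
    unfolding Qf_def by (intro Ck_on_divide[OF S(1)] mult diff add const sol(1); use r in force)
  have W: "Ck_on n S (\<lambda>y. Wf (r_of_t (norm (fst y))))"
    unfolding Wf_def by (intro Ck_on_divide[OF S(1)] Ck_on_power[OF S(1)] Ck_on_sqrt[OF S(1)] mult diff add const sol(1); use r in force)
  have a: "Ck_on n S (\<lambda>y. a (norm (fst y)) / (norm (fst y))\<^sup>2)"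
    unfolding a_def
    by (intro Ck_on_divide[OF S(1)] Ck_on_power[OF S(1)] add const sol(2) Q Ck_on_norm_fst)
       (use S(2) less_imp_neq[OF Qf_pos[OF r]] in force)+
  have b: "Ck_on n S (\<lambda>y. b (norm (fst y)) / (norm (fst y))\<^sup>2)"
    unfolding b_def
    by (intro Ck_on_divide[OF S(1)] Ck_on_power[OF S(1)] sol(3) W Ck_on_norm_fst)
       (use S(2) less_imp_neq[OF Wf_pos[OF r]] in force)+
  show ?thesis
    by (subst diag_abb_split)
       (intro add Ck_on_scaleR[OF S(1)] a b Ck_on_compose_linear[OF S(1) bounded_linear_diag_abb] Ck_on_mu)
qed

end

section \<open>Bounded curvature of global solutions\<close>

lemma bounded_curvature_solution:
  assumes A: "\<And>x v. x \<in> M \<Longrightarrow> norm (fst x) \<in> {0<..} \<Longrightarrow> v \<in> tangent x \<Longrightarrow> A x v = abform a b x v"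
    and a: "\<And>t. 0 < t \<Longrightarrow> a_ode a b t"
    and b: "\<And>t. 0 < t \<Longrightarrow> b_ode a b t"
    and ab: "a = (\<lambda>t. (1 + Y t) / Qf (r_of_t t))" "b = (\<lambda>t. D t / Wf (r_of_t t))"
    and YD: "\<And>t. 0 < t \<Longrightarrow> 0 \<le> Y t \<and> Y t \<le> C \<and> 0 \<le> D t \<and> D t \<le> C"
  shows "bounded_curvature_on M A"
  unfolding bounded_curvature_on_def
proof (intro exI ballI impI allI)
  fix x e assume x: "x \<in> M" "fst x \<noteq> 0" and e: "orthonormal_frame x e"
  let ?K = "100 * (1 + C)\<^sup>2"
  define t where "t = norm (fst x)"
  have t: "t > 0" using x by (simp add: t_def)
  have bound: "norm (curvature A x (\<lambda>n. if n = 0 then e i else e j)) \<le> ?K" if "i < 7" "j < 7" for i j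
  proof -
    define v where "v = (\<lambda>n::nat. if n = 0 then e i else e j)"
    have v: "v 0 \<in> tangent x" "v 1 \<in> tangent x" "gmetric x (v 0) (v 0) = 1" "gmetric x (v 1) (v 1) = 1"
      using e that by (auto simp: orthonormal_frame_def v_def)
    have "curvature A x v = curv_form (a t) (b t) (Acf 1 t * rate_a (r_of_t t) (a t) (b t))
        (Acf 1 t * rate_b (r_of_t t) (a t) (b t)) x v"
      unfolding t_def
      by (rule curvature_abform[where A = A and J = "{0<..}", OF A _ _ _ a b x(1) v(1,2)]) (use x in auto)
    also have "norm \<dots> \<le> ?K"
      unfolding ab t_def using YD[OF t] x by (intro curv_form_bound v) (simp_all add: t_def)
    finally show ?thesis by (simp add: v_def)
  qed
  have K: "?K \<ge> 0" by simp
  have "(\<Sum>j<7. \<Sum>i<j. (norm (curvature A x (\<lambda>n. if n = 0 then e i else e j)))\<^sup>2) \<le> (\<Sum>j<7::nat. \<Sum>i<j. ?K\<^sup>2)"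
    by (intro sum_mono power_mono bound) auto
  \<comment> \<open>The double sum has 21 terms; 49 makes the bound a perfect square.\<close>
  also have "\<dots> \<le> (7 * ?K)\<^sup>2"
  proof -
    have "(\<Sum>j<7::nat. \<Sum>i<j. c) \<le> 49 * c" if "0 \<le> c" for c :: real
      using that by (simp add: numeral_eq_Suc)
    from this[of "?K\<^sup>2"] show ?thesis by (simp only: power_mult_distrib[of 7 ?K]) simp
  qed
  finally have "sqrt (\<Sum>j<7. \<Sum>i<j. (norm (curvature A x (\<lambda>n. if n = 0 then e i else e j)))\<^sup>2) \<le> sqrt ((7 * ?K)\<^sup>2)"
    by (rule real_sqrt_le_mono)
  also have "sqrt ((7 * ?K)\<^sup>2) = 7 * ?K" using K by (intro real_sqrt_unique) auto
  finally show "norm_form2 e (curvature A x) \<le> 7 * ?K"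
    unfolding norm_form2_def .
qed

subsection \<open>Global existence\<close>

theorem theorem9:
  fixes A :: conn and f g :: "real \<Rightarrow> real" and \<epsilon> f1 g1 :: real
  assumes "\<epsilon> > 0"
    and "G2_instanton_on (tube \<epsilon>) A"
    and "invariant_on (tube \<epsilon>) A"
    and "\<And>x v. x \<in> tube \<epsilon> \<Longrightarrow> fst x \<noteq> 0 \<Longrightarrow> v \<in> tangent x \<Longrightarrow> A x v = ansatz f g x v"
    and "(\<lambda>t. f t - f1 * t) \<in> O[at_right 0](\<lambda>t. t ^ 3)"
    and "(\<lambda>t. g t - g1 * t) \<in> O[at_right 0](\<lambda>t. t ^ 3)"
    and "f1 \<ge> 1/2 + g1" and "1/2 + g1 > 1/2"
  shows "\<exists>A'. G2_instanton_on M A' \<and> invariant_on M A' \<and> bounded_curvature_on M A' \<and>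
              (\<forall>x\<in>tube \<epsilon>. \<forall>v\<in>tangent x. A' x v = A x v)"
proof -
  define a0 where "a0 t = Acf 1 t * f t" for t
  define b0 where "b0 t = Acf 2 t * g t" for t
  have A: "A x v = abform a0 b0 x v" if "x \<in> tube \<epsilon>" "fst x \<noteq> 0" "v \<in> tangent x" for x v
    using assms(4)[OF that] by (simp add: ansatz_abform a0_def[abs_def] b0_def[abs_def])
  note ode = instanton_ode[where A = A, OF assms(2) A]
  note reduced = reduced_deriv[OF _ ode]
  note lim = reduced_limits[OF bigo_imp_slope[OF assms(5)] bigo_imp_slope[OF assms(6)], folded a0_def b0_def]
  have g1: "g1 > 0" using assms(8) by simp
  obtain Y D C where YD: "\<And>t. 0 < t \<Longrightarrow> Y_ode Y D t"
    "\<And>t. 0 < t \<Longrightarrow> D_ode Y D t"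
    "\<And>t. 0 < t \<Longrightarrow> t < \<epsilon> \<Longrightarrow> Y t = a0 t * Qf (r_of_t t) - 1 \<and> D t = b0 t * Wf (r_of_t t)"
    "\<And>t. 0 < t \<Longrightarrow> 0 \<le> Y t \<and> Y t \<le> C \<and> 0 \<le> D t \<and> D t \<le> C"
    by (rule solution_extends[of \<epsilon> "\<lambda>t. a0 t * Qf (r_of_t t) - 1" "\<lambda>t. b0 t * Wf (r_of_t t)", OF assms(1) _ _ lim])
       (use reduced g1 assms(7) in auto)
  define a where "a = (\<lambda>t. (1 + Y t) / Qf (r_of_t t))"
  define b where "b = (\<lambda>t. D t / Wf (r_of_t t))"
  have ab_ode: "a_ode a b t"
    "b_ode a b t" if "0 < t" for t
    unfolding a_def b_def by (rule reduced_deriv_inverse[OF that YD(1,2)[OF that]])+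
  have ab_eq: "a t = a0 t" "b t = b0 t" if "0 < t" "t < \<epsilon>" for t
    using YD(3)[OF that] Qf_pos[OF r_of_t_gt[OF that(1)]] Wf_pos[OF r_of_t_gt[OF that(1)]]
    by (simp_all add: a_def b_def)
  \<comment> \<open>Inside the tube nothing changes, so smoothness and invariance over the singular
    orbit are those of \<open>A\<close>.\<close>
  define A' where "A' x v = (if norm (fst x) < \<epsilon> then A x v else abform a b x v)" for x v
  have A': "A' x v = abform a b x v" if "x \<in> M" "norm (fst x) \<in> {0<..}" "v \<in> tangent x" for x v
    using A[of x v] that ab_eq[of "norm (fst x)"] by (auto simp: A'_def tube_def abform_def)
  have pull: "retr_pull A' y w = retr_pull A y w" if "norm (fst y) < \<epsilon>" for y w
    using that by (simp add: retr_pull_def A'_def)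
  have pull': "retr_pull A' y w =
      diag_abb (a (norm (fst y)) / (norm (fst y))\<^sup>2) (b (norm (fst y)) / (norm (fst y))\<^sup>2) (mu y w)"
    if "fst y \<noteq> 0" "snd y \<noteq> 0" for y w
    by (rule retr_pull_abform[where A = A' and J = "{0<..}", OF A']) (use that in auto)
  have conn: "connection_on (tube \<epsilon>) A" using assms(2) by (simp add: G2_instanton_on_def)
  have "connection_on M A'"
    unfolding connection_on_def
  proof (intro conjI ballI allI)
    fix x assume x: "x \<in> M"
    then have q: "snd x \<noteq> 0" by (cases x) (auto simp: M_def)
    show "linear (retr_pull A' x)"
    proof (cases "norm (fst x) < \<epsilon>")
      case True
      then have "retr_pull A' x = retr_pull A x" using pull by blast
      moreover have "x \<in> tube \<epsilon>" using x True by (simp add: tube_def)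
      ultimately show ?thesis using conn by (simp add: connection_on_def)
    next
      case False
      then have p: "fst x \<noteq> 0" using assms(1) by auto
      have "retr_pull A' x = (\<lambda>w. diag_abb (a (norm (fst x)) / (norm (fst x))\<^sup>2) (b (norm (fst x)) / (norm (fst x))\<^sup>2) (mu x w))"
        using pull'[OF p q] by blast
      moreover have "linear (mu x)"
        by (rule linearI) (simp_all add: mu_def qmul.add_right qmul.add_left qmul.scaleR_right qmul.scaleR_left
            linear_add[OF bounded_linear.linear[OF bounded_linear_qcnj]] qcnj_scaleR scaleR_add_right algebra_simps)
      ultimately show ?thesis
        using linear_compose[OF _ diag_abb_linear] by (simp add: o_def)
    qed
  next
    fix w
    \<comment> \<open>\<open>?S1\<close> contains the singular orbit and sees only \<open>A\<close>.
      \<open>?S2\<close> contains the points with \<open>|p| = \<epsilon>\<close>, where the case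
      distinction switches, and there the explicit formula holds on both sides.\<close>
    let ?S1 = "{y :: amb. norm (fst y) \<in> {..<\<epsilon>} \<and> snd y \<noteq> 0}"
    let ?S2 = "{y :: amb. fst y \<noteq> 0 \<and> snd y \<noteq> 0}"
    have o1: "open ?S1" by (rule open_norm_fst) simp
    have "Ck_on n ?S1 (\<lambda>y. retr_pull A' y w)" for n
    proof -
      have "{y. snd y \<noteq> 0 \<and> retr y \<in> tube \<epsilon>} = ?S1"
        using retr_in_M by (auto simp: tube_def)
      moreover have "Ck_on n {y. snd y \<noteq> 0 \<and> retr y \<in> tube \<epsilon>} (\<lambda>y. retr_pull A y w)"
        using conn unfolding connection_on_def smooth_on_def by blast
      ultimately have "Ck_on n ?S1 (\<lambda>y. retr_pull A y w)" by simp
      then show ?thesis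
        by (rule Ck_on_cong[OF o1, THEN iffD1, rotated]) (simp add: pull)
    qed
    moreover have "Ck_on n ?S2 (\<lambda>y. retr_pull A' y w)" for n
    proof -
      have "Ck_on n ?S2 (\<lambda>y. diag_abb (a (norm (fst y)) / (norm (fst y))\<^sup>2) (b (norm (fst y)) / (norm (fst y))\<^sup>2) (mu y w))"
        unfolding a_def b_def by (rule Ck_on_abform[OF open_off_axes _ _ YD(1,2)]) auto
      then show ?thesis
        by (rule Ck_on_cong[OF open_off_axes, THEN iffD1, rotated]) (simp add: pull')
    qed
    ultimately have "Ck_on n (?S1 \<union> ?S2) (\<lambda>y. retr_pull A' y w)" for n
      by (intro Ck_on_Un o1 open_off_axes)
    moreover have "{y. snd y \<noteq> 0 \<and> retr y \<in> M} = ?S1 \<union> ?S2"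
      using retr_in_M assms(1) by auto
    ultimately show "smooth_on {y. snd y \<noteq> 0 \<and> retr y \<in> M} (\<lambda>y. retr_pull A' y w)"
      by (simp add: smooth_on_def)
  qed
  then have inst: "G2_instanton_on M A'"
    unfolding G2_instanton_on_def using ode_instanton[where A = A', OF A' ab_ode] by blast
  have inv: "invariant_on M A'"
    unfolding invariant_on_def
  proof (intro ballI conjI allI impI)
    fix x v assume x: "x \<in> M" and v: "v \<in> tangent x"
    have q: "norm (snd x) = 1" using x by (cases x) (auto simp: M_def)
    have p: "fst x \<noteq> 0" if "\<not> norm (fst x) < \<epsilon>" using that assms(1) by auto
    have tb: "x \<in> tube \<epsilon>" if "norm (fst x) < \<epsilon>" using that x by (simp add: tube_def)
    \<comment> \<open>Both actions preserve \<open>norm (fst x)\<close> and hence the case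
      distinction. Inside the tube, including the singular orbit, the invariance of \<open>A\<close>
      applies; outside, that of the explicit formula.\<close>
    show "A' (su2_action b1 b2 x) (su2_action b1 b2 v) = A' x v" if "norm b1 = 1" "norm b2 = 1" for b1 b2
    proof -
      have "A (su2_action b1 b2 x) (su2_action b1 b2 v) = A x v" if "norm (fst x) < \<epsilon>"
        using assms(3) tb[OF that] v \<open>norm b1 = 1\<close> \<open>norm b2 = 1\<close> unfolding invariant_on_def by blast
      then show ?thesis
        using p q that abform_su2[of x b1 b2 a b v] by (simp add: A'_def su2_action_norm)
    qed
    show "A' (u1_action (expT1 \<theta>) x) (u1_action (expT1 \<theta>) v) = Ad (qcnj (expT1 \<theta>)) (A' x v)" for \<theta>
    proof -
      have "norm (fst (u1_action (expT1 \<theta>) x)) = norm (fst x)"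
        by (simp add: u1_action_eq norm_qmul norm_expT1)
      then show ?thesis
        using assms(3) tb v p q abform_u1[of x a b \<theta> v] unfolding invariant_on_def
        by (simp add: A'_def)
    qed
  qed
  have "bounded_curvature_on M A'"
    by (rule bounded_curvature_solution[where A = A', OF A' ab_ode a_def b_def YD(4)])
  moreover have "\<forall>x\<in>tube \<epsilon>. \<forall>v\<in>tangent x. A' x v = A x v"
    by (simp add: A'_def tube_def)
  ultimately show ?thesis using inst inv by blast
qed

end
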